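(* Let $f(t)\in\mathbb{Z}[t]$ be a nonconstant polynomial with discriminant $\Delta(f)\neq 0$ and let $k\ge 2$ be an integer. Then there exists $p_0$ (depending on $k$ and $f$) such that for every prime $p\equiv 1\pmod{k}$ with $p\ge p_0$ the following holds: for every subset $A\subseteq\mathbb{F}_p$ with $\#A\ge c(p,k,f)$, there exists a permutation (i.e. an enumeration of all elements without repetition) $a_1,a_2,\ldots,a_{\#A}$ of $A$ such that $$f(a_1+a_2),\ f(a_2+a_3),\ \ldots,\ f(a_{\#A-1}+a_{\#A}),\ f(a_{\#A}+a_1)\in D_k(\mathbb{F}_p).$$
   Context: $\mathbb{F}_p$ is the field with $p$ elements; $f$ is evaluated on $\mathbb{F}_p$ via reduction of its coefficients modulo $p$; $\#S$ is the cardinality of a set $S$. For $f$ of degree $n\ge1$ with leading coefficient $a_n$ and complex roots $\alpha_1,\ldots,\alpha_n$ (with multiplicity), $\Delta(f)=a_n^{2n-2}\prod_{1\le i<j\le n}(\alpha_j-\alpha_i)^2$ (empty product equal to $1$). For a prime $p\equiv1\pmod k$: $D_k(\mathbb{F}_p)=\{x^k: x\in\mathbb{F}_p^*\}$ is the set of nonzero $k$-th powers; $N(p,k,f)=\#\{x\in\mathbb{F}_p: f(x)\in D_k(\mathbb{F}_p)\}$; $\Lambda(p,k,f)=1+\frac{\deg(f)}{k}\left(1+(k-1)\sqrt{p}\right)$, where $\deg(f)$ is the degree of $f$ in $\mathbb{Z}[t]$; $c(p,k,f)=p+2-N(p,k,f)+\left\lfloor\frac{2p\Lambda(p,k,f)}{N(p,k,f)}\right\rfloor$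 (for $p\equiv 1 \pmod k$ sufficiently large, $N(p,k,f)>0$). *)

theory Defs
  imports
    "HOL-Number_Theory.Number_Theory"
    "HOL-Computational_Algebra.Computational_Algebra"
    "HOL-Combinatorics.Combinatorics"
begin

section \<open>The discriminant\<close>

abbreviation complex_of_int_poly :: "int poly \<Rightarrow> complex poly" where
  "complex_of_int_poly f \<equiv> map_poly of_int f"

text \<open>
  An arbitrary but fixed listing of the complex roots, with multiplicity. The value of the
  discriminant does not depend on the choice, see \<open>discrim_eq\<close> below.
\<close>

definition root_list :: "int poly \<Rightarrow> complex list" where
  "root_list f = (SOME as. mset as = proots (complex_of_int_poly f))"

definition discrim :: "int poly \<Rightarrow> complex" where
  "discrim f = of_int (lead_coeff f) ^ (2 * degree f - 2) *
     (\<Prod>(i, j) \<in> {(i, j). i < j \<and> j < degree f}. (root_list f ! j - root_list f ! i)\<^sup>2)"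


section \<open>The field with p elements\<close>

text \<open>The carrier is \<open>{0..p - 1}\<close>, a set of integers, with arithmetic modulo \<open>p\<close>.\<close>

abbreviation Fp :: "nat \<Rightarrow> int ring" where
  "Fp p \<equiv> residue_ring (int p)"

definition eval_Fp :: "nat \<Rightarrow> int poly \<Rightarrow> int \<Rightarrow> int" where
  "eval_Fp p f x =
     (\<Oplus>\<^bsub>Fp p\<^esub> i \<in> {..degree f}. (Polynomial.coeff f i mod int p) \<otimes>\<^bsub>Fp p\<^esub> (x [^]\<^bsub>Fp p\<^esub> i))"

definition D_powers :: "nat \<Rightarrow> nat \<Rightarrow> int set" where
  "D_powers k p = {x [^]\<^bsub>Fp p\<^esub> k | x. x \<in> carrier (Fp p) - {\<zero>\<^bsub>Fp p\<^esub>}}"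

definition N_count :: "nat \<Rightarrow> nat \<Rightarrow> int poly \<Rightarrow> nat" where
  "N_count p k f = card {x \<in> carrier (Fp p). eval_Fp p f x \<in> D_powers k p}"

definition Lambda_bound :: "nat \<Rightarrow> nat \<Rightarrow> int poly \<Rightarrow> real" where
  "Lambda_bound p k f = 1 + real (degree f) / real k * (1 + (real k - 1) * sqrt (real p))"

text \<open>
  Division by zero yields zero here, so \<open>N_count p k f = 0\<close> gives \<open>c_bound p k f = p + 2\<close>, which exceeds the
  cardinality of every subset of the field.
\<close>

definition c_bound :: "nat \<Rightarrow> nat \<Rightarrow> int poly \<Rightarrow> int" where
  "c_bound p k f = int p + 2 - int (N_count p k f) + \<lfloor>2 * real p * Lambda_bound p k f / real (N_count p k f)\<rfloor>"


section \<open>Consistency of the definitions\<close>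

lemma length_root_list: "length (root_list f) = degree f"
  and mset_root_list: "mset (root_list f) = proots (complex_of_int_poly f)"
proof -
  show *: "mset (root_list f) = proots (complex_of_int_poly f)"
    unfolding root_list_def by (rule someI_ex) (rule ex_mset)
  have "length (root_list f) = size (proots (complex_of_int_poly f))"
    by (metis * size_mset)
  also have "\<dots> = degree f"
    by (simp add: size_proots_complex degree_map_poly)
  finally show "length (root_list f) = degree f" .
qed

lemma prod_pairs_permute:
  fixes g :: "nat \<Rightarrow> nat \<Rightarrow> 'a :: comm_monoid_mult"
  assumes "\<sigma> permutes {..<n}" and sym: "\<And>i j. g i j = g j i"
  shows "(\<Prod>(i, j) \<in> {(i, j). i < j \<and> j < n}. g (\<sigma> i) (\<sigma> j)) =
         (\<Prod>(i, j) \<in> {(i, j). i < j \<and> j < n}. g i j)"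
proof -
  let ?P = "{(i, j). i < j \<and> j < n}"
  let ?h = "\<lambda>\<tau> (i, j). (min (\<tau> i) (\<tau> j), max (\<tau> i) (\<tau> j :: nat))"
  have step: "?h \<tau> z \<in> ?P \<and> ?h \<rho> (?h \<tau> z) = z"
    if t: "\<tau> permutes {..<n}" and inv: "\<And>i. \<rho> (\<tau> i) = i" and z: "z \<in> ?P" for \<tau> \<rho> z
  proof -
    obtain i j where ij: "z = (i, j)" "i < j" "j < n" using z by auto
    have "\<tau> i < n" "\<tau> j < n"
      using permutes_in_image[OF t, of i] permutes_in_image[OF t, of j] ij by auto
    moreover have "\<tau> i \<noteq> \<tau> j" using ij inv by (metis nat_neq_iff)
    ultimately show ?thesis using ij inv by (auto simp: min_def max_def)
  qed
  have inv: "inv_into UNIV \<sigma> permutes {..<n}" using assms(1) by (rule permutes_inv)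
  show ?thesis
  proof (rule prod.reindex_bij_witness[where i = "?h (inv_into UNIV \<sigma>)" and j = "?h \<sigma>"])
    fix z assume z: "z \<in> ?P"
    show "?h (inv_into UNIV \<sigma>) (?h \<sigma> z) = z" "?h \<sigma> z \<in> ?P"
      using step[OF assms(1) _ z, of "inv_into UNIV \<sigma>"] permutes_inverses[OF assms(1)] by auto
    show "?h \<sigma> (?h (inv_into UNIV \<sigma>) z) = z" "?h (inv_into UNIV \<sigma>) z \<in> ?P"
      using step[OF inv _ z, of "\<sigma>"] permutes_inverses[OF assms(1)] by auto
    show "(case ?h \<sigma> z of (i, j) \<Rightarrow> g i j) = (case z of (i, j) \<Rightarrow> g (\<sigma> i) (\<sigma> j))"
      using sym by (auto simp: min_def max_def split: prod.splits)
  qed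
qed

lemma discrim_eq:
  assumes "mset as = proots (complex_of_int_poly f)"
  shows "discrim f = of_int (lead_coeff f) ^ (2 * degree f - 2) *
     (\<Prod>(i, j) \<in> {(i, j). i < j \<and> j < degree f}. (as ! j - as ! i)\<^sup>2)"
proof -
  have "mset (root_list f) = mset as" using assms mset_root_list by simp
  then obtain \<sigma> where \<sigma>: "\<sigma> permutes {..<length as}" "permute_list \<sigma> as = root_list f"
    by (rule mset_eq_permutation)
  have len: "length as = degree f"
    using \<sigma>(2) length_root_list by (metis length_permute_list)
  have nth: "root_list f ! i = as ! \<sigma> i" if "i < degree f" for i
    using permute_list_nth[OF \<sigma>(1), of i] \<sigma>(2) len that by simp
  have "(\<Prod>(i, j) \<in> {(i, j). i < j \<and> j < degree f}. (root_list f ! j - root_list f ! i)\<^sup>2) =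
        (\<Prod>(i, j) \<in> {(i, j). i < j \<and> j < degree f}. (as ! \<sigma> j - as ! \<sigma> i)\<^sup>2)"
    by (rule prod.cong) (auto simp: nth)
  also have "\<dots> = (\<Prod>(i, j) \<in> {(i, j). i < j \<and> j < degree f}. (as ! j - as ! i)\<^sup>2)"
    using prod_pairs_permute[of \<sigma> "degree f" "\<lambda>i j. (as ! j - as ! i)\<^sup>2"] \<sigma>(1) len
    by (simp add: power2_commute)
  finally show ?thesis by (simp add: discrim_def)
qed

lemma eval_Fp_eq:
  assumes "prime p" and "x \<in> carrier (Fp p)"
  shows "eval_Fp p f x = poly f x mod int p"
proof -
  interpret residues_prime p "Fp p"
    using assms(1) by unfold_locales auto
  have x: "x mod int p = x"
    using assms(2) by (simp add: residue_ring_def)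
  have "(Polynomial.coeff f i mod int p) \<otimes>\<^bsub>Fp p\<^esub> (x [^]\<^bsub>Fp p\<^esub> i) =
        (Polynomial.coeff f i * x ^ i) mod int p" for i
    using pow_cong[of x i] x mult_cong[of "Polynomial.coeff f i" "x ^ i"] by simp
  then have "eval_Fp p f x = (\<Oplus>\<^bsub>Fp p\<^esub> i \<in> {..degree f}. (Polynomial.coeff f i * x ^ i) mod int p)"
    by (simp add: eval_Fp_def)
  also have "\<dots> = (\<Sum>i\<le>degree f. Polynomial.coeff f i * x ^ i) mod int p"
    by (rule sum_cong) simp
  finally show ?thesis by (simp add: poly_altdef)
qed

end

theory Submission
  imports Defs
begin

text \<open>
  Write \<open>S\<close> for the set of all \<open>y\<close> in \<open>\<int>/p\<close> with \<open>f(y)\<close> a nonzero \<open>k\<close>-th power, and \<open>N\<close> for its size.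
  The enumeration asked for is a Hamilton cycle in the graph on \<open>A\<close> that joins distinct \<open>u\<close> and \<open>v\<close>
  if \<open>u + v \<in> S\<close>. Two facts about \<open>S\<close> produce it:
  \<open>N\<close> is at least \<open>(1/k - \<epsilon>) p\<close>, and \<open>S \<inter> (S + t)\<close> has at most \<open>(1/k\<^sup>2 + \<epsilon>) p\<close> elements for each
  \<open>t \<noteq> 0\<close>, for a small constant \<open>\<epsilon>\<close> and all large \<open>p\<close>.

  From these facts to the cycle. By Cauchy-Schwarz, two disjoint sets of vertices of size \<open>\<eta> p\<close> have
  an edge between them (\<open>no_edges_inequality\<close>). Let \<open>A'\<close> be the complement of \<open>A\<close>. The bound \<open>c(p,k,f)\<close> gives
  \<open>|A'| \<le> N - 3\<close>, so each vertex has at least two neighbours; and a vertex \<open>v\<close> with few neighbours has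
  nearly all of \<open>S - v\<close> inside \<open>A'\<close>. Two such vertices \<open>v\<close> and \<open>v'\<close> would make \<open>(S - v) \<inter> (S - v')\<close> almost
  as large as \<open>S\<close>, against the second fact. So at most one vertex has degree below a constant multiple of \<open>p\<close>
  (\<open>hamiltonian_sum_graph\<close>). Take a longest cycle through this vertex. If it misses a vertex, the
  rerouting argument of Chvatal and Erdos either lengthens it or produces two disjoint large sets
  without an edge between them (\<open>hamiltonian_if_expanding\<close>).

  The two facts follow from one estimate: with \<open>g = (p - 1) / k\<close> and \<open>t \<noteq> 0\<close>, at most
  \<open>(1/k\<^sup>2 + \<epsilon>) p\<close> elements \<open>x\<close> have prescribed values of \<open>f(x)^g\<close> and of \<open>f(x + t)^g\<close>
  (\<open>equidistribution\<close>). The second fact is the case of the values \<open>1\<close> and \<open>1\<close>; summing over all pairs of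
  \<open>k\<close>-th roots of unity gives the first (\<open>count_lower_bound\<close>).

  The estimate is proved by Stepanov's method over the prime field (\<open>stepanov_bound\<close>). With \<open>f1 = f(x)\<close>
  and \<open>f2 = f(x + t)\<close> one looks for a polynomial
  \<open>R = f1^L f2^L \<Sum> c(j1,j2,a,b) f1^(j1 g) f2^(j2 g) x^a x^(p b)\<close> that vanishes to order \<open>L\<close> at each of
  the points to be counted. At such a point the powers \<open>f1^g\<close>, \<open>f2^g\<close>, \<open>x^p\<close> equal known values or \<open>x\<close>
  itself, and \<open>x^p\<close> has derivative \<open>0\<close>. Hence the conditions are about \<open>L B\<close> linear equations
  in \<open>k\<^sup>2 D B\<close> unknowns, and \<open>L\<close> can be as large as \<open>k\<^sup>2 D - 1\<close> while the degree of \<open>R\<close> is about \<open>(D + 2 d) p\<close>,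
  where \<open>d\<close> is the degree of \<open>f\<close>. Since \<open>D\<close> is a constant, chosen large, the bound \<open>deg R / L\<close> is close to \<open>p / k\<^sup>2\<close>.

  It remains to see that \<open>R\<close> is not zero, that is, that the products \<open>f1^(j1 g) f2^(j2 g)\<close> are linearly
  independent over polynomials of bounded degree, even modulo \<open>x^p\<close> (\<open>independence_mod\<close>).
  Differentiating a relation and eliminating one term leaves a shorter one. It collapses only if two
  terms have a quotient with derivative zero; and this is impossible at a prime factor of one of
  \<open>f1\<close>, \<open>f2\<close> that divides it once and does not divide the other (\<open>ratio_valuation\<close>). The factor exists since \<open>f\<close> is squarefree
  modulo \<open>p\<close>, by the discriminant hypothesis, and does not divide its translate \<open>f(x + t)\<close>.
\<close>

section \<open>Hamilton cycles in graphs without large sparse pairs\<close>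

definition is_cycle :: "('a \<Rightarrow> 'a \<Rightarrow> bool) \<Rightarrow> 'a list \<Rightarrow> bool" where
  "is_cycle E xs \<longleftrightarrow> distinct xs \<and> 3 \<le> length xs \<and> successively E xs \<and> E (last xs) (hd xs)"

text \<open>
  The vertices that can be reached from \<open>a\<close> inside \<open>Y\<close>; for symmetric \<open>E\<close> and \<open>a \<in> Y\<close> this is the connected component of \<open>a\<close>
  in the graph induced on \<open>Y\<close>.
\<close>

definition reach :: "('a \<Rightarrow> 'a \<Rightarrow> bool) \<Rightarrow> 'a set \<Rightarrow> 'a \<Rightarrow> 'a set" where
  "reach E Y a = {x. (\<lambda>x y. E x y \<and> x \<in> Y \<and> y \<in> Y)\<^sup>*\<^sup>* a x}"

lemma reach_refl: "a \<in> reach E Y a"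
  by (simp add: reach_def)

lemma reach_subset:
  assumes "a \<in> Y" shows "reach E Y a \<subseteq> Y"
proof
  fix x assume "x \<in> reach E Y a"
  then have "(\<lambda>x y. E x y \<and> x \<in> Y \<and> y \<in> Y)\<^sup>*\<^sup>* a x" by (simp add: reach_def)
  then show "x \<in> Y" using assms by (cases rule: rtranclp.cases) auto
qed

lemma reach_step:
  assumes "x \<in> reach E Y a" "E x y" "a \<in> Y" "y \<in> Y" shows "y \<in> reach E Y a"
proof -
  have "x \<in> Y" using assms reach_subset by fast
  then show ?thesis using assms unfolding reach_def
    by (auto intro: rtranclp.rtrancl_into_rtrancl)
qed

lemma reach_sym:
  assumes "symp E" "x \<in> reach E Y a" shows "a \<in> reach E Y x"
proof -
  let ?R = "\<lambda>x y. E x y \<and> x \<in> Y \<and> y \<in> Y"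
  have "symp ?R" using assms(1) by (auto simp: symp_def)
  then have "symp (?R\<^sup>*\<^sup>*)" by (rule symp_rtranclp)
  then show ?thesis using assms(2) unfolding reach_def by (auto dest: sympD)
qed

lemma reach_trans: "x \<in> reach E Y a \<Longrightarrow> y \<in> reach E Y x \<Longrightarrow> y \<in> reach E Y a"
  unfolding reach_def by auto

lemma reach_disjoint:
  assumes "symp E" "b \<notin> reach E Y a" shows "reach E Y a \<inter> reach E Y b = {}"
  using assms reach_sym reach_trans by (metis disjoint_iff)

lemma reach_path:
  assumes "b \<in> reach E Y a" "a \<in> Y"
  shows "\<exists>ys. ys \<noteq> [] \<and> hd ys = a \<and> last ys = b \<and> distinct ys \<and> set ys \<subseteq> Y \<and> successively E ys"
proof -
  have "(\<lambda>x y. E x y \<and> x \<in> Y \<and> y \<in> Y)\<^sup>*\<^sup>* a b" using assms(1) by (simp add: reach_def)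
  then show ?thesis
  proof induction
    case base
    show ?case by (rule exI[of _ "[a]"]) (use assms(2) in auto)
  next
    case (step b c)
    then obtain ys where ys: "ys \<noteq> []" "hd ys = a" "last ys = b" "distinct ys" "set ys \<subseteq> Y"
      "successively E ys" by blast
    show ?case
    proof (cases "c \<in> set ys")
      case True
      then obtain us vs where "ys = us @ c # vs" by (meson split_list)
      then show ?thesis using ys
        by (intro exI[of _ "us @ [c]"]) (auto simp: successively_append_iff hd_append)
    next
      case False
      then show ?thesis using ys step
        by (intro exI[of _ "ys @ [c]"]) (auto simp: successively_append_iff)
    qed
  qed
qed

lemma is_cycle_rotate1:
  assumes "is_cycle E xs" shows "is_cycle E (rotate1 xs)"
proof (cases xs)
  case (Cons x ys)
  then show ?thesis using assms
    by (cases ys)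
      (auto simp: is_cycle_def successively_append_iff successively_Cons hd_append split: if_splits)
qed (use assms in \<open>simp add: is_cycle_def\<close>)

lemma is_cycle_rotate: "is_cycle E xs \<Longrightarrow> is_cycle E (rotate n xs)"
  by (induction n) (auto intro: is_cycle_rotate1)

lemma is_cycle_insert_path:
  assumes "is_cycle E xs" "ys \<noteq> []" "distinct ys" "set ys \<inter> set xs = {}" "successively E ys"
    "E (last xs) (hd ys)" "E (last ys) (hd xs)"
  shows "is_cycle E (xs @ ys)"
  using assms by (cases "xs = []") (auto simp: is_cycle_def successively_append_iff)

text \<open>
  The rerouting step: the edges from \<open>us\<close> to \<open>vs\<close> and from \<open>vs\<close> back to \<open>us\<close> are replaced by
  the edge between the two heads and by the detour \<open>ys\<close> that joins the two ends. All old vertices stay on the cycle, so a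
  vertex that the cycle has to contain is never lost.
\<close>

lemma is_cycle_reroute:
  assumes "is_cycle E (us @ vs)" "symp E" "us \<noteq> []" "vs \<noteq> []" "ys \<noteq> []" "distinct ys"
    "set ys \<inter> set (us @ vs) = {}" "successively E ys"
    "E (last vs) (hd ys)" "E (last ys) (last us)" "E (hd us) (hd vs)"
  shows "is_cycle E (vs @ ys @ rev us)"
proof -
  have "successively E (rev us)"
    using assms(1,2) by (auto simp: is_cycle_def successively_append_iff successively_rev 
       elim!: successively_mono dest: sympD)
  then show ?thesis using assms
    by (auto simp: is_cycle_def successively_append_iff hd_rev last_rev)
qed

lemma rotate_Suc_ends:
  assumes "i < length xs"
  shows "last (rotate (Suc i) xs) = xs ! i" "hd (rotate (Suc i) xs) = xs ! (Suc i mod length xs)"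
proof -
  have ne: "xs \<noteq> []" using assms by auto
  show "hd (rotate (Suc i) xs) = xs ! (Suc i mod length xs)"
    using ne by (rule hd_rotate_conv_nth)
  have "last (rotate (Suc i) xs) = rotate (Suc i) xs ! (length xs - 1)"
    using ne by (simp add: last_conv_nth del: rotate_Suc)
  also have "\<dots> = xs ! ((Suc i + (length xs - 1)) mod length xs)"
    using ne by (intro nth_rotate) auto
  also have "(Suc i + (length xs - 1)) mod length xs = i"
  proof -
    have "Suc i + (length xs - 1) = i + length xs" using assms by simp
    then show ?thesis using assms by (simp only: mod_add_self2 mod_less)
  qed
  finally show "last (rotate (Suc i) xs) = xs ! i" .
qed

text \<open>
  If the ends of one edge of the cycle both have neighbours in the same component outside, a path through
  this component can replace the edge. The index \<open>Suc i mod length xs\<close> is the cyclic successor of \<open>i\<close>.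
\<close>

lemma longest_cycle_no_consecutive:
  assumes cyc: "is_cycle E xs" and sym: "symp E"
    and max: "\<And>zs. is_cycle E zs \<Longrightarrow> set xs \<subseteq> set zs \<Longrightarrow> set zs \<subseteq> set xs \<union> Y \<Longrightarrow> length zs \<le> length xs"
    and Y: "Y \<inter> set xs = {}" and h: "h \<in> Y" and i: "i < length xs"
    and a: "a \<in> reach E Y h" "E (xs ! i) a"
    and b: "b \<in> reach E Y h" "E (xs ! (Suc i mod length xs)) b"
  shows False
proof -
  let ?zs = "rotate (Suc i) xs"
  have "b \<in> reach E Y a" using a b sym reach_sym reach_trans by metis
  moreover have "a \<in> Y" using a h reach_subset by fast
  ultimately obtain ys where ys: "ys \<noteq> []" "hd ys = a" "last ys = b" "distinct ys" "set ys \<subseteq> Y"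
      "successively E ys" using reach_path by metis
  have "is_cycle E (?zs @ ys)"
    using cyc ys a b Y sym rotate_Suc_ends[OF i]
    by (intro is_cycle_insert_path is_cycle_rotate) (auto simp del: rotate_Suc dest: sympD)
  then have "length (?zs @ ys) \<le> length xs"
    using ys by (intro max) (auto simp del: rotate_Suc)
  then show False using ys(1) by simp
qed

text \<open>
  Chvatal and Erdos: let \<open>xs ! i\<close> and \<open>xs ! j\<close> have neighbours in the same outside component. An edge between
  their successors would allow the rerouting step, with a path through the component as the detour.
\<close>

lemma longest_cycle_successors_independent:
  assumes cyc: "is_cycle E xs" and sym: "symp E"
    and max: "\<And>zs. is_cycle E zs \<Longrightarrow> set xs \<subseteq> set zs \<Longrightarrow> set zs \<subseteq> set xs \<union> Y \<Longrightarrow> length zs \<le> length xs"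
    and Y: "Y \<inter> set xs = {}" and h: "h \<in> Y" and i: "i < length xs" and j: "j < length xs" "i \<noteq> j"
    and a: "a \<in> reach E Y h" "E (xs ! i) a"
    and b: "b \<in> reach E Y h" "E (xs ! j) b"
  shows "\<not> E (xs ! (Suc i mod length xs)) (xs ! (Suc j mod length xs))"
proof
  assume edge: "E (xs ! (Suc i mod length xs)) (xs ! (Suc j mod length xs))"
  let ?n = "length xs"
  let ?zs = "rotate (Suc i) xs"
  have "b \<in> reach E Y a" using a b sym reach_sym reach_trans by metis
  moreover have "a \<in> Y" using a h reach_subset by fast
  ultimately obtain ys where ys: "ys \<noteq> []" "hd ys = a" "last ys = b" "distinct ys" "set ys \<subseteq> Y"
      "successively E ys" using reach_path by metis
  have dist: "distinct xs" using cyc by (simp add: is_cycle_def)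
  have czs: "is_cycle E ?zs" using cyc by (rule is_cycle_rotate)
  have "xs ! j \<in> set ?zs" using j by (simp del: rotate_Suc)
  then obtain m where m: "m < ?n" "?zs ! m = xs ! j"
    by (metis in_set_conv_nth length_rotate)
  have zm: "?zs ! l = xs ! ((Suc i + l) mod ?n)" if "l < ?n" for l
    using that by (rule nth_rotate)
  have "xs ! ((Suc i + m) mod ?n) = xs ! j" using zm m by simp
  then have jm: "(Suc i + m) mod ?n = j"
  proof -
    have "(Suc i + m) mod ?n < ?n" using j by (intro mod_less_divisor) auto
    then show ?thesis using nth_eq_iff_index_eq[OF dist _ j(1)] \<open>xs ! ((Suc i + m) mod ?n) = xs ! j\<close>
      by blast
  qed
  have "m \<noteq> ?n - 1"
  proof
    assume "m = ?n - 1"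
    then have "Suc i + m = i + ?n" using i by simp
    then have "(Suc i + m) mod ?n = i" using i by (simp only: mod_add_self2 mod_less)
    then show False using jm j by simp
  qed
  then have m1: "Suc m < ?n" using m by simp
  define us where "us = take (Suc m) ?zs"
  define vs where "vs = drop (Suc m) ?zs"
  have uv: "us @ vs = ?zs" by (simp add: us_def vs_def del: rotate_Suc)
  have "us \<noteq> []" "vs \<noteq> []" using m1 by (auto simp: us_def vs_def simp del: rotate_Suc)
  have "last us = xs ! j" using m m1 by (simp add: us_def take_Suc_conv_app_nth del: rotate_Suc)
  have "last vs = xs ! i" using rotate_Suc_ends[OF i] m1
    by (simp add: vs_def last_drop del: rotate_Suc)
  have "hd us = xs ! (Suc i mod ?n)" using rotate_Suc_ends[OF i] m1
    by (simp add: us_def del: rotate_Suc)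
  have "hd vs = ?zs ! Suc m" using m1 by (simp add: vs_def hd_drop_conv_nth del: rotate_Suc)
  also have "\<dots> = xs ! (Suc (Suc i + m) mod ?n)" using zm[OF m1] by (simp del: rotate_Suc)
  also have "Suc (Suc i + m) mod ?n = Suc j mod ?n" using jm by (metis mod_Suc_eq)
  finally have hd_vs: "hd vs = xs ! (Suc j mod ?n)" .
  have "is_cycle E (vs @ ys @ rev us)"
  proof (rule is_cycle_reroute)
    show "is_cycle E (us @ vs)" using czs uv by simp
    show "set ys \<inter> set (us @ vs) = {}" using uv ys Y by (auto simp del: rotate_Suc)
    show "E (last vs) (hd ys)" using a ys \<open>last vs = _\<close> by simp
    show "E (last ys) (last us)" using b ys \<open>last us = _\<close> sym by (simp add: sympD)
    show "E (hd us) (hd vs)" using edge \<open>hd us = _\<close> hd_vs by simp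
  qed (use ys sym \<open>us \<noteq> []\<close> \<open>vs \<noteq> []\<close> in auto)
  moreover have "set us \<union> set vs = set xs" using uv by (metis set_append set_rotate)
  ultimately have "length (vs @ ys @ rev us) \<le> length xs"
    using ys by (intro max) auto
  moreover have "length us + length vs = length xs" using uv by (metis length_append length_rotate)
  moreover have "0 < length ys" using ys(1) by simp
  ultimately show False by simp
qed

text \<open>
  Removing \<open>v0\<close> leaves a connected graph: two components would both have at least \<open>s\<close> vertices because of the degrees,
  and no edge would join them. So two neighbours of \<open>v0\<close> are joined by a path that avoids \<open>v0\<close>.
\<close>

lemma exists_cycle_through:
  fixes E :: "'a \<Rightarrow> 'a \<Rightarrow> bool"
  assumes fin: "finite V" and sym: "symp E" and irr: "\<And>x. \<not> E x x"
    and v0: "v0 \<in> V"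
    and deg: "\<And>v. v \<in> V \<Longrightarrow> v \<noteq> v0 \<Longrightarrow> s < card {w \<in> V. E v w}"
    and deg0: "2 \<le> card {w \<in> V. E v0 w}"
    and edges: "\<And>U W. U \<subseteq> V \<Longrightarrow> W \<subseteq> V \<Longrightarrow> U \<inter> W = {} \<Longrightarrow> s \<le> card U \<Longrightarrow> s \<le> card W \<Longrightarrow> \<exists>u\<in>U. \<exists>w\<in>W. E u w"
  shows "\<exists>xs. is_cycle E xs \<and> v0 \<in> set xs \<and> set xs \<subseteq> V"
proof -
  from deg0 obtain a b where ab: "a \<noteq> b" "a \<in> V" "b \<in> V" "E v0 a" "E v0 b"
    using fin by (auto simp: card_le_Suc_iff numeral_2_eq_2)
  define Y where "Y = V - {v0}"
  have abY: "a \<in> Y" "b \<in> Y" using ab irr by (auto simp: Y_def)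
  have large: "s \<le> card (reach E Y c)" if c: "c \<in> Y" for c
  proof -
    have "{w \<in> V. E c w} \<subseteq> insert v0 (reach E Y c)"
      using c reach_step[OF reach_refl, of E c _ Y] by (auto simp: Y_def)
    moreover have finr: "finite (reach E Y c)"
      using reach_subset[OF c, of E] fin by (auto simp: Y_def intro: finite_subset)
    ultimately have "card {w \<in> V. E c w} \<le> card (insert v0 (reach E Y c))"
      by (intro card_mono) auto
    also have "\<dots> \<le> Suc (card (reach E Y c))" using finr by (simp add: card_insert_if)
    finally have "card {w \<in> V. E c w} \<le> Suc (card (reach E Y c))" .
    with deg[of c] c show ?thesis by (auto simp: Y_def)
  qed
  have "b \<in> reach E Y a"
  proof (rule ccontr)
    assume nb: "b \<notin> reach E Y a"
    have disj: "reach E Y a \<inter> reach E Y b = {}" using sym nb by (rule reach_disjoint)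
    have "reach E Y a \<subseteq> Y" "reach E Y b \<subseteq> Y" using abY by (auto dest: reach_subset)
    then obtain u w where "u \<in> reach E Y a" "w \<in> reach E Y b" "E u w"
      using edges[of "reach E Y a" "reach E Y b"] disj large abY by (auto simp: Y_def)
    then have "w \<in> reach E Y a" using abY \<open>reach E Y b \<subseteq> Y\<close> by (meson reach_step subsetD)
    then show False using disj \<open>w \<in> reach E Y b\<close> by blast
  qed
  then obtain ys where ys: "ys \<noteq> []" "hd ys = a" "last ys = b" "distinct ys" "set ys \<subseteq> Y"
      "successively E ys" using reach_path abY by metis
  have "length ys \<noteq> 1" using ys ab by (auto simp: length_Suc_conv)
  then have "2 \<le> length ys" using ys(1) by (cases ys; cases "tl ys") auto
  then have "is_cycle E (v0 # ys)"
    using ys ab sym by (auto simp: is_cycle_def successively_Cons Y_def dest: sympD)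
  then show ?thesis using ys v0 by (intro exI[of _ "v0 # ys"]) (auto simp: Y_def)
qed

text \<open>
  Among the cycles through \<open>v0\<close> take a longest one, suppose that it misses a vertex, and let \<open>H\<close> be the component of this vertex outside
  the cycle. If at least \<open>2 s\<close> vertices of the cycle have neighbours in \<open>H\<close>, their successors form an
  independent set with two disjoint parts of size \<open>s\<close>. If there are fewer, \<open>H\<close> has at least \<open>s\<close> vertices, so fewer than
  \<open>s\<close> cycle vertices have no neighbour in \<open>H\<close>, and the cycle is shorter than \<open>3 s\<close>. Then every cycle vertex other than
  \<open>v0\<close> has a neighbour outside, and the outside is the single component \<open>H\<close>; two consecutive vertices with neighbours in
  \<open>H\<close> contradict maximality. The vertex \<open>v0\<close> is the one whose degree may be as small as \<open>2\<close>.
\<close>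

theorem hamiltonian_if_expanding:
  fixes E :: "'a \<Rightarrow> 'a \<Rightarrow> bool"
  assumes fin: "finite V" and sym: "symp E" and irr: "\<And>x. \<not> E x x"
    and v0: "v0 \<in> V" and s: "1 \<le> s"
    and deg: "\<And>v. v \<in> V \<Longrightarrow> v \<noteq> v0 \<Longrightarrow> 4 * s \<le> card {w \<in> V. E v w}"
    and deg0: "2 \<le> card {w \<in> V. E v0 w}"
    and edges: "\<And>U W. U \<subseteq> V \<Longrightarrow> W \<subseteq> V \<Longrightarrow> U \<inter> W = {} \<Longrightarrow> s \<le> card U \<Longrightarrow> s \<le> card W \<Longrightarrow> \<exists>u\<in>U. \<exists>w\<in>W. E u w"
  shows "\<exists>xs. is_cycle E xs \<and> set xs = V"
proof -
  define Q where "Q xs \<longleftrightarrow> is_cycle E xs \<and> v0 \<in> set xs \<and> set xs \<subseteq> V" for xs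
  have "\<exists>xs. is_cycle E xs \<and> v0 \<in> set xs \<and> set xs \<subseteq> V"
  proof (rule exists_cycle_through[OF fin sym irr v0 _ deg0 edges])
    show "s < card {w \<in> V. E v w}" if "v \<in> V" "v \<noteq> v0" for v
      using deg[OF that] s by simp
  qed
  then obtain xs0 where xs0: "Q xs0" by (auto simp: Q_def)
  have bound: "length xs \<le> card V" if "Q xs" for xs
    using that card_mono[OF fin, of "set xs"] by (auto simp: Q_def is_cycle_def distinct_card)
  have "\<exists>xs. Q xs \<and> (\<forall>zs. Q zs \<longrightarrow> length zs \<le> length xs)"
    using xs0 bound by (intro ex_has_greatest_nat[where b = "Suc (card V)"]) (auto simp: less_Suc_eq_le)
  then obtain xs where xs: "Q xs" and longest: "\<And>zs. Q zs \<Longrightarrow> length zs \<le> length xs" by blast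
  let ?n = "length xs"
  have cyc: "is_cycle E xs" and v0xs: "v0 \<in> set xs" and xsV: "set xs \<subseteq> V"
    using xs by (auto simp: Q_def)
  have dist: "distinct xs" and n3: "3 \<le> ?n" using cyc by (auto simp: is_cycle_def)
  have cardxs: "card (set xs) = ?n" using dist by (rule distinct_card)
  show ?thesis
  proof (rule ccontr)
    assume "\<not> ?thesis"
    then have "set xs \<noteq> V" using cyc by auto
    then obtain h where h: "h \<in> V - set xs" using xsV by auto
    define Y where "Y = V - set xs"
    have hY: "h \<in> Y" using h by (simp add: Y_def)
    have finY: "finite Y" using fin by (simp add: Y_def)
    have YV: "Y \<subseteq> V" by (auto simp: Y_def)
    have Y0: "Y \<inter> set xs = {}" by (auto simp: Y_def)
    have max: "length zs \<le> length xs" if "is_cycle E zs" "set xs \<subseteq> set zs" "set zs \<subseteq> set xs \<union> Y" for zs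
      using that v0xs xsV by (intro longest) (auto simp: Q_def Y_def)
    define H where "H = reach E Y h"
    have HY: "H \<subseteq> Y" unfolding H_def using hY by (rule reach_subset)
    define I where "I = {i. i < ?n \<and> (\<exists>a\<in>H. E (xs ! i) a)}"
    define N where "N = (!) xs ` I"
    have finI: "finite I" by (simp add: I_def)
    have inj: "inj_on ((!) xs) {..<?n}" using dist by (simp add: inj_on_nth)
    have cardN: "card N = card I"
      unfolding N_def by (rule card_image, rule inj_on_subset[OF inj]) (auto simp: I_def)
    have Nxs: "N \<subseteq> set xs" by (auto simp: N_def I_def)
    have N_iff: "c \<in> N" if "c \<in> set xs" "a \<in> H" "E c a" for c a
      using that unfolding N_def I_def by (auto simp: in_set_conv_nth)
    have consecutive: False if "i \<in> I" "Suc i mod ?n \<in> I" for i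
      using that longest_cycle_no_consecutive[OF cyc sym max Y0 hY, of i] by (auto simp: I_def H_def)
    define suc where "suc i = xs ! (Suc i mod ?n)" for i
    have indep: "\<not> E (suc i) (suc j)" if "i \<in> I" "j \<in> I" "i \<noteq> j" for i j
      using that longest_cycle_successors_independent[OF cyc sym max Y0 hY, of i j]
      by (auto simp: I_def H_def suc_def)
    have suc_inj: "inj_on suc {..<?n}"
    proof (rule inj_onI)
      fix i j assume ij: "i \<in> {..<?n}" "j \<in> {..<?n}" "suc i = suc j"
      have "0 < ?n" using n3 by linarith
      then have "Suc i mod ?n < ?n" "Suc j mod ?n < ?n" by simp_all
      then have "Suc i mod ?n = Suc j mod ?n"
        using nth_eq_iff_index_eq[OF dist] ij(3) unfolding suc_def by blast
      then show "i = j" using ij by (auto simp: mod_Suc split: if_splits)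
    qed
    have closed: "w \<in> K \<or> w \<in> set xs" if "K = reach E Y c" "c \<in> Y" "u \<in> K" "E u w" "w \<in> V" for K c u w
      using that reach_step[of u E Y c w] by (auto simp: Y_def)
    have small: "card I < 2 * s"
    proof (rule ccontr)
      assume "\<not> card I < 2 * s"
      then obtain I1 where I1: "I1 \<subseteq> I" "card I1 = s"
        using obtain_subset_with_card_n[of s I] by auto
      have "card (I - I1) = card I - s" using I1 finI by (metis card_Diff_subset finite_subset)
      then have I2: "s \<le> card (I - I1)" using \<open>\<not> card I < 2 * s\<close> by simp
      have ii: "inj_on suc I" using suc_inj by (rule inj_on_subset) (auto simp: I_def)
      have "\<exists>u\<in>suc ` I1. \<exists>w\<in>suc ` (I - I1). E u w"
      proof (rule edges)
        have "suc i \<in> V" for i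
        proof -
          have "0 < ?n" using n3 by linarith
          then have "Suc i mod ?n < ?n" by simp
          then show ?thesis using nth_mem xsV unfolding suc_def by blast
        qed
        then show "suc ` I1 \<subseteq> V" "suc ` (I - I1) \<subseteq> V" using I1 by auto
        show "suc ` I1 \<inter> suc ` (I - I1) = {}" using ii I1 by (auto simp: inj_on_def)
        show "s \<le> card (suc ` I1)" using I1 card_image[OF inj_on_subset[OF ii I1(1)]] by simp
        show "s \<le> card (suc ` (I - I1))" using I2 card_image[OF inj_on_subset[OF ii, of "I - I1"]] by auto
      qed
      then show False using indep I1 by auto
    qed
    have hv0: "h \<noteq> v0" using h v0xs by auto
    have "{w \<in> V. E h w} \<subseteq> H \<union> N"
    proof
      fix w assume w: "w \<in> {w \<in> V. E h w}"
      then have "w \<in> H \<or> w \<in> set xs" using closed[OF H_def hY, of h w] by (auto simp: H_def reach_refl)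
      then show "w \<in> H \<union> N" using w N_iff[of w h] sym by (auto simp: H_def reach_refl dest: sympD)
    qed
    then have "card {w \<in> V. E h w} \<le> card (H \<union> N)"
      using HY finY finI by (intro card_mono) (auto simp: N_def intro: finite_subset)
    also have "\<dots> \<le> card H + card I" using card_Un_le[of H N] cardN by simp
    finally have H_large: "s \<le> card H" using deg[of h] h hv0 small s by auto
    have "card (set xs - N) < s"
    proof (rule ccontr)
      assume "\<not> card (set xs - N) < s"
      then have "\<exists>u\<in>H. \<exists>w\<in>set xs - N. E u w"
        using H_large HY YV Y0 xsV by (intro edges) auto
      then obtain u w where "u \<in> H" "w \<in> set xs - N" "E u w" by blast
      then show False using N_iff[of w u] sym by (auto dest: sympD)
    qed
    moreover have "card (set xs - N) = ?n - card I"
      using cardxs cardN Nxs by (metis List.finite_set card_Diff_subset finite_subset)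
    ultimately have n_small: "?n < 3 * s" using small by simp
    have "Y \<subseteq> H"
    proof
      fix y assume y: "y \<in> Y"
      show "y \<in> H"
      proof (rule ccontr)
        assume nH: "y \<notin> H"
        define K where "K = reach E Y y"
        have disj: "H \<inter> K = {}" using reach_disjoint[OF sym] nH by (simp add: H_def K_def)
        have KY: "K \<subseteq> Y" unfolding K_def using y by (rule reach_subset)
        have "{w \<in> V. E y w} \<subseteq> K \<union> set xs"
          using closed[OF K_def y, of y] by (auto simp: K_def reach_refl)
        then have "card {w \<in> V. E y w} \<le> card (K \<union> set xs)"
          using KY finY by (intro card_mono) (auto intro: finite_subset)
        also have "\<dots> \<le> card K + ?n" using card_Un_le[of K "set xs"] cardxs by simp
        finally have "card {w \<in> V. E y w} \<le> card K + ?n" .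
        moreover have "y \<in> V" "y \<noteq> v0" using y v0xs by (auto simp: Y_def)
        then have "4 * s \<le> card {w \<in> V. E y w}" by (rule deg)
        ultimately have "s \<le> card K" using n_small by linarith
        then have "\<exists>u\<in>H. \<exists>w\<in>K. E u w"
          using H_large HY KY YV disj by (intro edges) auto
        then obtain u w where uw: "u \<in> H" "w \<in> K" "E u w" by blast
        then have "w \<in> H" using closed[OF H_def hY, of u w] KY YV Y0 by blast
        then show False using uw disj by blast
      qed
    qed
    have inI: "i \<in> I" if "i < ?n" "xs ! i \<noteq> v0" for i
    proof -
      have "xs ! i \<in> V" using that xsV by auto
      then have "4 * s \<le> card {w \<in> V. E (xs ! i) w}" using deg that by blast
      moreover have "card {w \<in> V. E (xs ! i) w} \<le> ?n" if "{w \<in> V. E (xs ! i) w} \<subseteq> set xs"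
        using card_mono[OF _ that] cardxs by simp
      ultimately have "\<not> {w \<in> V. E (xs ! i) w} \<subseteq> set xs"
        using n_small by linarith
      then show ?thesis using \<open>Y \<subseteq> H\<close> that by (auto simp: I_def Y_def)
    qed
    obtain i0 where i0: "i0 < ?n" "xs ! i0 = v0" using v0xs by (metis in_set_conv_nth)
    have other: "xs ! i \<noteq> v0" if "i < ?n" "i \<noteq> i0" for i
      using that i0 dist by (metis nth_eq_iff_index_eq)
    define i where "i = Suc i0 mod ?n"
    have "i < ?n" "i \<noteq> i0" "Suc i mod ?n < ?n" "Suc i mod ?n \<noteq> i0"
      using i0 n3 by (auto simp: i_def mod_Suc split: if_splits)
    then show False using consecutive[of i] inI other by blast
  qed
qed

section \<open>Sum graphs of periodic sets\<close>

text \<open>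
  Subsets of \<open>\<int>/p\<close> are handled as predicates on the integers, so that sums and translates need no reduction.
\<close>

definition periodic :: "int \<Rightarrow> (int \<Rightarrow> bool) \<Rightarrow> bool" where
  "periodic p P \<longleftrightarrow> (\<forall>x. P (x mod p) = P x)"

lemma periodic_shift: "periodic p P \<Longrightarrow> periodic p (\<lambda>x. P (x + t))"
  unfolding periodic_def by (metis mod_add_left_eq)

lemma card_periodic_shift:
  assumes p: "0 < p" and P: "periodic p P"
  shows "card {x \<in> {0..<p}. P (x + t)} = card {x \<in> {0..<p}. P x}"
proof (rule bij_betw_same_card)
  show "bij_betw (\<lambda>x. (x + t) mod p) {x \<in> {0..<p}. P (x + t)} {x \<in> {0..<p}. P x}"
  proof (rule bij_betw_byWitness[where f' = "\<lambda>x. (x - t) mod p"])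
    show "\<forall>a\<in>{x \<in> {0..<p}. P (x + t)}. ((a + t) mod p - t) mod p = a"
      by (auto simp: mod_simps)
    show "\<forall>a'\<in>{x \<in> {0..<p}. P x}. ((a' - t) mod p + t) mod p = a'"
      by (auto simp: mod_simps)
    show "(\<lambda>x. (x + t) mod p) ` {x \<in> {0..<p}. P (x + t)} \<subseteq> {x \<in> {0..<p}. P x}"
      using p P by (auto simp: periodic_def)
    have "P ((x - t) mod p + t)" if "P x" for x
      using that P unfolding periodic_def by (metis diff_add_cancel mod_add_left_eq)
    then show "(\<lambda>x. (x - t) mod p) ` {x \<in> {0..<p}. P x} \<subseteq> {x \<in> {0..<p}. P (x + t)}"
      using p by auto
  qed
qed

lemma card_both_periodic_shift:
  assumes p: "0 < p" and P: "periodic p P"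
  shows "card {x \<in> {0..<p}. P (x + w) \<and> P (x + w')} = card {x \<in> {0..<p}. P x \<and> P (x + (w' - w))}"
proof -
  have "periodic p (\<lambda>x. P x \<and> P (x + (w' - w)))"
    using P periodic_shift[OF P, of "w' - w"] by (simp add: periodic_def)
  from card_periodic_shift[OF p this, of w] show ?thesis by (simp add: algebra_simps)
qed

lemma sum_squared_le_card_sum_squares:
  fixes r :: "'a \<Rightarrow> real"
  shows "(\<Sum>x\<in>X. r x)\<^sup>2 \<le> real (card X) * (\<Sum>x\<in>X. (r x)\<^sup>2)"
proof -
  have "0 \<le> (\<Sum>x\<in>X. \<Sum>y\<in>X. (r x - r y)\<^sup>2)" by (intro sum_nonneg) simp
  also have "\<dots> = (\<Sum>x\<in>X. \<Sum>y\<in>X. (r x)\<^sup>2) + (\<Sum>x\<in>X. \<Sum>y\<in>X. (r y)\<^sup>2)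
      - 2 * (\<Sum>x\<in>X. \<Sum>y\<in>X. r x * r y)"
    by (simp only: power2_diff sum.distrib sum_subtractf sum_distrib_left mult.assoc)
  also have "(\<Sum>x\<in>X. \<Sum>y\<in>X. r x * r y) = (\<Sum>x\<in>X. r x)\<^sup>2"
    by (simp only: power2_eq_square sum_product)
  also have "(\<Sum>x\<in>X. \<Sum>y\<in>X. (r x)\<^sup>2) = real (card X) * (\<Sum>x\<in>X. (r x)\<^sup>2)"
    by (simp add: sum_distrib_left)
  also have "(\<Sum>x\<in>X. \<Sum>y\<in>X. (r y)\<^sup>2) = real (card X) * (\<Sum>x\<in>X. (r x)\<^sup>2)"
    by simp
  finally show ?thesis by simp
qed

text \<open>
  Let \<open>r x\<close> be the number of \<open>w \<in> W\<close> with \<open>P (x + w)\<close>. It vanishes on \<open>U\<close>, its sum is \<open>|W| N\<close>, and its second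
  moment is bounded through the pair counts \<open>K\<close>. Cauchy-Schwarz on the complement of \<open>U\<close> compares the two.
\<close>

lemma no_edges_inequality:
  fixes p :: int and K :: real and P :: "int \<Rightarrow> bool"
  assumes p: "0 < p" and P: "periodic p P"
    and K: "\<And>t. \<not> p dvd t \<Longrightarrow> real (card {x \<in> {0..<p}. P x \<and> P (x + t)}) \<le> K" and K0: "0 \<le> K"
    and UW: "U \<subseteq> {0..<p}" "W \<subseteq> {0..<p}" and none: "\<And>u w. u \<in> U \<Longrightarrow> w \<in> W \<Longrightarrow> \<not> P (u + w)"
  defines "N \<equiv> card {x \<in> {0..<p}. P x}"
  shows "(real (card W) * real N)\<^sup>2 \<le> (real_of_int p - real (card U)) *
           (real (card W) * real N + (real (card W))\<^sup>2 * K)"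
proof -
  have finW: "finite W" and finU: "finite U" using UW by (auto intro: finite_subset)
  define r where "r x = (\<Sum>w\<in>W. of_bool (P (x + w)) :: real)" for x
  have count: "(\<Sum>x\<in>{0..<p}. of_bool (Q x) :: real) = real (card {x \<in> {0..<p}. Q x})" for Q
    by (simp add: sum_of_bool_eq Int_def)
  have "(\<Sum>x\<in>{0..<p}. r x) = (\<Sum>w\<in>W. \<Sum>x\<in>{0..<p}. of_bool (P (x + w)))"
    unfolding r_def by (rule sum.swap)
  also have "\<dots> = real (card W) * real N"
    by (simp only: count card_periodic_shift[OF p P] N_def sum_constant)
  finally have s1: "(\<Sum>x\<in>{0..<p}. r x) = real (card W) * real N" .
  have r0: "r x = 0" if "x \<in> U" for x
    using none[OF that] by (simp add: r_def)
  have "(\<Sum>x\<in>{0..<p}. r x) = (\<Sum>x\<in>{0..<p} - U. r x)"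
    using r0 by (intro sum.mono_neutral_right) auto
  then have "(real (card W) * real N)\<^sup>2 \<le> real (card ({0..<p} - U)) * (\<Sum>x\<in>{0..<p} - U. (r x)\<^sup>2)"
    using sum_squared_le_card_sum_squares[of r "{0..<p} - U"] s1 by simp
  also have "real (card ({0..<p} - U)) = real_of_int p - real (card U)"
  proof -
    have "card ({0..<p} - U) = nat p - card U" using finU UW by (simp add: card_Diff_subset)
    moreover have "card U \<le> nat p" using card_mono[OF _ UW(1)] by simp
    ultimately show ?thesis using p by (simp add: of_nat_diff)
  qed
  finally have cs: "(real (card W) * real N)\<^sup>2 \<le> (real_of_int p - real (card U)) * (\<Sum>x\<in>{0..<p} - U. (r x)\<^sup>2)" .
  have "(\<Sum>x\<in>{0..<p} - U. (r x)\<^sup>2) = (\<Sum>x\<in>{0..<p}. (r x)\<^sup>2)"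
    using r0 by (intro sum.mono_neutral_left) auto
  also have "(\<Sum>x\<in>{0..<p}. (r x)\<^sup>2) = (\<Sum>x\<in>{0..<p}. \<Sum>w\<in>W. \<Sum>w'\<in>W. of_bool (P (x + w) \<and> P (x + w')))"
    unfolding r_def power2_eq_square sum_product by (simp add: of_bool_conj)
  also have "\<dots> = (\<Sum>w\<in>W. \<Sum>x\<in>{0..<p}. \<Sum>w'\<in>W. of_bool (P (x + w) \<and> P (x + w')))"
    by (rule sum.swap)
  also have "\<dots> = (\<Sum>w\<in>W. \<Sum>w'\<in>W. \<Sum>x\<in>{0..<p}. of_bool (P (x + w) \<and> P (x + w')))"
    by (intro sum.cong refl sum.swap)
  also have "\<dots> = (\<Sum>w\<in>W. \<Sum>w'\<in>W. real (card {x \<in> {0..<p}. P x \<and> P (x + (w' - w))}))"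
    by (simp only: count card_both_periodic_shift[OF p P])
  also have "\<dots> \<le> (\<Sum>w\<in>W. \<Sum>w'\<in>W. (if w' = w then real N else 0) + K)"
  proof (intro sum_mono)
    fix w w' assume w: "w \<in> W" "w' \<in> W"
    show "real (card {x \<in> {0..<p}. P x \<and> P (x + (w' - w))}) \<le> (if w' = w then real N else 0) + K"
    proof (cases "w' = w")
      case True
      then show ?thesis using K0 by (simp add: N_def)
    next
      case False
      have "w \<in> {0..<p}" "w' \<in> {0..<p}" using w UW by blast+
      then have "\<bar>w' - w\<bar> < p" by auto
      then have "\<not> p dvd w' - w" using False zdvd_imp_le[of p "\<bar>w' - w\<bar>"] by auto
      then show ?thesis using K False by simp
    qed
  qed
  also have "\<dots> = real (card W) * real N + (real (card W))\<^sup>2 * K"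
    using finW by (simp add: sum.distrib sum.delta power2_eq_square algebra_simps)
  finally have "(\<Sum>x\<in>{0..<p} - U. (r x)\<^sup>2) \<le> real (card W) * real N + (real (card W))\<^sup>2 * K" .
  moreover have "0 \<le> real_of_int p - real (card U)"
    using card_mono[OF _ UW(1)] p by simp
  ultimately show ?thesis using cs by (meson mult_left_mono order.trans)
qed

text \<open>
  Here \<open>x\<close> stands for \<open>1 / k\<close>. A vertex of degree below \<open>4 s\<close> has almost all its \<open>N\<close> potential
  neighbours in the complement \<open>A'\<close> of \<open>A\<close>, which has at most \<open>N\<close> elements; two such vertices would share almost \<open>N\<close> of
  them, more than \<open>K\<close> allows, since \<open>x > x\<^sup>2\<close>. The threshold \<open>s\<close> is close to \<open>p x\<^sup>2 / 16\<close>,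
  and the error terms \<open>x ^ 3 / 1000\<close> and \<open>x ^ 5 / 1000\<close> are small enough to leave room in
  both contradictions.
\<close>

lemma hamiltonian_sum_graph:
  fixes p :: int and P :: "int \<Rightarrow> bool" and x :: real
  assumes P: "periodic p P" and x: "0 < x" "x \<le> 1 / 2"
    and large: "real_of_int p * x ^ 7 \<ge> 32000"
    and N: "(x - x ^ 3 / 1000) * real_of_int p \<le> real (card {y \<in> {0..<p}. P y})"
    and K: "\<And>t. \<not> p dvd t \<Longrightarrow> real (card {y \<in> {0..<p}. P y \<and> P (y + t)}) \<le> (x\<^sup>2 + x ^ 5 / 1000) * real_of_int p"
    and A: "A \<subseteq> {0..<p}" "p + 3 \<le> int (card A) + int (card {y \<in> {0..<p}. P y})"
  shows "\<exists>xs. is_cycle (\<lambda>u v. u \<noteq> v \<and> P (u + v)) xs \<and> set xs = A"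
proof -
  define E where "E = (\<lambda>u v. u \<noteq> v \<and> P (u + v))"
  define N where "N = card {y \<in> {0..<p}. P y}"
  define s where "s = nat \<lfloor>real_of_int p * x\<^sup>2 / 16\<rfloor>"
  have ppos: "0 < p"
  proof (rule ccontr)
    assume "\<not> 0 < p"
    then have "real_of_int p * x ^ 7 \<le> 0" using x by (intro mult_nonpos_nonneg) auto
    then show False using large by simp
  qed
  have "x ^ 7 \<le> x\<^sup>2" using x by (intro power_decreasing) auto
  then have px2: "32000 \<le> real_of_int p * x\<^sup>2"
  proof -
    have "real_of_int p * x ^ 7 \<le> real_of_int p * x\<^sup>2"
      using \<open>x ^ 7 \<le> x\<^sup>2\<close> ppos by (intro mult_left_mono) auto
    then show ?thesis using large by linarith
  qed
  have s_le: "real s \<le> real_of_int p * x\<^sup>2 / 16" using px2 unfolding s_def by linarith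
  have s_gt: "real_of_int p * x\<^sup>2 / 16 - 1 < real s" using px2 unfolding s_def by linarith
  have s_ge: "real_of_int p * x\<^sup>2 / 32 \<le> real s" using s_gt px2 by linarith
  have s1: "1 \<le> s" using s_ge px2 by linarith
  define nb where "nb v = {y \<in> {0..<p}. P (v + y)}" for v
  have fin_nb: "finite (nb v)" for v
    unfolding nb_def by (rule finite_subset[of _ "{0..<p}"]) auto
  have card_nb: "card (nb v) = N" for v
    using card_periodic_shift[OF ppos P, of v] by (simp add: nb_def N_def add.commute)
  have finA: "finite A" using A(1) by (rule finite_subset) simp
  define A' where "A' = {0..<p} - A"
  have finA': "finite A'" by (simp add: A'_def)
  have cA': "int (card A') = p - int (card A)"
  proof -
    have "card A \<le> nat p" using card_mono[OF _ A(1)] by simp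
    then show ?thesis unfolding A'_def using A(1) finA ppos by (simp add: card_Diff_subset)
  qed
  have nb_split: "N = card (nb v \<inter> A) + card (nb v \<inter> A')" for v
  proof -
    have "nb v = (nb v \<inter> A) \<union> (nb v \<inter> A')" by (auto simp: nb_def A'_def)
    then have "card (nb v) = card (nb v \<inter> A) + card (nb v \<inter> A')"
      by (metis A'_def Diff_disjoint Int_left_commute card_Un_disjoint fin_nb finite_Int inf_bot_right inf_assoc)
    then show ?thesis by (simp add: card_nb)
  qed
  have deg: "card (nb v \<inter> A) \<le> Suc (card {w \<in> A. E v w})" for v
  proof -
    have "nb v \<inter> A \<subseteq> insert v {w \<in> A. E v w}" by (auto simp: nb_def E_def)
    then have "card (nb v \<inter> A) \<le> card (insert v {w \<in> A. E v w})" using finA by (intro card_mono) auto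
    also have "\<dots> \<le> Suc (card {w \<in> A. E v w})" by (rule card_insert_le_m1) auto
    finally show ?thesis .
  qed
  have deg2: "2 \<le> card {w \<in> A. E v w}" for v
  proof -
    have "card (nb v \<inter> A') \<le> card A'" using finA' by (intro card_mono) auto
    then show ?thesis using deg[of v] nb_split[of v] A(2) cA' unfolding N_def by linarith
  qed
  have one_low: "v = v'" if v: "v \<in> A" "v' \<in> A" and low: "card {w \<in> A. E v w} < 4 * s" "card {w \<in> A. E v' w} < 4 * s" for v v'
  proof (rule ccontr)
    assume "v \<noteq> v'"
    have "v \<in> {0..<p}" "v' \<in> {0..<p}" using v A(1) by blast+
    then have "\<bar>v' - v\<bar> < p" by auto
    then have t: "\<not> p dvd v' - v" using \<open>v \<noteq> v'\<close> zdvd_imp_le[of p "\<bar>v' - v\<bar>"] by auto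
    have "card (nb v \<inter> A') + card (nb v' \<inter> A') = card ((nb v \<inter> A') \<union> (nb v' \<inter> A')) + card ((nb v \<inter> A') \<inter> (nb v' \<inter> A'))"
      using finA' by (intro card_Un_Int) auto
    moreover have "card ((nb v \<inter> A') \<union> (nb v' \<inter> A')) \<le> card A'" using finA' by (intro card_mono) auto
    moreover have "card ((nb v \<inter> A') \<inter> (nb v' \<inter> A')) \<le> card (nb v \<inter> nb v')"
      using fin_nb by (intro card_mono) auto
    moreover have "card A' \<le> N" using cA' A(2) unfolding N_def by linarith
    ultimately have "N \<le> card (nb v \<inter> nb v') + 8 * s"
      using nb_split[of v] nb_split[of v'] deg[of v] deg[of v'] low by linarith
    moreover have "card (nb v \<inter> nb v') = card {y \<in> {0..<p}. P y \<and> P (y + (v' - v))}"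
    proof -
      have "nb v \<inter> nb v' = {y \<in> {0..<p}. P (y + v) \<and> P (y + v')}" by (auto simp: nb_def add.commute)
      then show ?thesis using card_both_periodic_shift[OF ppos P, of v v'] by simp
    qed
    ultimately have "real N \<le> (x\<^sup>2 + x ^ 5 / 1000) * real_of_int p + 8 * real s"
      using K[OF t] by linarith
    then have "(x - x ^ 3 / 1000) * real_of_int p \<le> (x\<^sup>2 + x ^ 5 / 1000 + x\<^sup>2 / 2) * real_of_int p"
      using N s_le by (simp add: N_def algebra_simps)
    then have "x - x ^ 3 / 1000 \<le> x\<^sup>2 + x ^ 5 / 1000 + x\<^sup>2 / 2" using ppos by simp
    moreover have "2 * x\<^sup>2 \<le> x" using x by (simp add: power2_eq_square)
    moreover have "x ^ 3 \<le> x\<^sup>2" "x ^ 5 \<le> x\<^sup>2" using x by (intro power_decreasing; simp)+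
    moreover have "0 < x\<^sup>2" using x by simp
    ultimately show False by linarith
  qed
  have edges: "\<exists>u\<in>U. \<exists>w\<in>W. E u w"
    if UW: "U \<subseteq> A" "W \<subseteq> A" "U \<inter> W = {}" and s: "s \<le> card U" "s \<le> card W" for U W
  proof (rule ccontr)
    assume no: "\<not> ?thesis"
    define K' where "K' = (x\<^sup>2 + x ^ 5 / 1000) * real_of_int p"
    have KK: "real (card {y \<in> {0..<p}. P y \<and> P (y + t)}) \<le> K'" if "\<not> p dvd t" for t
      unfolding K'_def by (rule K[OF that])
    have K0: "0 \<le> K'" using x ppos by (simp add: K'_def)
    have none: "\<not> P (u + w)" if "u \<in> U" "w \<in> W" for u w
    proof -
      have "u \<noteq> w" using that UW(3) by auto
      moreover have "\<not> E u w" using no that by auto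
      ultimately show ?thesis by (simp add: E_def)
    qed
    have U': "U \<subseteq> {0..<p}" "W \<subseteq> {0..<p}" using UW A by auto
    have ineq: "(real (card W) * real N)\<^sup>2 \<le> (real_of_int p - real (card U)) *
           (real (card W) * real N + (real (card W))\<^sup>2 * K')"
      unfolding N_def by (rule no_edges_inequality[OF ppos P KK K0 U' none])
    have W0: "0 < real (card W)" using s s1 by linarith
    have Np: "real N \<le> real_of_int p"
    proof -
      have "N \<le> card {0..<p}" unfolding N_def by (intro card_mono) auto
      then show ?thesis using ppos by simp
    qed
    have "(real (card W))\<^sup>2 * (real N)\<^sup>2 \<le> (real (card W))\<^sup>2 * ((real_of_int p - real (card U)) * (real N / real (card W) + K'))"
    proof -
      have "real (card W) * real N + (real (card W))\<^sup>2 * K' = (real (card W))\<^sup>2 * (real N / real (card W) + K')"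
        using W0 by (simp add: power2_eq_square field_simps)
      then show ?thesis using ineq by (simp add: power_mult_distrib mult.left_commute)
    qed
    then have "(real N)\<^sup>2 \<le> (real_of_int p - real (card U)) * (real N / real (card W) + K')"
      using W0 by simp
    also have "\<dots> \<le> (real_of_int p * (1 - x\<^sup>2 / 32)) * (real_of_int p * (x\<^sup>2 + x ^ 5 / 500))"
    proof (intro mult_mono)
      have "real_of_int p * x\<^sup>2 / 32 \<le> real (card U)" using s_ge s(1) by linarith
      then show "real_of_int p - real (card U) \<le> real_of_int p * (1 - x\<^sup>2 / 32)"
        by (simp add: algebra_simps)
      have "real N / real (card W) \<le> real_of_int p / (real_of_int p * x\<^sup>2 / 32)"
        using Np s_ge s(2) px2 ppos by (intro frac_le) auto
      also have "\<dots> = 32 / x\<^sup>2" using ppos by simp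
      also have "\<dots> \<le> real_of_int p * x ^ 5 / 1000"
      proof -
        have "x ^ 7 = x ^ 5 * x\<^sup>2" by (simp flip: power_add)
        then have "32000 \<le> real_of_int p * x ^ 5 * x\<^sup>2" using large by (simp add: mult.assoc)
        then show ?thesis using x by (simp add: pos_divide_le_eq)
      qed
      finally have "real N / real (card W) \<le> real_of_int p * x ^ 5 / 1000" .
      moreover have "K' = real_of_int p * x\<^sup>2 + real_of_int p * x ^ 5 / 1000"
        by (simp add: K'_def algebra_simps)
      ultimately show "real N / real (card W) + K' \<le> real_of_int p * (x\<^sup>2 + x ^ 5 / 500)"
        unfolding distrib_left by linarith
      have "x\<^sup>2 \<le> 1" using x by (simp add: power_le_one)
      then show "0 \<le> real_of_int p * (1 - x\<^sup>2 / 32)" using ppos by simp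
      show "0 \<le> real N / real (card W) + K'" using K0 by simp
    qed
    also have "\<dots> = (real_of_int p)\<^sup>2 * ((1 - x\<^sup>2 / 32) * (x\<^sup>2 + x ^ 5 / 500))"
      by (simp add: power2_eq_square)
    finally have up: "(real N)\<^sup>2 \<le> (real_of_int p)\<^sup>2 * ((1 - x\<^sup>2 / 32) * (x\<^sup>2 + x ^ 5 / 500))" .
    have x3: "x ^ 3 \<le> x" using power_decreasing[of 1 3 x] x by simp
    have "((x - x ^ 3 / 1000) * real_of_int p)\<^sup>2 \<le> (real N)\<^sup>2"
      using N x x3 ppos unfolding N_def by (intro power_mono mult_nonneg_nonneg) auto
    then have "(real_of_int p)\<^sup>2 * (x - x ^ 3 / 1000)\<^sup>2 \<le> (real_of_int p)\<^sup>2 * ((1 - x\<^sup>2 / 32) * (x\<^sup>2 + x ^ 5 / 500))"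
      using up by (simp add: power_mult_distrib mult.commute)
    then have "(x - x ^ 3 / 1000)\<^sup>2 \<le> (1 - x\<^sup>2 / 32) * (x\<^sup>2 + x ^ 5 / 500)"
      using ppos by simp
    moreover have "(x - x ^ 3 / 1000)\<^sup>2 = x\<^sup>2 - x ^ 4 / 500 + x ^ 6 / 1000000"
      by (simp add: eval_nat_numeral field_simps)
    moreover have "(1 - x\<^sup>2 / 32) * (x\<^sup>2 + x ^ 5 / 500) = x\<^sup>2 + x ^ 5 / 500 - x ^ 4 / 32 - x ^ 7 / 16000"
      by (simp add: eval_nat_numeral field_simps)
    moreover have "x ^ 5 \<le> x ^ 4" using x by (intro power_decreasing) auto
    moreover have "0 < x ^ 4" "0 < x ^ 6" "0 < x ^ 7" using x by simp_all
    ultimately show False by linarith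
  qed
  have "A \<noteq> {}" using deg2[of 0] by (auto simp: card_gt_0_iff)
  then obtain v0 where v0: "v0 \<in> A" "\<And>v. v \<in> A \<Longrightarrow> card {w \<in> A. E v w} < 4 * s \<Longrightarrow> v = v0"
    using one_low by (metis all_not_in_conv)
  have "\<exists>xs. is_cycle E xs \<and> set xs = A"
  proof (rule hamiltonian_if_expanding[OF finA _ _ v0(1) s1 _ deg2 edges])
    show "symp E" by (auto simp: E_def symp_def add.commute)
    show "\<not> E v v" for v by (simp add: E_def)
    show "4 * s \<le> card {w \<in> A. E v w}" if "v \<in> A" "v \<noteq> v0" for v
      using v0(2)[of v] that by force
  qed auto
  then show ?thesis by (simp add: E_def)
qed

section \<open>Derivatives and translates of integer polynomials\<close>

lemma smult_of_nat: "smult (int n) a = of_nat n * a"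
  by (simp add: of_nat_poly)

lemma mult_pderiv_power: "q * pderiv (q ^ n) = of_nat n * q ^ n * pderiv q" for q :: "int poly"
proof (cases n)
  case (Suc m)
  have "pderiv (q ^ Suc m) = of_nat (Suc m) * q ^ m * pderiv q"
    by (simp add: pderiv_power_Suc smult_of_nat del: power_Suc of_nat_Suc)
  then have "q * pderiv (q ^ Suc m) = of_nat (Suc m) * (q * q ^ m) * pderiv q"
    by (simp only: mult_ac)
  then show ?thesis by (simp only: Suc power_Suc)
qed simp

text \<open>
  Multiplying by \<open>f1 * f2\<close> avoids the exponents \<open>m - 1\<close> and \<open>n - 1\<close>, so that the formula also holds for exponent \<open>0\<close>.
\<close>

lemma pderiv_monomial_mult:
  fixes f1 f2 :: "int poly"
  shows "f1 * f2 * pderiv (f1 ^ m * f2 ^ n) =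
    f1 ^ m * f2 ^ n * (of_nat m * (pderiv f1 * f2) + of_nat n * (f1 * pderiv f2))"
proof -
  have "f1 * f2 * pderiv (f1 ^ m * f2 ^ n) =
      f1 * f1 ^ m * (f2 * pderiv (f2 ^ n)) + f2 * f2 ^ n * (f1 * pderiv (f1 ^ m))"
    by (simp add: pderiv_mult algebra_simps)
  then show ?thesis unfolding mult_pderiv_power by (simp add: algebra_simps)
qed

lemma degree_mult_bound: "degree a \<le> m \<Longrightarrow> degree b \<le> n \<Longrightarrow> degree (a * b) \<le> m + n"
  for a b :: "int poly"
  using degree_mult_le[of a b] by linarith

lemma degree_pderiv_bound: "degree a \<le> m \<Longrightarrow> degree (pderiv a) \<le> m" for a :: "int poly"
  by (simp add: degree_pderiv)

lemma lead_coeff_translate: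
  fixes f :: "int poly"
  assumes "degree f \<le> n" shows "coeff (f \<circ>\<^sub>p [:t, 1:]) n = coeff f n"
proof (cases "degree f = n")
  case True
  then show ?thesis using lead_coeff_comp[of "[:t, 1:]" f] by (simp add: degree_pcompose)
next
  case False
  then show ?thesis using assms by (simp add: coeff_eq_0 degree_pcompose)
qed

lemma coeff_translate:
  fixes f :: "int poly"
  assumes "degree f \<le> Suc n"
  shows "coeff (f \<circ>\<^sub>p [:t, 1:]) n = coeff f n + int (Suc n) * t * coeff f (Suc n)"
  using assms
proof (induction f arbitrary: n rule: pCons_induct)
  case (pCons a f)
  have d: "degree f \<le> n" using pCons by (cases "f = 0") auto
  have "coeff (f \<circ>\<^sub>p [:t, 1:]) n = coeff f n" using d by (rule lead_coeff_translate)
  then show ?case using pCons.IH[of "n - 1"] d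
    by (cases n) (auto simp: pcompose_pCons algebra_simps)
qed simp

lemma translate_add: "f \<circ>\<^sub>p [:a, 1:] \<circ>\<^sub>p [:b, 1:] = f \<circ>\<^sub>p [:a + b, 1:]" for f :: "int poly"
proof -
  have "[:a, 1:] \<circ>\<^sub>p [:b, 1:] = [:a + b, 1:]" by (simp add: pcompose_pCons)
  then show ?thesis by (metis pcompose_assoc)
qed

lemma higher_pderiv_translate:
  "(pderiv ^^ i) (a \<circ>\<^sub>p [:u, 1:]) = (pderiv ^^ i) a \<circ>\<^sub>p [:u, 1:]" for a :: "int poly"
  by (induction i) (simp_all add: pderiv_pcompose pderiv_pCons)

text \<open>
  The polynomial factor in the \<open>i\<close>-th derivative of \<open>f1 ^ n1 * f2 ^ n2 * x ^ a\<close>, after \<open>f1 ^ (n1 - i) * f2 ^ (n2 - i)\<close> has been taken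
  out; see \<open>higher_pderiv_monomial\<close>. Its degree is bounded independently of \<open>n1\<close> and \<open>n2\<close>, which are of the size of \<open>p\<close>.
\<close>

primrec deriv_cofactor :: "int poly \<Rightarrow> int poly \<Rightarrow> nat \<Rightarrow> nat \<Rightarrow> nat \<Rightarrow> nat \<Rightarrow> int poly" where
  "deriv_cofactor f1 f2 n1 n2 a 0 = monom 1 a"
| "deriv_cofactor f1 f2 n1 n2 a (Suc i) = f1 * f2 * pderiv (deriv_cofactor f1 f2 n1 n2 a i) +
     (of_nat (n1 - i) * (pderiv f1 * f2) + of_nat (n2 - i) * (f1 * pderiv f2)) * deriv_cofactor f1 f2 n1 n2 a i"

lemma degree_deriv_cofactor:
  assumes "degree f1 \<le> d" "degree f2 \<le> d"
  shows "degree (deriv_cofactor f1 f2 n1 n2 a i) \<le> a + 2 * d * i"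
proof (induction i)
  case 0
  then show ?case by (simp add: degree_monom_eq)
next
  case (Suc i)
  let ?q = "deriv_cofactor f1 f2 n1 n2 a i"
  have c: "degree (of_nat c :: int poly) \<le> 0" for c by (simp add: of_nat_poly)
  have "degree (f1 * f2 * pderiv ?q) \<le> (d + d) + (a + 2 * d * i)"
    by (intro degree_mult_bound degree_pderiv_bound assms Suc)
  moreover have "degree ((of_nat (n1 - i) * (pderiv f1 * f2) + of_nat (n2 - i) * (f1 * pderiv f2)) * ?q)
     \<le> (0 + (d + d)) + (a + 2 * d * i)"
    by (intro degree_mult_bound degree_add_le degree_pderiv_bound assms c Suc)
  ultimately show ?case by (simp add: degree_add_le)
qed

section \<open>Integer polynomials modulo a prime\<close>

text \<open>
  Polynomials over the field with \<open>p\<close> elements are represented by integer polynomials, since \<open>p\<close> is a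
  variable of the theorem and cannot be part of a type. The predicates below are being zero, divisibility and congruence
  in \<open>\<int>[x] / p\<close>; the degree is that of the chosen integer representative.
\<close>

locale prime_modulus =
  fixes p :: int
  assumes prime_p: "prime p"
begin

definition zero_mod :: "int poly \<Rightarrow> bool" where
  "zero_mod F \<longleftrightarrow> [:p:] dvd F"

definition dvd_mod :: "int poly \<Rightarrow> int poly \<Rightarrow> bool" where
  "dvd_mod a b \<longleftrightarrow> (\<exists>c. zero_mod (b - a * c))"

lemma zero_mod_iff_coeff: "zero_mod F \<longleftrightarrow> (\<forall>n. p dvd coeff F n)"
  unfolding zero_mod_def by (rule const_poly_dvd_iff)

lemma zero_mod_0 [simp]: "zero_mod 0"
  by (simp add: zero_mod_def)

lemma zero_mod_add: "zero_mod a \<Longrightarrow> zero_mod b \<Longrightarrow> zero_mod (a + b)"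
  by (simp add: zero_mod_def)

lemma zero_mod_diff: "zero_mod a \<Longrightarrow> zero_mod b \<Longrightarrow> zero_mod (a - b)"
  by (simp add: zero_mod_def)

lemma zero_mod_uminus: "zero_mod (- a) \<longleftrightarrow> zero_mod a"
  by (simp add: zero_mod_def)

lemma zero_mod_multI: "zero_mod a \<Longrightarrow> zero_mod (a * b)" "zero_mod b \<Longrightarrow> zero_mod (a * b)"
  by (simp_all add: zero_mod_def)

lemma prime_elem_p: "prime_elem p"
  using prime_p by auto

lemma zero_mod_mult_iff: "zero_mod (a * b) \<longleftrightarrow> zero_mod a \<or> zero_mod b"
  using prime_elem_p unfolding zero_mod_def
  by (intro prime_elem_dvd_mult_iff) (simp add: prime_elem_const_poly_iff)

lemma zero_mod_one: "\<not> zero_mod 1"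
proof
  assume "zero_mod 1"
  then have "p dvd coeff 1 0" unfolding zero_mod_iff_coeff by blast
  then show False using prime_p by (auto simp: prime_int_iff)
qed

lemma zero_mod_power_iff: "zero_mod (a ^ n) \<longleftrightarrow> zero_mod a \<and> 0 < n"
  by (induction n) (auto simp: zero_mod_mult_iff zero_mod_one)

lemma zero_mod_const [simp]: "zero_mod [:c:] \<longleftrightarrow> p dvd c"
  by (simp add: zero_mod_def)

lemma zero_mod_smult_iff: "zero_mod (smult c a) \<longleftrightarrow> p dvd c \<or> zero_mod a"
  using zero_mod_mult_iff[of "[:c:]" a] by simp

lemma zero_mod_sum: "(\<And>i. i \<in> I \<Longrightarrow> zero_mod (f i)) \<Longrightarrow> zero_mod (\<Sum>i\<in>I. f i)"
  by (simp add: zero_mod_def dvd_sum)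

lemma zero_mod_pderiv: "zero_mod a \<Longrightarrow> zero_mod (pderiv a)"
  by (simp add: zero_mod_iff_coeff coeff_pderiv)

lemma zero_mod_poly: "zero_mod a \<Longrightarrow> p dvd poly a x"
  by (auto simp: zero_mod_def elim!: dvdE)

lemma zero_mod_lead_coeff: "\<not> p dvd lead_coeff a \<Longrightarrow> \<not> zero_mod a"
  by (auto simp: zero_mod_iff_coeff)

definition cong_mod :: "int poly \<Rightarrow> int poly \<Rightarrow> bool" where
  "cong_mod a b \<longleftrightarrow> zero_mod (a - b)"

lemma cong_mod_refl [simp]: "cong_mod a a" by (simp add: cong_mod_def)

lemma cong_mod_sym: "cong_mod a b \<Longrightarrow> cong_mod b a"
  unfolding cong_mod_def using zero_mod_uminus[of "a - b"] by simp

lemma cong_mod_trans [trans]: "cong_mod a b \<Longrightarrow> cong_mod b c \<Longrightarrow> cong_mod a c"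
  unfolding cong_mod_def using zero_mod_add[of "a - b" "b - c"] by simp

lemma cong_mod_zero: "cong_mod a b \<Longrightarrow> zero_mod a \<longleftrightarrow> zero_mod b"
  unfolding cong_mod_def using zero_mod_add[of "a - b" b] zero_mod_diff[of a "a - b"] by auto

lemma cong_mod_add: "cong_mod a b \<Longrightarrow> cong_mod c d \<Longrightarrow> cong_mod (a + c) (b + d)"
  unfolding cong_mod_def using zero_mod_add[of "a - b" "c - d"] by (simp add: algebra_simps)

lemma cong_mod_diff: "cong_mod a b \<Longrightarrow> cong_mod c d \<Longrightarrow> cong_mod (a - c) (b - d)"
  unfolding cong_mod_def using zero_mod_diff[of "a - b" "c - d"] by (simp add: algebra_simps)

lemma cong_mod_mult:
  assumes "cong_mod a b" "cong_mod c d" shows "cong_mod (a * c) (b * d)"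
proof -
  have "a * c - b * d = (a - b) * c + b * (c - d)" by (simp add: algebra_simps)
  then show ?thesis
    using assms zero_mod_add[of "(a - b) * c" "b * (c - d)"] unfolding cong_mod_def
    by (auto simp: zero_mod_mult_iff)
qed

lemma cong_mod_pderiv: "cong_mod a b \<Longrightarrow> cong_mod (pderiv a) (pderiv b)"
  unfolding cong_mod_def using zero_mod_pderiv[of "a - b"] by (simp add: pderiv_diff)

lemma dvd_mod_alt: "dvd_mod a b \<longleftrightarrow> (\<exists>c. cong_mod b (a * c))"
  by (simp add: dvd_mod_def cong_mod_def)

lemma dvd_mod_triv [simp]: "dvd_mod a (a * b)" "dvd_mod a (b * a)" "dvd_mod a a"
  unfolding dvd_mod_alt by (metis cong_mod_refl mult.commute mult_1_right)+

lemma dvd_mod_cong: "dvd_mod a b \<Longrightarrow> cong_mod b c \<Longrightarrow> dvd_mod a c"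
  unfolding dvd_mod_alt using cong_mod_sym cong_mod_trans by blast

lemma dvd_mod_add: "dvd_mod a b \<Longrightarrow> dvd_mod a c \<Longrightarrow> dvd_mod a (b + c)"
  unfolding dvd_mod_alt using cong_mod_add by (metis distrib_left)

lemma dvd_mod_diff: "dvd_mod a b \<Longrightarrow> dvd_mod a c \<Longrightarrow> dvd_mod a (b - c)"
  unfolding dvd_mod_alt using cong_mod_diff by (metis right_diff_distrib)

lemma dvd_mod_multI: "dvd_mod a b \<Longrightarrow> dvd_mod a (b * c)" "dvd_mod a b \<Longrightarrow> dvd_mod a (c * b)"
  unfolding dvd_mod_alt using cong_mod_mult[OF _ cong_mod_refl] cong_mod_mult[OF cong_mod_refl]
  by (metis mult.assoc, metis mult.left_commute)

lemma dvd_mod_smultI: "dvd_mod a b \<Longrightarrow> dvd_mod a (smult c b)"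
  using dvd_mod_multI(2)[of a b "[:c:]"] by simp

lemma dvd_mod_trans: "dvd_mod a b \<Longrightarrow> dvd_mod b c \<Longrightarrow> dvd_mod a c"
  unfolding dvd_mod_alt using cong_mod_mult[OF _ cong_mod_refl] cong_mod_trans by (metis mult.assoc)

lemma inverse_mod:
  assumes "\<not> p dvd c" shows "\<exists>d. p dvd 1 - d * c"
proof -
  have "coprime c p" using assms prime_p by (metis coprime_commute prime_imp_coprime)
  then obtain d where "[c * d = 1] (mod p)" using cong_solve_coprime_int by blast
  then have "p dvd c * d - 1" by (simp add: cong_iff_dvd_diff)
  then have "p dvd 1 - d * c" by (metis dvd_diff_commute mult.commute)
  then show ?thesis ..
qed

lemma dvd_mod_smult_cancel:
  assumes "\<not> p dvd c" "dvd_mod a (smult c b)" shows "dvd_mod a b"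
proof -
  obtain d where "p dvd 1 - d * c" using inverse_mod assms by blast
  then have "zero_mod ([:1 - d * c:] * b)" using zero_mod_const zero_mod_mult_iff by blast
  then have "cong_mod (smult d (smult c b)) b"
    using zero_mod_uminus[of "[:1 - d * c:] * b"] by (simp add: cong_mod_def smult_diff_left)
  then show ?thesis using dvd_mod_smultI[OF assms(2)] dvd_mod_cong by blast
qed

text \<open>
  Reducing the coefficients gives a representative whose degree is the degree modulo \<open>p\<close>.
\<close>

lemma reduced_representative:
  assumes "\<not> zero_mod a"
  shows "\<exists>b. cong_mod a b \<and> \<not> p dvd lead_coeff b \<and> degree b \<le> degree a"
proof -
  define b where "b = map_poly (\<lambda>c. c mod p) a"
  have cb: "coeff b n = coeff a n mod p" for n by (simp add: b_def coeff_map_poly)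
  have eq: "cong_mod a b"
    by (simp add: cong_mod_def zero_mod_iff_coeff cb flip: mod_eq_dvd_iff)
  have "b \<noteq> 0" using assms cong_mod_zero[OF eq] by auto
  then have "coeff a (degree b) mod p \<noteq> 0" using cb[of "degree b"] by (metis leading_coeff_0_iff)
  then have "\<not> p dvd lead_coeff b" by (simp add: cb dvd_eq_mod_eq_0)
  moreover have "degree b \<le> degree a" by (rule degree_le) (auto simp: cb coeff_eq_0)
  ultimately show ?thesis using eq by blast
qed

text \<open>
  Degrees of divisors behave as over a field, once the leading coefficients are units modulo \<open>p\<close>.
\<close>

lemma degree_cofactor:
  assumes a: "\<not> zero_mod a" and q: "\<not> p dvd lead_coeff q" and "dvd_mod q a"
  shows "\<exists>c. cong_mod a (q * c) \<and> \<not> p dvd lead_coeff c \<and> degree q + degree c \<le> degree a"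
proof -
  obtain c0 where c0: "cong_mod a (q * c0)" using assms(3) dvd_mod_alt by blast
  then have "\<not> zero_mod c0" using a cong_mod_zero zero_mod_multI by blast
  then obtain c where c: "cong_mod c0 c" "\<not> p dvd lead_coeff c"
    using reduced_representative by blast
  have eq: "cong_mod a (q * c)" using c0 c cong_mod_mult[OF cong_mod_refl] cong_mod_trans by blast
  have "\<not> p dvd coeff (q * c) (degree q + degree c)"
    using q c prime_p by (simp add: coeff_mult_degree_sum prime_dvd_mult_iff)
  moreover have "p dvd coeff (a - q * c) (degree q + degree c)"
    using eq by (simp add: cong_mod_def zero_mod_iff_coeff)
  ultimately have "coeff a (degree q + degree c) \<noteq> 0" by auto
  then show ?thesis using eq c le_degree by blast
qed

text \<open>
  Pseudo-division over the integers, followed by an inverse of the power of the leading coefficient.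
\<close>

lemma division_mod:
  assumes "\<not> p dvd lead_coeff q"
  shows "\<exists>s r. cong_mod a (q * s + r) \<and> (r = 0 \<or> degree r < degree q)"
proof -
  have "q \<noteq> 0" using assms by auto
  define e where "e = Suc (degree a) - degree q"
  obtain s r where sr: "pseudo_divmod a q = (s, r)" by force
  have eq: "smult (lead_coeff q ^ e) a = q * s + r" and r: "r = 0 \<or> degree r < degree q"
    using pseudo_divmod[OF \<open>q \<noteq> 0\<close> sr] by (auto simp: e_def)
  have "\<not> p dvd lead_coeff q ^ e" using assms prime_p prime_dvd_power by blast
  then obtain d where d: "p dvd 1 - d * lead_coeff q ^ e" using inverse_mod by blast
  then have "zero_mod ([:1 - d * lead_coeff q ^ e:] * a)" using zero_mod_const zero_mod_mult_iff by blast
  then have "cong_mod a (smult d (smult (lead_coeff q ^ e) a))"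
    by (simp add: cong_mod_def smult_diff_left)
  also have "smult d (smult (lead_coeff q ^ e) a) = q * smult d s + smult d r"
    unfolding eq by (simp add: smult_add_right)
  finally show ?thesis using r by (metis degree_smult_le le_less_trans smult_0_right)
qed

definition prime_mod :: "int poly \<Rightarrow> bool" where
  "prime_mod q \<longleftrightarrow> \<not> p dvd lead_coeff q \<and> 1 \<le> degree q \<and>
     (\<forall>a b. dvd_mod q (a * b) \<longrightarrow> dvd_mod q a \<or> dvd_mod q b)"

lemma not_dvd_const:
  assumes "\<not> p dvd lead_coeff q" "1 \<le> degree q" "\<not> p dvd c"
  shows "\<not> dvd_mod q [:c:]"
  using degree_cofactor[of "[:c:]" q] assms by auto

text \<open>
  Take a divisor \<open>q\<close> of \<open>f\<close> of least degree that does not divide \<open>h\<close>. Every divisor \<open>z\<close> of \<open>q\<close> is trivial: otherwise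
  \<open>z\<close> and its cofactor \<open>r\<close> have smaller degree and both divide \<open>h\<close>; they are coprime because \<open>f\<close> is
  squarefree (the identity \<open>u * f + v * pderiv f = [:R:]\<close>), so \<open>q\<close> divides \<open>h\<close> as well. Hence Bezout makes \<open>q\<close> prime.
\<close>

lemma exists_prime_factor_not_dividing:
  assumes f: "\<not> zero_mod f" and bez: "u * f + v * pderiv f = [:R:]" "\<not> p dvd R"
    and h: "\<not> dvd_mod f h"
  shows "\<exists>q. prime_mod q \<and> dvd_mod q f \<and> \<not> dvd_mod q h \<and> \<not> dvd_mod q (pderiv f)"
proof -
  define T where "T q \<longleftrightarrow> \<not> p dvd lead_coeff q \<and> dvd_mod q f \<and> \<not> dvd_mod q h" for q
  obtain f' where f': "cong_mod f f'" "\<not> p dvd lead_coeff f'"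
    using reduced_representative[OF f] by blast
  have "dvd_mod f' f" using dvd_mod_cong[OF dvd_mod_triv(3) cong_mod_sym[OF f'(1)]] .
  moreover have "\<not> dvd_mod f' h"
    using h dvd_mod_trans[OF dvd_mod_cong[OF dvd_mod_triv(3) f'(1)], of h] by blast
  ultimately have "T f'" using f'(2) by (simp add: T_def)
  then have "\<exists>q. T q \<and> (\<forall>r. T r \<longrightarrow> degree q \<le> degree r)"
    by (rule ex_has_least_nat)
  then obtain q where q: "T q" and least: "\<And>r. T r \<Longrightarrow> degree q \<le> degree r"
    by blast
  have lq: "\<not> p dvd lead_coeff q" and qf: "dvd_mod q f" and qh: "\<not> dvd_mod q h"
    using q by (auto simp: T_def)
  have small: "dvd_mod r h" if "\<not> p dvd lead_coeff r" "dvd_mod r f" "degree r < degree q" for r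
    using least[of r] that by (force simp: T_def)
  have unit: "dvd_mod r a" if r: "degree r = 0" "\<not> p dvd lead_coeff r" for r a
  proof -
    obtain c where c: "r = [:c:]" using r(1) by (blast elim: degree_eq_zeroE)
    then have "\<not> p dvd c" using r(2) by simp
    moreover have "dvd_mod r (smult c a)" using dvd_mod_triv(1)[of "[:c:]" a] c by simp
    ultimately show ?thesis by (rule dvd_mod_smult_cancel)
  qed
  have deg1: "1 \<le> degree q" using unit[of q h] lq qh by (cases "degree q") auto
  have prime: "dvd_mod q b" if ab: "dvd_mod q (a * b)" and na: "\<not> dvd_mod q a" for a b
  proof -
    define I where "I z \<longleftrightarrow> (\<exists>x y. cong_mod z (x * q + y * a)) \<and> \<not> p dvd lead_coeff z" for z
    have "I q" unfolding I_def using lq by (metis add.right_neutral cong_mod_refl mult_1 mult_zero_left)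
    then have "\<exists>z. I z \<and> (\<forall>w. I w \<longrightarrow> degree z \<le> degree w)"
      by (rule ex_has_least_nat)
    then obtain z where z: "I z" and zleast: "\<And>w. I w \<Longrightarrow> degree z \<le> degree w"
      by blast
    then obtain x y where xy: "cong_mod z (x * q + y * a)" and lz: "\<not> p dvd lead_coeff z"
      by (auto simp: I_def)
    have zdvd: "dvd_mod z c" if c: "cong_mod c (x' * q + y' * a)" for c x' y'
    proof -
      obtain s r where sr: "cong_mod c (z * s + r)" "r = 0 \<or> degree r < degree z"
        using division_mod[OF lz] by blast
      have "zero_mod r"
      proof (rule ccontr)
        assume nr: "\<not> zero_mod r"
        then obtain r' where r': "cong_mod r r'" "\<not> p dvd lead_coeff r'" "degree r' \<le> degree r"
          using reduced_representative by blast
        have "cong_mod r (c - z * s)"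
          using cong_mod_sym[OF cong_mod_diff[OF sr(1) cong_mod_refl[of "z * s"]]] by simp
        also have "cong_mod \<dots> ((x' * q + y' * a) - (x * q + y * a) * s)"
          by (intro cong_mod_diff c cong_mod_mult xy cong_mod_refl)
        also have "(x' * q + y' * a) - (x * q + y * a) * s = (x' - x * s) * q + (y' - y * s) * a"
          by (simp add: algebra_simps)
        finally have "cong_mod r' ((x' - x * s) * q + (y' - y * s) * a)"
          by (rule cong_mod_trans[OF cong_mod_sym[OF r'(1)]])
        then have "I r'" unfolding I_def using r'(2) by blast
        then have "degree z \<le> degree r" using zleast r'(3) by fastforce
        then show False using sr(2) nr by auto
      qed
      then have "cong_mod (z * s + r) (z * s)" by (simp add: cong_mod_def)
      then have "cong_mod (z * s) c" using cong_mod_sym[OF cong_mod_trans[OF sr(1)]] by blast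
      then show ?thesis by (rule dvd_mod_cong[OF dvd_mod_triv(1)])
    qed
    have zq: "dvd_mod z q" using zdvd[of q 1 0] by simp
    have za: "dvd_mod z a" using zdvd[of a 0 1] by simp
    obtain r where r: "cong_mod q (z * r)" "\<not> p dvd lead_coeff r" "degree z + degree r \<le> degree q"
      using degree_cofactor[OF _ lz zq] zero_mod_lead_coeff[OF lq] by blast
    have "degree z = 0"
    proof (rule ccontr)
      assume z0: "degree z \<noteq> 0"
      have zf: "dvd_mod z f" by (rule dvd_mod_trans[OF zq qf])
      show False
      proof (cases "degree r = 0")
        case True
        then obtain c where c: "r = [:c:]" by (blast elim: degree_eq_zeroE)
        have "cong_mod (smult c z) q" using r(1) c cong_mod_sym by simp
        then have "dvd_mod q (smult c z)" using dvd_mod_cong[OF dvd_mod_triv(3) cong_mod_sym] by blast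
        moreover have "\<not> p dvd c" using r(2) c by simp
        ultimately have "dvd_mod q z" by (metis dvd_mod_smult_cancel)
        then show False using na dvd_mod_trans[OF _ za] by blast
      next
        case False
        have rq: "dvd_mod r q" by (rule dvd_mod_cong[OF dvd_mod_triv(2) cong_mod_sym[OF r(1)]])
        have "degree r < degree q" "degree z < degree q" using r(3) False z0 by linarith+
        then have rh: "dvd_mod r h" and zh: "dvd_mod z h"
          using small[OF r(2) dvd_mod_trans[OF rq qf]] small[OF lz zf] by blast+
        obtain h1 where h1: "cong_mod h (z * h1)" using zh dvd_mod_alt by blast
        obtain h2 where h2: "cong_mod h (r * h2)" using rh dvd_mod_alt by blast
        obtain s where s: "cong_mod f (q * s)" using qf dvd_mod_alt by blast
        have fzrs: "cong_mod f (z * r * s)"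
          by (rule cong_mod_trans[OF s cong_mod_mult[OF r(1) cong_mod_refl]])
        define X where "X = u * r * s + v * (pderiv r * s + r * pderiv s)"
        define Y where "Y = v * pderiv z * s"
        have "cong_mod [:R:] (u * (z * r * s) + v * pderiv (z * r * s))"
          unfolding bez(1)[symmetric]
          by (intro cong_mod_add cong_mod_mult cong_mod_refl fzrs cong_mod_pderiv)
        also have "u * (z * r * s) + v * pderiv (z * r * s) = X * z + Y * r"
          by (simp add: X_def Y_def pderiv_mult algebra_simps)
        finally have RXY: "cong_mod [:R:] (X * z + Y * r)" .
        have "cong_mod ([:R:] * h) ((X * z + Y * r) * h)"
          by (intro cong_mod_mult RXY cong_mod_refl)
        also have "(X * z + Y * r) * h = X * z * h + Y * r * h" by (simp add: algebra_simps)
        also have "cong_mod \<dots> (X * z * (r * h2) + Y * r * (z * h1))"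
          by (intro cong_mod_add cong_mod_mult cong_mod_refl h1 h2)
        also have "X * z * (r * h2) + Y * r * (z * h1) = (z * r) * (X * h2 + Y * h1)"
          by (simp add: algebra_simps)
        also have "cong_mod \<dots> (q * (X * h2 + Y * h1))"
          by (intro cong_mod_mult cong_mod_sym[OF r(1)] cong_mod_refl)
        finally have "dvd_mod q (smult R h)"
          using dvd_mod_alt by auto
        then show False using dvd_mod_smult_cancel[OF bez(2)] qh by blast
      qed
    qed
    then have "dvd_mod z 1" using unit lz by blast
    then obtain e where e: "cong_mod 1 (z * e)" using dvd_mod_alt by blast
    have "cong_mod (1 * b) (z * e * b)" by (intro cong_mod_mult e cong_mod_refl)
    also have "cong_mod \<dots> ((x * q + y * a) * e * b)"
      by (intro cong_mod_mult xy cong_mod_refl)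
    also have "(x * q + y * a) * e * b = q * (x * e * b) + (a * b) * (y * e)"
      by (simp add: algebra_simps)
    finally have "cong_mod (q * (x * e * b) + (a * b) * (y * e)) b" by (metis cong_mod_sym mult_1)
    moreover have "dvd_mod q (q * (x * e * b) + (a * b) * (y * e))"
      by (intro dvd_mod_add dvd_mod_triv dvd_mod_multI(1) ab)
    ultimately show ?thesis using dvd_mod_cong by blast
  qed
  have "\<not> dvd_mod q (pderiv f)"
  proof
    assume "dvd_mod q (pderiv f)"
    then have "dvd_mod q (u * f + v * pderiv f)" by (intro dvd_mod_add dvd_mod_multI(2) qf)
    then show False using not_dvd_const[OF lq deg1 bez(2)] bez(1) by simp
  qed
  then show ?thesis using prime lq deg1 qf qh unfolding prime_mod_def by blast
qed

text \<open>
  A quotient of two polynomials of equal degree and leading coefficient is \<open>1\<close>, but the second coefficient of the translate differs by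
  \<open>degree f * t * lead_coeff f\<close>.
\<close>

lemma not_dvd_translate:
  assumes lc: "\<not> p dvd lead_coeff f" and d: "\<not> p dvd int (degree f)" and t: "\<not> p dvd t"
  shows "\<not> dvd_mod f (f \<circ>\<^sub>p [:t, 1:])"
proof
  define h where "h = f \<circ>\<^sub>p [:t, 1:]"
  define n where "n = degree f - 1"
  assume "dvd_mod f (f \<circ>\<^sub>p [:t, 1:])"
  then have fh: "dvd_mod f h" by (simp add: h_def)
  have dh: "degree h = degree f" by (simp add: h_def degree_pcompose)
  have lh: "lead_coeff h = lead_coeff f" by (simp add: h_def lead_coeff_comp)
  obtain c where c: "cong_mod h (f * c)" "degree f + degree c \<le> degree h"
    using degree_cofactor[OF _ lc fh] zero_mod_lead_coeff[of h] lh lc by auto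
  then obtain c0 where c0: "c = [:c0:]" using dh degree_eq_zeroE by auto
  have co: "p dvd coeff h i - c0 * coeff f i" for i
    using c(1) c0 by (simp add: cong_mod_def zero_mod_iff_coeff mult.commute)
  have "p dvd lead_coeff f * (1 - c0)"
    using co[of "degree f"] lh dh by (simp add: algebra_simps)
  then have c1: "p dvd 1 - c0" using lc prime_p by (simp add: prime_dvd_mult_iff)
  have "degree f \<noteq> 0"
  proof
    assume "degree f = 0"
    then show False using d by simp
  qed
  then have dn: "degree f = Suc n" by (simp add: n_def)
  have "coeff h n = coeff f n + int (degree f) * t * lead_coeff f"
    using coeff_translate[of f n t] dn by (simp add: h_def)
  then have "coeff h n - c0 * coeff f n = (1 - c0) * coeff f n + int (degree f) * t * lead_coeff f"
    by (simp add: algebra_simps)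
  then have "p dvd int (degree f) * t * lead_coeff f"
    using co[of n] c1 by (metis dvd_add_right_iff dvd_mult2)
  then show False using d t lc prime_p by (simp add: prime_dvd_mult_iff)
qed

lemma not_p_dvd_one: "\<not> p dvd 1"
  using prime_p by (meson not_prime_unit)

lemma p_pos: "0 < p"
  using prime_p by (rule prime_gt_0_int)

section \<open>Zeros of high multiplicity modulo a prime\<close>

lemma dvd_mod_power_cancel:
  assumes q: "prime_mod q" and a: "\<not> dvd_mod q a" and "dvd_mod (q ^ L) (a * b)"
  shows "dvd_mod (q ^ L) b"
  using assms(3)
proof (induction L)
  case 0
  then show ?case using dvd_mod_triv(1)[of 1 b] by simp
next
  case (Suc L)
  obtain C where C: "cong_mod (a * b) (q ^ Suc L * C)" using Suc.prems dvd_mod_alt by blast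
  have "q ^ Suc L * C = q ^ L * (q * C)" by simp
  then have "dvd_mod (q ^ L) (a * b)" using C dvd_mod_alt by metis
  then obtain b' where b': "cong_mod b (q ^ L * b')" using Suc.IH dvd_mod_alt by blast
  have "cong_mod (a * (q ^ L * b')) (a * b)"
    by (intro cong_mod_mult cong_mod_refl cong_mod_sym[OF b'])
  also note C
  finally have "zero_mod (q ^ L * (a * b' - q * C))"
    by (simp add: cong_mod_def algebra_simps)
  moreover have "\<not> zero_mod q" using q zero_mod_lead_coeff by (simp add: prime_mod_def)
  ultimately have "zero_mod (a * b' - q * C)" by (simp add: zero_mod_mult_iff zero_mod_power_iff)
  then have "dvd_mod q (a * b')" unfolding dvd_mod_def by blast
  then have "dvd_mod q b'" using q a unfolding prime_mod_def by blast
  then obtain b'' where "cong_mod b' (q * b'')" using dvd_mod_alt by blast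
  then have "cong_mod (q ^ L * b') (q ^ L * (q * b''))" by (intro cong_mod_mult cong_mod_refl)
  then have "cong_mod b (q ^ L * (q * b''))" by (rule cong_mod_trans[OF b'])
  then have "cong_mod b (q ^ Suc L * b'')" by (simp add: mult_ac)
  then show ?case unfolding dvd_mod_alt by blast
qed

lemma dvd_mod_linear_iff: "dvd_mod [:- u, 1:] a \<longleftrightarrow> p dvd poly a u"
proof
  assume "dvd_mod [:- u, 1:] a"
  then obtain c where "zero_mod (a - [:- u, 1:] * c)" using dvd_mod_def by blast
  then show "p dvd poly a u" using zero_mod_poly[of _ u] by fastforce
next
  assume "p dvd poly a u"
  moreover have "a - [:- u, 1:] * synthetic_div a u = [:poly a u:]"
    using synthetic_div_correct'[of u a] by (simp add: algebra_simps)
  ultimately show "dvd_mod [:- u, 1:] a" unfolding dvd_mod_def by (metis zero_mod_const)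
qed

lemma prime_mod_linear: "prime_mod [:- u, 1:]"
  using prime_p unfolding prime_mod_def dvd_mod_linear_iff
  by (auto simp: prime_dvd_mult_iff)

lemma zero_mod_pcompose: "zero_mod a \<Longrightarrow> zero_mod (a \<circ>\<^sub>p b)"
proof -
  assume "zero_mod a"
  then obtain k where "a = [:p:] * k" unfolding zero_mod_def by blast
  then have "a \<circ>\<^sub>p b = smult p (k \<circ>\<^sub>p b)" by (simp add: pcompose_smult)
  then show ?thesis by (simp add: zero_mod_smult_iff)
qed

lemma dvd_mod_pcompose: "dvd_mod a b \<Longrightarrow> dvd_mod (a \<circ>\<^sub>p c) (b \<circ>\<^sub>p c)"
  unfolding dvd_mod_def using zero_mod_pcompose by (metis pcompose_diff pcompose_mult)

text \<open>
  After translating \<open>u\<close> to \<open>0\<close>, the \<open>i\<close>-th derivative at \<open>0\<close> is \<open>fact i\<close> times a coefficient, and \<open>fact i\<close> is a unit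
  modulo \<open>p\<close> for \<open>i < L\<close>. This is where the order of vanishing must not exceed the characteristic.
\<close>

lemma dvd_mod_linear_power:
  assumes L: "int L \<le> p" and der: "\<And>i. i < L \<Longrightarrow> p dvd poly ((pderiv ^^ i) a) u"
  shows "dvd_mod ([:- u, 1:] ^ L) a"
proof -
  define h where "h = a \<circ>\<^sub>p [:u, 1:]"
  have "p dvd coeff h i" if i: "i < L" for i
  proof -
    have "poly ((pderiv ^^ i) a) u = poly ((pderiv ^^ i) h) 0"
      by (simp add: h_def higher_pderiv_translate poly_pcompose)
    also have "\<dots> = fact i * coeff h i"
      by (simp add: poly_0_coeff_0 coeff_higher_pderiv pochhammer_fact)
    finally have "p dvd fact i * coeff h i" by (rule subst) (rule der[OF i])
    moreover have "\<not> p dvd fact i" 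
    proof -
      have "prime (nat p)" using prime_p prime_int_nat_transfer by blast
      moreover have "i < nat p" using i L by linarith
      ultimately have "\<not> nat p dvd fact i" by (simp add: prime_dvd_fact_iff)
      moreover have "int (nat p) = p" using p_pos by simp
      ultimately show ?thesis by (metis int_dvd_int_iff of_nat_fact)
    qed
    ultimately show ?thesis using prime_p by (simp add: prime_dvd_mult_iff)
  qed
  then have "zero_mod (h - monom 1 L * poly_shift L h)"
    by (auto simp: zero_mod_iff_coeff coeff_monom_mult coeff_poly_shift)
  then have "dvd_mod (monom 1 L) h" using dvd_mod_def by blast
  then have "dvd_mod (monom 1 L \<circ>\<^sub>p [:- u, 1:]) (h \<circ>\<^sub>p [:- u, 1:])" by (rule dvd_mod_pcompose)
  moreover have "h \<circ>\<^sub>p [:- u, 1:] = a"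
    by (simp add: h_def pcompose_assoc[symmetric] pcompose_pCons)
  moreover have "monom 1 L \<circ>\<^sub>p [:- u, 1:] = [:- u, 1:] ^ L"
    
  proof (induction L)
    case (Suc L)
    have "monom (1 :: int) (Suc L) = [:0, 1:] * monom 1 L" by (simp add: monom_Suc)
    then show ?case by (simp only: pcompose_mult Suc.IH power_Suc) (simp add: pcompose_pCons)
  qed (simp add: pcompose_1)
  ultimately show ?thesis by simp
qed

lemma zero_mod_if_many_roots:
  assumes Z: "Z \<subseteq> {0..<p}" and L: "int L \<le> p"
    and der: "\<And>i u. i < L \<Longrightarrow> u \<in> Z \<Longrightarrow> p dvd poly ((pderiv ^^ i) a) u"
    and deg: "degree a < L * card Z"
  shows "zero_mod a"
proof (rule ccontr)
  assume a: "\<not> zero_mod a"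
  have fin: "finite Z" using Z by (rule finite_subset) simp
  define M where "M Y = (\<Prod>u\<in>Y. [:- u, 1:] ^ L)" for Y :: "int set"
  have monic: "lead_coeff (M Y) = 1" for Y
    by (simp add: M_def lead_coeff_prod lead_coeff_power)
  have degM: "degree (M Y) = L * card Y" for Y
    by (simp add: M_def degree_prod_eq_sum_degree degree_power_eq)
  have "dvd_mod (M Y) a" if "Y \<subseteq> Z" for Y
    using finite_subset[OF that fin] that
  proof (induction Y rule: finite_induct)
    case empty
    then show ?case using dvd_mod_triv(1)[of 1 a] by (simp add: M_def)
  next
    case (insert v Y)
    obtain c where c: "cong_mod a (M Y * c)" using insert dvd_mod_alt by blast
    have "dvd_mod ([:- v, 1:] ^ L) a" using insert der L by (intro dvd_mod_linear_power) auto
    then have "dvd_mod ([:- v, 1:] ^ L) (M Y * c)" using c by (rule dvd_mod_cong)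
    moreover have "\<not> p dvd poly (M Y) v"
    proof
      assume "p dvd poly (M Y) v"
      then obtain u where u: "u \<in> Y" "p dvd (v - u) ^ L"
        using insert prime_p by (auto simp: M_def poly_prod prime_dvd_prod_iff)
      then have "p dvd v - u" using prime_p prime_dvd_power by blast
      moreover have "u \<in> {0..<p}" "v \<in> {0..<p}" using u insert Z by blast+
      then have "\<bar>v - u\<bar> < p" by auto
      ultimately have "v = u" using zdvd_imp_le[of p "\<bar>v - u\<bar>"] by fastforce
      then show False using u insert by simp
    qed
    ultimately have "dvd_mod ([:- v, 1:] ^ L) c"
      by (intro dvd_mod_power_cancel[OF prime_mod_linear, of v "M Y" L c]) (simp add: dvd_mod_linear_iff)
    then obtain c' where "cong_mod c ([:- v, 1:] ^ L * c')" using dvd_mod_alt by blast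
    then have "cong_mod (M Y * c) (M Y * ([:- v, 1:] ^ L * c'))" by (intro cong_mod_mult cong_mod_refl)
    then have "cong_mod a (M Y * ([:- v, 1:] ^ L * c'))" by (rule cong_mod_trans[OF c])
    then have "cong_mod a (M (insert v Y) * c')" using insert by (simp add: M_def mult_ac)
    then show ?case using dvd_mod_alt by blast
  qed
  then have "dvd_mod (M Z) a" by simp
  then show False using degree_cofactor[OF a, of "M Z"] monic[of Z] degM[of Z] deg not_p_dvd_one
    by fastforce
qed

section \<open>Independence of products of high powers\<close>

lemma valuation_mod:
  assumes q: "prime_mod q" and "\<not> zero_mod e"
  shows "\<exists>a E. cong_mod e (q ^ a * E) \<and> \<not> dvd_mod q E \<and> a \<le> degree e"
  using assms(2)
proof (induction "degree e" arbitrary: e rule: less_induct)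
  case less
  show ?case
  proof (cases "dvd_mod q e")
    case False
    then show ?thesis by (intro exI[of _ 0] exI[of _ e]) simp
  next
    case True
    then obtain c where c: "cong_mod e (q * c)" "\<not> p dvd lead_coeff c" "degree q + degree c \<le> degree e"
      using degree_cofactor[OF less.prems] q unfolding prime_mod_def by blast
    have small: "degree c < degree e" using c q by (auto simp: prime_mod_def)
    then obtain a E where aE: "cong_mod c (q ^ a * E)" "\<not> dvd_mod q E" "a \<le> degree c"
      using less.hyps zero_mod_lead_coeff[OF c(2)] by blast
    have "cong_mod (q * c) (q * (q ^ a * E))" by (intro cong_mod_mult cong_mod_refl aE)
    then have "cong_mod e (q ^ Suc a * E)" using cong_mod_trans[OF c(1)] by (simp add: mult_ac)
    then show ?thesis using aE small by (intro exI[of _ "Suc a"] exI[of _ E]) simp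
  qed
qed

text \<open>
  A simple prime factor of \<open>f\<close> that is not a factor of \<open>h\<close>; the last condition says that it divides \<open>f\<close> only once.
\<close>

definition separating :: "int poly \<Rightarrow> int poly \<Rightarrow> int poly \<Rightarrow> bool" where
  "separating q f h \<longleftrightarrow> prime_mod q \<and> dvd_mod q f \<and> \<not> dvd_mod q h \<and> \<not> dvd_mod q (pderiv f)"

text \<open>
  Up to powers of \<open>f1\<close> and \<open>f2\<close>, the hypothesis says that \<open>f1 ^ c1 * f2 ^ c2 * e / e0\<close> has derivative zero. In
  characteristic \<open>p\<close> its order at any prime \<open>q\<close> that does not divide its own derivative is then a multiple of \<open>p\<close>. At a simple factor \<open>q\<close>
  of \<open>f1\<close> that does not divide \<open>f2\<close> this order is \<open>c1 + a - b\<close>, with the orders \<open>a\<close>, \<open>b\<close> of \<open>e\<close> and \<open>e0\<close>.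
\<close>

lemma ratio_valuation:
  assumes q: "separating q f1 f2" and e: "\<not> zero_mod e" and e0: "\<not> zero_mod e0"
    and zero: "zero_mod (f1 * f2 * (e0 * pderiv e - pderiv e0 * e)
       + (of_int c1 * (pderiv f1 * f2) + of_int c2 * (f1 * pderiv f2)) * e0 * e)"
  shows "\<exists>a b. a \<le> degree e \<and> b \<le> degree e0 \<and> p dvd int a - int b + c1"
proof -
  have pr: "prime_mod q" and nf2: "\<not> dvd_mod q f2" and nf1': "\<not> dvd_mod q (pderiv f1)"
    using q by (auto simp: separating_def)
  obtain G where G: "cong_mod f1 (q * G)" using q dvd_mod_alt by (auto simp: separating_def)
  obtain a E where E: "cong_mod e (q ^ a * E)" "\<not> dvd_mod q E" "a \<le> degree e"
    using valuation_mod[OF pr e] by blast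
  obtain b E0 where E0: "cong_mod e0 (q ^ b * E0)" "\<not> dvd_mod q E0" "b \<le> degree e0"
    using valuation_mod[OF pr e0] by blast
  have f1': "cong_mod (q * pderiv G + G * pderiv q) (pderiv f1)"
    using cong_mod_sym[OF cong_mod_pderiv[OF G]] by (simp add: pderiv_mult)
  have nG: "\<not> dvd_mod q G"
  proof
    assume "dvd_mod q G"
    then have "dvd_mod q (q * pderiv G + G * pderiv q)" by (intro dvd_mod_add dvd_mod_multI(1) dvd_mod_triv)
    then show False using nf1' dvd_mod_cong[OF _ f1'] by blast
  qed
  have nq': "\<not> dvd_mod q (pderiv q)"
  proof
    assume "dvd_mod q (pderiv q)"
    then have "dvd_mod q (q * pderiv G + G * pderiv q)" by (intro dvd_mod_add dvd_mod_multI(2) dvd_mod_triv(1))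
    then show False using nf1' dvd_mod_cong[OF _ f1'] by blast
  qed
  define P where "P = pderiv (q ^ a * E)"
  define P0 where "P0 = pderiv (q ^ b * E0)"
  have qP: "q * P = q ^ a * (of_nat a * pderiv q * E + q * pderiv E)"
    using mult_pderiv_power[of q a] by (simp add: P_def pderiv_mult algebra_simps)
  have qP0: "q * P0 = q ^ b * (of_nat b * pderiv q * E0 + q * pderiv E0)"
    using mult_pderiv_power[of q b] by (simp add: P0_def pderiv_mult algebra_simps)
  define m where "m = int a - int b + c1"
  define W where "W = G * f2 * (E0 * pderiv E - pderiv E0 * E) +
     of_int c1 * (pderiv G * f2 * E0 * E) + of_int c2 * (G * pderiv f2 * E0 * E)"
  have "cong_mod (f1 * f2 * (e0 * pderiv e - pderiv e0 * e)
       + (of_int c1 * (pderiv f1 * f2) + of_int c2 * (f1 * pderiv f2)) * e0 * e)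
     (q * G * f2 * (q ^ b * E0 * P - P0 * (q ^ a * E))
       + (of_int c1 * (pderiv (q * G) * f2) + of_int c2 * (q * G * pderiv f2)) * (q ^ b * E0) * (q ^ a * E))"
    unfolding P_def P0_def
    by (intro cong_mod_add cong_mod_mult cong_mod_diff cong_mod_refl cong_mod_pderiv G E E0)
  also have "q * G * f2 * (q ^ b * E0 * P - P0 * (q ^ a * E)) = G * f2 * (q ^ b * E0 * (q * P) - (q * P0) * (q ^ a * E))"
    by (simp add: algebra_simps)
  also have "G * f2 * (q ^ b * E0 * (q * P) - (q * P0) * (q ^ a * E))
       + (of_int c1 * (pderiv (q * G) * f2) + of_int c2 * (q * G * pderiv f2)) * (q ^ b * E0) * (q ^ a * E)
      = q ^ (a + b) * (of_int m * (pderiv q * G * f2 * E0 * E) + q * W)"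
    unfolding qP qP0 W_def m_def by (simp add: pderiv_mult power_add algebra_simps)
  finally have "zero_mod (q ^ (a + b) * (of_int m * (pderiv q * G * f2 * E0 * E) + q * W))"
    using zero cong_mod_zero by blast
  moreover have "\<not> zero_mod q" using pr zero_mod_lead_coeff by (simp add: prime_mod_def)
  ultimately have "zero_mod (of_int m * (pderiv q * G * f2 * E0 * E) - q * (- W))"
    by (simp add: zero_mod_mult_iff zero_mod_power_iff)
  then have "dvd_mod q (of_int m * (pderiv q * G * f2 * E0 * E))" unfolding dvd_mod_def by blast
  then have "dvd_mod q (of_int m)"
    using pr nq' nG nf2 E(2) E0(2) unfolding prime_mod_def by blast
  then have "p dvd m" using not_dvd_const[of q m] pr by (auto simp: of_int_poly prime_mod_def)
  then show ?thesis using E(3) E0(3) unfolding m_def by blast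
qed

text \<open>
  The exponent \<open>g\<close> represents \<open>- 1 / k\<close> modulo \<open>p\<close>. So the congruence says \<open>k * (a - b) = \<delta>\<close> modulo \<open>p\<close>, hence in
  the integers as both sides are small, and no nonzero multiple of \<open>k\<close> is smaller than \<open>k\<close>.
\<close>

lemma small_residue_zero:
  fixes \<delta> :: int and a b B k g :: nat
  assumes kg: "int k * int g = p - 1" and dvd: "p dvd int a - int b + int g * \<delta>"
    and ab: "a \<le> B" "b \<le> B" and d: "\<bar>\<delta>\<bar> < int k" and large: "int k * (int B + 1) < p"
  shows "\<delta> = 0"
proof -
  have "int k * (int a - int b + int g * \<delta>) = (int k * (int a - int b) - \<delta>) + p * \<delta>"
  proof -
    have "int k * (int a - int b + int g * \<delta>) = int k * (int a - int b) + (int k * int g) * \<delta>"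
      by (simp add: algebra_simps)
    then show ?thesis unfolding kg by (simp add: algebra_simps)
  qed
  moreover have "p dvd int k * (int a - int b + int g * \<delta>)" using dvd by (rule dvd_mult)
  ultimately have "p dvd int k * (int a - int b) - \<delta>"
    by (simp add: dvd_add_left_iff)
  moreover have "\<bar>int k * (int a - int b) - \<delta>\<bar> < p"
  proof -
    have "\<bar>int k * (int a - int b)\<bar> \<le> int k * int B"
      using ab by (simp add: abs_mult mult_left_mono)
    then show ?thesis using d large by (simp add: algebra_simps)
  qed
  ultimately have "int k * (int a - int b) = \<delta>"
    using zdvd_imp_le[of p "\<bar>int k * (int a - int b) - \<delta>\<bar>"] by fastforce
  then have "int k dvd \<delta>" by (metis dvd_triv_left)
  then show ?thesis using d zdvd_imp_le[of "int k" "\<bar>\<delta>\<bar>"] by fastforce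
qed

text \<open>
  Induction on the number of terms. If \<open>S\<close> is divisible by \<open>x ^ m\<close>, then \<open>S\<close> and its derivative are divisible by
  \<open>x ^ (m - 1)\<close>; the combination that cancels the \<open>j\<close>-th term has the same shape with the cofactors \<open>es i\<close>, whose degrees are at most
  \<open>2 * B + 2 * d\<close>. This doubling is the reason for the factor \<open>2 ^ card J\<close>. By induction all \<open>es i\<close> vanish, and \<open>es i = 0\<close> is
  the hypothesis of \<open>ratio_valuation\<close> for \<open>e i\<close> and \<open>e j\<close>. If all the other terms are zero, the remaining one is divisible by \<open>x ^ m\<close>, and
  its degree is too small for that.
\<close>

lemma independence_mod:
  fixes e :: "nat \<times> nat \<Rightarrow> int poly"
  assumes sep1: "separating q1 f1 f2" and sep2: "separating q2 f2 f1"
    and deg: "degree f1 \<le> d" "degree f2 \<le> d"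
    and f0: "\<not> p dvd poly f1 0" "\<not> p dvd poly f2 0"
    and kg: "int k * int g = p - 1"
    and "finite J" "J \<subseteq> {..<k} \<times> {..<k}" "\<forall>j\<in>J. degree (e j) \<le> B"
    and "dvd_mod ([:0, 1:] ^ m) (\<Sum>j\<in>J. f1 ^ (fst j * g) * f2 ^ (snd j * g) * e j)"
    and "2 ^ card J * (B + 2 * d) + card J < m"
    and "int k * (2 ^ card J * (int B + 2 * int d) + 1) < p"
    and "j \<in> J"
  shows "zero_mod (e j)"
proof -
  define n where "n = card J"
  show ?thesis
    using assms(8-13) n_def assms(14)
proof (induction n arbitrary: J e B m j)
  case 0
  then show ?case by auto
next
  case (Suc n)
  have cJ: "card J = Suc n" using Suc.prems(7) by simp
  show ?case
  proof (rule ccontr)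
    assume nz: "\<not> zero_mod (e j)"
    define y where "y i = f1 ^ (fst i * g) * f2 ^ (snd i * g)" for i :: "nat \<times> nat"
    define w where "w i = of_nat (fst i * g) * (pderiv f1 * f2) + of_nat (snd i * g) * (f1 * pderiv f2)" for i :: "nat \<times> nat"
    define c1 where "c1 i = int g * (int (fst i) - int (fst j))" for i :: "nat \<times> nat"
    define c2 where "c2 i = int g * (int (snd i) - int (snd j))" for i :: "nat \<times> nat"
    \<comment> \<open>The cofactors of the combination of \<open>S\<close> and its derivative that has no \<open>j\<close>-th term.\<close>
    define es where "es i = f1 * f2 * (e j * pderiv (e i) - pderiv (e j) * e i) +
      (of_int (c1 i) * (pderiv f1 * f2) + of_int (c2 i) * (f1 * pderiv f2)) * e j * e i" for i
    define S where "S = (\<Sum>i\<in>J. y i * e i)"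
    define J' where "J' = J - {j}"
    have finJ': "finite J'" and cardJ': "card J' = n" and subJ': "J' \<subseteq> {..<k} \<times> {..<k}"
      using cJ Suc.prems(1,2,8) by (auto simp: J'_def)
    have m0: "m \<noteq> 0" using Suc.prems(5) by auto
    have xS: "dvd_mod ([:0, 1:] ^ m) S" using Suc.prems by (simp add: S_def y_def)
    then obtain C where C: "cong_mod S ([:0, 1:] ^ m * C)" using dvd_mod_alt by blast
    define x :: "int poly" where "x = [:0, 1:]"
    have split: "x ^ m = x ^ (m - 1) * x"
      using m0 power_Suc2[of x "m - 1"] by simp
    have xS1: "dvd_mod (x ^ (m - 1)) S"
      using C split dvd_mod_cong[OF dvd_mod_triv(1) cong_mod_sym, of S "x ^ (m - 1)" "x * C"]
      by (simp add: x_def mult.assoc)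
    have dx: "pderiv x = 1" by (simp add: x_def pderiv_pCons)
    have "cong_mod (pderiv S) (pderiv (x ^ m * C))" unfolding x_def by (rule cong_mod_pderiv[OF C])
    also have "pderiv (x ^ m * C) = x ^ m * pderiv C + of_nat m * x ^ (m - 1) * C"
      by (simp add: pderiv_mult pderiv_power dx smult_of_nat)
    also have "\<dots> = x ^ (m - 1) * (x * pderiv C + of_nat m * C)"
      by (simp add: split algebra_simps)
    finally have xS': "dvd_mod (x ^ (m - 1)) (pderiv S)" unfolding dvd_mod_alt by blast
    have "e j * (f1 * f2 * pderiv S) - (f1 * f2 * pderiv (e j) + w j * e j) * S = (\<Sum>i\<in>J. y i * es i)"
    proof -
      have summand: "e j * (f1 * f2 * pderiv (y i * e i)) - (f1 * f2 * pderiv (e j) + w j * e j) * (y i * e i) = y i * es i" for i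
      proof -
        have "f1 * f2 * pderiv (y i * e i) = (f1 * f2 * pderiv (y i)) * e i + f1 * f2 * y i * pderiv (e i)"
          by (simp add: pderiv_mult algebra_simps)
        also have "f1 * f2 * pderiv (y i) = y i * w i"
          by (simp only: y_def w_def pderiv_monomial_mult)
        finally have *: "f1 * f2 * pderiv (y i * e i) = y i * w i * e i + f1 * f2 * y i * pderiv (e i)" .
        show ?thesis unfolding * es_def c1_def c2_def w_def by (simp add: algebra_simps)
      qed
      have "pderiv S = (\<Sum>i\<in>J. pderiv (y i * e i))"
        unfolding S_def using higher_pderiv_sum[of 1] by simp
      then show ?thesis unfolding S_def
        by (simp only: sum_distrib_left sum_subtractf[symmetric] summand)
    qed
    also have "\<dots> = (\<Sum>i\<in>J'. y i * es i)"
    proof -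
      have "es j = 0" by (simp add: es_def c1_def c2_def)
      then show ?thesis unfolding J'_def using Suc.prems by (simp add: sum.remove)
    qed
    finally have sum': "e j * (f1 * f2 * pderiv S) - (f1 * f2 * pderiv (e j) + w j * e j) * S = (\<Sum>i\<in>J'. y i * es i)" .
    \<comment> \<open>Both \<open>S\<close> and its derivative are divisible by \<open>x ^ (m - 1)\<close>, hence so is the combination.\<close>
    have x': "dvd_mod (x ^ (m - 1)) (\<Sum>i\<in>J'. y i * es i)"
      unfolding sum'[symmetric] by (intro dvd_mod_diff dvd_mod_multI(2) xS1 xS')
    have es0: "zero_mod (es i)" if i: "i \<in> J'" for i
    proof (rule Suc.IH[of J' es "2 * B + 2 * d" "m - 1"])
      show "\<forall>i'\<in>J'. degree (es i') \<le> 2 * B + 2 * d"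
      proof
        fix i' assume "i' \<in> J'"
        then have ei: "degree (e i') \<le> B" and ej: "degree (e j) \<le> B"
          using Suc.prems(3,8) by (auto simp: J'_def)
        have c: "degree (of_int c :: int poly) \<le> 0" for c by (simp add: of_int_poly)
        have "degree (f1 * f2 * (e j * pderiv (e i') - pderiv (e j) * e i')) \<le> (d + d) + (B + B)"
          by (intro degree_mult_bound degree_diff_le degree_pderiv_bound deg ei ej)
        moreover have "degree ((of_int (c1 i') * (pderiv f1 * f2) + of_int (c2 i') * (f1 * pderiv f2)) * e j * e i')
             \<le> ((0 + (d + d)) + B) + B"
          by (intro degree_mult_bound degree_add_le degree_pderiv_bound deg ei ej c)
        ultimately show "degree (es i') \<le> 2 * B + 2 * d"
          unfolding es_def by (intro degree_add_le) linarith+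
      qed
      show "dvd_mod ([:0, 1:] ^ (m - 1)) (\<Sum>j\<in>J'. f1 ^ (fst j * g) * f2 ^ (snd j * g) * es j)"
        using x' by (simp add: y_def x_def)
      show "2 ^ card J' * (2 * B + 2 * d + 2 * d) + card J' < m - 1"
        using Suc.prems(5) unfolding cardJ' cJ by (simp add: algebra_simps)
      show "int k * (2 ^ card J' * (int (2 * B + 2 * d) + 2 * int d) + 1) < p"
        using Suc.prems(6) cJ unfolding cardJ' by (simp add: algebra_simps)
    qed (use i finJ' cardJ' subJ' in auto)
    have large: "int k * (int B + 1) < p"
    proof -
      have "int B + 1 \<le> 2 ^ card J * (int B + 2 * int d) + 1"
        using mult_mono[of 1 "2 ^ card J :: int" "int B" "int B + 2 * int d"] by simp
      then have "int k * (int B + 1) \<le> int k * (2 ^ card J * (int B + 2 * int d) + 1)"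
        by (rule mult_left_mono) simp
      then show ?thesis using Suc.prems(6) by linarith
    qed
    have e0: "zero_mod (e i)" if i: "i \<in> J'" for i
    proof (rule ccontr)
      assume nzi: "\<not> zero_mod (e i)"
      have ij: "i \<noteq> j" "i \<in> J" using i by (auto simp: J'_def)
      have dB: "degree (e i) \<le> B" "degree (e j) \<le> B" using ij Suc.prems by auto
      have lt: "fst i < k" "snd i < k" "fst j < k" "snd j < k" using ij Suc.prems by auto
      obtain a b where "a \<le> degree (e i)" "b \<le> degree (e j)" "p dvd int a - int b + c1 i"
        using ratio_valuation[OF sep1 nzi nz es0[OF i, unfolded es_def]] by blast
      then have "int (fst i) - int (fst j) = 0"
        using dB lt by (intro small_residue_zero[OF kg _ _ _ _ large, of a b]) (auto simp: c1_def)
      moreover have "zero_mod (f2 * f1 * (e j * pderiv (e i) - pderiv (e j) * e i) +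
          (of_int (c2 i) * (pderiv f2 * f1) + of_int (c1 i) * (f2 * pderiv f1)) * e j * e i)"
        using es0[OF i] unfolding es_def by (simp add: algebra_simps)
      then obtain a b where "a \<le> degree (e i)" "b \<le> degree (e j)" "p dvd int a - int b + c2 i"
        using ratio_valuation[OF sep2 nzi nz] by blast
      then have "int (snd i) - int (snd j) = 0"
        using dB lt by (intro small_residue_zero[OF kg _ _ _ _ large, of a b]) (auto simp: c2_def)
      ultimately show False using ij by (simp add: prod_eq_iff)
    qed
    have "S = y j * e j + (\<Sum>i\<in>J'. y i * e i)"
      unfolding S_def J'_def using Suc.prems by (simp add: sum.remove)
    moreover have "zero_mod (\<Sum>i\<in>J'. y i * e i)"
      using e0 by (intro zero_mod_sum zero_mod_multI(2))
    ultimately have "cong_mod S (y j * e j)" by (simp add: cong_mod_def)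
    then have "dvd_mod ([:0, 1:] ^ m) (y j * e j)" by (rule dvd_mod_cong[OF xS])
    moreover have "\<not> dvd_mod [:0, 1:] (y j)"
      using dvd_mod_linear_iff[of 0 "y j"] f0 prime_p
      by (auto simp: y_def prime_dvd_mult_iff dest: prime_dvd_power)
    ultimately have "dvd_mod ([:0, 1:] ^ m) (e j)"
      using dvd_mod_power_cancel[of "[:0, 1:]"] prime_mod_linear[of 0] by simp
    then have "degree ([:0, 1 :: int:] ^ m) \<le> degree (e j)"
      using degree_cofactor[OF nz, of "[:0, 1:] ^ m"] prime_p
      by (auto simp: lead_coeff_power prime_int_iff)
    then have "m \<le> B" using Suc.prems(3,8) by (force simp: degree_power_eq)
    moreover have "B \<le> 2 ^ card J * (B + 2 * d)"
      using mult_mono[of 1 "2 ^ card J :: nat" B "B + 2 * d"] by simp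
    ultimately show False using Suc.prems(5) by linarith
  qed
qed
qed

section \<open>The method of Stepanov\<close>

text \<open>
  By the pigeonhole principle two vectors with entries in \<open>{0..<p}\<close> give the same values; their difference is a solution.
\<close>

lemma homogeneous_system_mod:
  fixes M :: "'q \<Rightarrow> 'i \<Rightarrow> int"
  assumes fin: "finite I" "finite Q" and less: "card Q < card I"
  shows "\<exists>c. (\<exists>i\<in>I. \<not> p dvd c i) \<and> (\<forall>q\<in>Q. p dvd (\<Sum>i\<in>I. M q i * c i))"
proof -
  define F where "F c = (\<lambda>q\<in>Q. (\<Sum>i\<in>I. M q i * c i) mod p)" for c :: "'i \<Rightarrow> int"
  let ?X = "PiE I (\<lambda>_. {0..<p})" and ?Y = "PiE Q (\<lambda>_. {0..<p})"
  have "F ` ?X \<subseteq> ?Y" using p_pos by (auto simp: F_def)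
  moreover have finY: "finite ?Y" using fin by (auto intro: finite_PiE)
  moreover have "card ?Y < card ?X"
  proof -
    have "1 < nat p" using prime_gt_1_int[OF prime_p] by simp
    then show ?thesis using less fin by (simp add: card_PiE power_strict_increasing)
  qed
  ultimately have "\<not> inj_on F ?X"
    using card_mono[of ?Y "F ` ?X"] card_image[of F ?X] by fastforce
  then obtain c c' where c: "c \<in> ?X" "c' \<in> ?X" "c \<noteq> c'" "F c = F c'"
    by (auto simp: inj_on_def)
  then obtain i where i: "i \<in> I" "c i \<noteq> c' i" by (metis PiE_ext)
  have "\<not> p dvd c i - c' i"
  proof
    assume "p dvd c i - c' i"
    then have "c i mod p = c' i mod p" by (simp add: mod_eq_dvd_iff)
    moreover have "c i \<in> {0..<p}" "c' i \<in> {0..<p}" using c i by (auto dest: PiE_mem)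
    ultimately show False using i by simp
  qed
  moreover have "p dvd (\<Sum>i\<in>I. M q i * (c i - c' i))" if q: "q \<in> Q" for q
  proof -
    have "(\<Sum>i\<in>I. M q i * c i) mod p = (\<Sum>i\<in>I. M q i * c' i) mod p"
      using fun_cong[OF c(4), of q] q by (simp add: F_def)
    then show ?thesis by (simp add: mod_eq_dvd_iff right_diff_distrib sum_subtractf)
  qed
  ultimately show ?thesis using i by (intro exI[of _ "\<lambda>i. c i - c' i"]) auto
qed

text \<open>
  The factor \<open>X\<close> will be a power of \<open>x ^ p\<close>, a constant for differentiation modulo \<open>p\<close>.
\<close>

lemma higher_pderiv_monomial:
  assumes X: "zero_mod (pderiv X)"
  shows "i \<le> n1 \<Longrightarrow> i \<le> n2 \<Longrightarrow>
    cong_mod ((pderiv ^^ i) (f1 ^ n1 * f2 ^ n2 * monom 1 a * X))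
      (f1 ^ (n1 - i) * f2 ^ (n2 - i) * deriv_cofactor f1 f2 n1 n2 a i * X)"
proof (induction i)
  case 0
  then show ?case by simp
next
  case (Suc i)
  let ?q = "deriv_cofactor f1 f2 n1 n2 a i"
  obtain m1 where m1: "n1 - i = Suc m1" "n1 - Suc i = m1" using Suc.prems by (metis Suc_diff_Suc Suc_le_lessD)
  obtain m2 where m2: "n2 - i = Suc m2" "n2 - Suc i = m2" using Suc.prems by (metis Suc_diff_Suc Suc_le_lessD)
  have pw: "pderiv (f ^ Suc m) = of_nat (Suc m) * f ^ m * pderiv f" for f :: "int poly" and m
    by (simp add: pderiv_power_Suc smult_of_nat del: power_Suc of_nat_Suc)
  have "cong_mod ((pderiv ^^ Suc i) (f1 ^ n1 * f2 ^ n2 * monom 1 a * X))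
      (pderiv (f1 ^ (n1 - i) * f2 ^ (n2 - i) * ?q * X))"
    using Suc by (auto intro: cong_mod_pderiv)
  also have "pderiv (f1 ^ (n1 - i) * f2 ^ (n2 - i) * ?q * X) =
      f1 ^ m1 * f2 ^ m2 * deriv_cofactor f1 f2 n1 n2 a (Suc i) * X +
      f1 ^ (n1 - i) * f2 ^ (n2 - i) * ?q * pderiv X"
    unfolding m1(1) m2(1) deriv_cofactor.simps pderiv_mult pw by (simp add: algebra_simps del: of_nat_Suc)
  also have "cong_mod \<dots> (f1 ^ m1 * f2 ^ m2 * deriv_cofactor f1 f2 n1 n2 a (Suc i) * X)"
    using X by (simp add: cong_mod_def zero_mod_multI)
  finally show ?case using m1 m2 by simp
qed

lemma fermat_mod:
  assumes "0 \<le> u" shows "[u ^ nat p = u] (mod p)"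
proof -
  have pr: "prime (nat p)" using prime_p prime_int_nat_transfer by blast
  have "[nat u ^ nat p = nat u] (mod nat p)"
  proof (cases "nat p dvd nat u")
    case True
    moreover have "nat p dvd nat u ^ nat p" using True p_pos by (simp add: dvd_power_le dvd_trans)
    ultimately show ?thesis by (simp add: cong_def dvd_eq_mod_eq_0)
  next
    case False
    then have "[nat u ^ (nat p - 1) * nat u = 1 * nat u] (mod nat p)"
      using fermat_theorem[OF pr] by (intro cong_scalar_right) auto
    moreover have "nat u ^ (nat p - 1) * nat u = nat u ^ nat p"
      using p_pos by (metis power_minus_mult zero_less_nat_eq)
    ultimately show ?thesis by simp
  qed
  then have "[int (nat u ^ nat p) = int (nat u)] (mod int (nat p))" by (simp only: cong_int_iff)
  then show ?thesis using assms p_pos by simp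
qed

lemma cong_poly_if_zero_mod: "zero_mod (a - b) \<Longrightarrow> [poly a u = poly b u] (mod p)"
  using zero_mod_poly[of "a - b" u] by (simp add: cong_iff_dvd_diff)

text \<open>
  The unknowns are indexed by \<open>(j, (a, b)) \<in> I\<close>, the equations by \<open>(i, n) \<in> Q\<close>: the \<open>n\<close>-th coefficient of the polynomial \<open>W\<close> that
  represents the \<open>i\<close>-th derivative of \<open>R\<close> at the points of \<open>Z\<close>. The value of \<open>B\<close> is large enough for the unknowns to
  outnumber the equations when \<open>L = k\<^sup>2 * D - 1\<close>. If \<open>L * card Z\<close> exceeded the degree bound, \<open>R\<close> would be zero; comparing the lowest
  power of \<open>x ^ p\<close> with a nonzero coefficient leaves a relation modulo \<open>x ^ p\<close> that \<open>independence_mod\<close> excludes.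
\<close>

lemma stepanov_bound:
  fixes k g d D L B :: nat
  assumes sep1: "separating q1 f1 f2" and sep2: "separating q2 f2 f1"
    and deg: "degree f1 \<le> d" "degree f2 \<le> d"
    and f0: "\<not> p dvd poly f1 0" "\<not> p dvd poly f2 0"
    and kg: "int k * int g = p - 1" and k: "1 \<le> k" and D: "1 \<le> D"
    and L: "L = k\<^sup>2 * D - 1" and B: "B = k\<^sup>2 * D * (D + 2 * d * L) + 1"
    and large1: "2 ^ k\<^sup>2 * (B + 2 * d) + k\<^sup>2 < nat p"
    and large2: "k * (2 ^ k\<^sup>2 * (B + 2 * d) + 1) < nat p"
    and Z: "Z \<subseteq> {0..<p}"
    and z1: "\<And>u. u \<in> Z \<Longrightarrow> [poly f1 u ^ g = z1] (mod p)"
    and z2: "\<And>u. u \<in> Z \<Longrightarrow> [poly f2 u ^ g = z2] (mod p)"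
  shows "L * card Z \<le> 2 * d * L + 2 * d * ((k - 1) * g) + B + nat p * D"
proof (rule ccontr)
  assume many: "\<not> ?thesis"
  define N where "N = B + D + 2 * d * L"
  define I where "I = ({..<k} \<times> {..<k}) \<times> ({..<B} \<times> {..<D})"
  define Q where "Q = {..<L} \<times> {..<N}"
  define q where "q i j a = deriv_cofactor f1 f2 (L + fst j * g) (L + snd j * g) a i"
    for i a :: nat and j :: "nat \<times> nat"
  define M where "M = (\<lambda>(i, n) (j, (a, b)). z1 ^ fst j * z2 ^ snd j * coeff (q i j a * monom 1 b) n)"
  have "L * N < k\<^sup>2 * B * D"
  proof -
    define K where "K = k\<^sup>2 * D"
    have K: "1 \<le> K" using k D by (simp add: K_def)
    have "(K - 1) * N = (K - 1) * B + (K - 1) * (D + 2 * d * L)"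
      by (simp add: N_def algebra_simps)
    also have "\<dots> < (K - 1) * B + B"
    proof -
      have "(K - 1) * (D + 2 * d * L) \<le> K * (D + 2 * d * L)" by simp
      also have "\<dots> < B" unfolding B K_def by simp
      finally show ?thesis by simp
    qed
    also have "\<dots> = K * B" using K by (simp add: algebra_simps)
    finally show ?thesis by (simp add: L K_def mult_ac)
  qed
  then have "card Q < card I" by (simp add: Q_def I_def power2_eq_square mult_ac)
  moreover have "finite I" "finite Q" by (simp_all add: I_def Q_def)
  ultimately obtain c where c: "\<exists>i\<in>I. \<not> p dvd c i" and sol: "\<forall>e\<in>Q. p dvd (\<Sum>i\<in>I. M e i * c i)"
    using homogeneous_system_mod[of I Q M] by blast
  define X where "X b = monom (1::int) (nat p * b)" for b
  define T where "T = (\<lambda>(j, (a, b)). f1 ^ (L + fst j * g) * f2 ^ (L + snd j * g) * monom 1 a * X b)"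
  define R where "R = (\<Sum>i\<in>I. smult (c i) (T i))"
  have dX: "zero_mod (pderiv (X b))" for b
    using p_pos by (auto simp: X_def pderiv_monom zero_mod_iff_coeff coeff_monom)
  have "degree R \<le> 2 * d * L + 2 * d * ((k - 1) * g) + B + nat p * D"
    unfolding R_def
  proof (intro degree_sum_le order.trans[OF degree_smult_le])
    show "finite I" by (simp add: I_def)
    fix i assume "i \<in> I"
    then obtain j a b where i: "i = (j, (a, b))" "fst j < k" "snd j < k" "a < B" "b < D"
      by (auto simp: I_def)
    have pow: "degree (f ^ n) \<le> d * n" if "degree f \<le> d" for f :: "int poly" and n
      using degree_power_le[of f n] that by (meson mult_le_mono1 order.trans)
    have "degree (T i) \<le> d * (L + fst j * g) + d * (L + snd j * g) + a + nat p * b"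
      unfolding T_def i X_def prod.case
      by (intro degree_mult_bound pow deg) (simp_all add: degree_monom_eq)
    also have "\<dots> \<le> d * (L + (k - 1) * g) + d * (L + (k - 1) * g) + B + nat p * D"
      using i by (intro add_mono mult_le_mono order.refl) auto
    finally show "degree (T i) \<le> 2 * d * L + 2 * d * ((k - 1) * g) + B + nat p * D"
      by (simp add: algebra_simps)
  qed
  then have degR: "degree R < L * card Z" using many by linarith
  have Lp: "int L \<le> p"
  proof -
    have "L \<le> k\<^sup>2 * D * 1" using L by simp
    also have "\<dots> \<le> k\<^sup>2 * D * (D + 2 * d * L)" using D by (intro mult_le_mono) auto
    also have "\<dots> \<le> 1 * (B + 2 * d)" using B by simp
    also have "\<dots> \<le> 2 ^ k\<^sup>2 * (B + 2 * d)" by (intro mult_le_mono) auto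
    finally show ?thesis using large1 by linarith
  qed
  have der: "p dvd poly ((pderiv ^^ i) R) u" if i: "i < L" and u: "u \<in> Z" for i u
  proof -
    \<comment> \<open>At the points of \<open>Z\<close>, \<open>W\<close> is the \<open>i\<close>-th derivative of \<open>R\<close> up to the factor \<open>(f1 * f2) ^ (L - i)\<close>.\<close>
    define W where "W = (\<Sum>(j, (a, b))\<in>I. smult (c (j, (a, b)) * (z1 ^ fst j * z2 ^ snd j)) (q i j a * monom 1 b))"
    have "zero_mod W"
      unfolding zero_mod_iff_coeff
    proof
      fix n
      show "p dvd coeff W n"
      proof (cases "n < N")
        case True
        have "coeff W n = (\<Sum>e\<in>I. M (i, n) e * c e)"
          unfolding W_def coeff_sum by (intro sum.cong) (auto simp: M_def)
        then show ?thesis using sol i True by (auto simp: Q_def)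
      next
        case False
        have "coeff (q i j a * monom 1 b) n = 0" if "a < B" "b < D" for j a b
        proof (rule coeff_eq_0)
          have "degree (q i j a * monom 1 b) \<le> (a + 2 * d * i) + b"
            unfolding q_def
            by (intro degree_mult_bound degree_deriv_cofactor deg) (simp add: degree_monom_eq)
          also have "\<dots> < N"
          proof -
            have "2 * d * i \<le> 2 * d * L" using i by (intro mult_le_mono) auto
            then show ?thesis using that unfolding N_def by linarith
          qed
          finally show "degree (q i j a * monom 1 b) < n" using False by simp
        qed
        then show ?thesis unfolding W_def coeff_sum
          by (intro dvd_sum) (auto simp: I_def)
      qed
    qed
    then have pW: "p dvd poly W u" by (rule zero_mod_poly)
    have u0: "0 \<le> u" using u Z by auto
    have summand: "[poly ((pderiv ^^ i) (T (j, (a, b)))) u =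
        poly f1 u ^ (L - i) * poly f2 u ^ (L - i) * (z1 ^ fst j * z2 ^ snd j * poly (q i j a * monom 1 b) u)] (mod p)"
      for j a b
    proof -
      have ex: "L - i + g * fst j = L + fst j * g - i" "L - i + g * snd j = L + snd j * g - i"
        using i by (auto simp: mult.commute)
      have "cong_mod ((pderiv ^^ i) (T (j, (a, b))))
          (f1 ^ (L - i + g * fst j) * f2 ^ (L - i + g * snd j) * q i j a * X b)"
        unfolding ex T_def q_def prod.case using i by (intro higher_pderiv_monomial dX) auto
      then have "[poly ((pderiv ^^ i) (T (j, (a, b)))) u =
          poly f1 u ^ (L - i + g * fst j) * poly f2 u ^ (L - i + g * snd j) * poly (q i j a) u * (u ^ nat p) ^ b] (mod p)"
        using cong_poly_if_zero_mod unfolding cong_mod_def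
        by (fastforce simp: X_def poly_monom power_mult)
      also have "poly f1 u ^ (L - i + g * fst j) * poly f2 u ^ (L - i + g * snd j) * poly (q i j a) u * (u ^ nat p) ^ b
         = poly f1 u ^ (L - i) * poly f2 u ^ (L - i) * ((poly f1 u ^ g) ^ fst j * (poly f2 u ^ g) ^ snd j * (poly (q i j a) u * (u ^ nat p) ^ b))"
        by (simp add: power_add power_mult mult_ac)
      also have "[\<dots> = poly f1 u ^ (L - i) * poly f2 u ^ (L - i) * (z1 ^ fst j * z2 ^ snd j * (poly (q i j a) u * u ^ b))] (mod p)"
        by (intro cong_mult cong_pow cong_refl z1 z2 u fermat_mod u0)
      finally show ?thesis by (simp add: poly_monom)
    qed
    have "poly ((pderiv ^^ i) R) u = (\<Sum>e\<in>I. c e * poly ((pderiv ^^ i) (T e)) u)"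
      by (simp add: R_def higher_pderiv_sum higher_pderiv_smult poly_sum)
    also have "[\<dots> = (\<Sum>(j, (a, b))\<in>I. c (j, (a, b)) * (poly f1 u ^ (L - i) * poly f2 u ^ (L - i) * (z1 ^ fst j * z2 ^ snd j * poly (q i j a * monom 1 b) u)))] (mod p)"
      by (intro cong_sum) (auto intro!: cong_mult cong_refl summand simp del: poly_mult)
    also have "(\<Sum>(j, (a, b))\<in>I. c (j, (a, b)) * (poly f1 u ^ (L - i) * poly f2 u ^ (L - i) * (z1 ^ fst j * z2 ^ snd j * poly (q i j a * monom 1 b) u)))
        = poly f1 u ^ (L - i) * poly f2 u ^ (L - i) * poly W u"
      unfolding W_def poly_sum sum_distrib_left
      by (intro sum.cong) (auto simp: mult_ac)
    finally show ?thesis using pW by (simp add: cong_dvd_iff)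
  qed
  have "zero_mod R" by (rule zero_mod_if_many_roots[OF Z Lp der degR])
  define E where "E b j = (\<Sum>a<B. monom (c (j, (a, b))) a)" for b j
  define F where "F b = (\<Sum>j\<in>{..<k} \<times> {..<k}. f1 ^ (fst j * g) * f2 ^ (snd j * g) * E b j)" for b
  have "R = f1 ^ L * f2 ^ L * (\<Sum>b<D. X b * F b)"
  proof -
    have "R = (\<Sum>j\<in>{..<k} \<times> {..<k}. \<Sum>a<B. \<Sum>b<D. smult (c (j, (a, b))) (T (j, (a, b))))"
      unfolding R_def I_def by (simp add: sum.cartesian_product case_prod_beta)
    also have "\<dots> = (\<Sum>j\<in>{..<k} \<times> {..<k}. \<Sum>b<D. \<Sum>a<B. smult (c (j, (a, b))) (T (j, (a, b))))"
      by (intro sum.cong refl sum.swap)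
    also have "\<dots> = (\<Sum>b<D. \<Sum>j\<in>{..<k} \<times> {..<k}. \<Sum>a<B. smult (c (j, (a, b))) (T (j, (a, b))))"
      by (rule sum.swap)
    also have "\<dots> = (\<Sum>b<D. \<Sum>j\<in>{..<k} \<times> {..<k}. \<Sum>a<B.
        f1 ^ L * f2 ^ L * (X b * (f1 ^ (fst j * g) * f2 ^ (snd j * g) * monom (c (j, (a, b))) a)))"
    proof (intro sum.cong refl)
      fix a b j
      have "monom (c (j, (a, b))) a = smult (c (j, (a, b))) (monom 1 a)" by (simp add: smult_monom)
      then show "smult (c (j, (a, b))) (T (j, (a, b))) =
          f1 ^ L * f2 ^ L * (X b * (f1 ^ (fst j * g) * f2 ^ (snd j * g) * monom (c (j, (a, b))) a))"
        by (simp only: T_def prod.case power_add mult_smult_right mult_smult_left mult_ac)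
    qed
    also have "\<dots> = f1 ^ L * f2 ^ L * (\<Sum>b<D. X b * F b)"
      by (simp only: F_def E_def sum_distrib_left)
    finally show ?thesis .
  qed
  moreover have "\<not> zero_mod f1" "\<not> zero_mod f2" using f0 zero_mod_poly by blast+
  ultimately have zsum: "zero_mod (\<Sum>b<D. X b * F b)"
    using \<open>zero_mod R\<close> by (simp add: zero_mod_mult_iff zero_mod_power_iff)
  have nX: "\<not> zero_mod (X b)" for b
    using not_p_dvd_one by (auto simp: X_def zero_mod_iff_coeff coeff_monom)
  have E0: "zero_mod (E b j)" if "b < D" "j \<in> {..<k} \<times> {..<k}" for b j
    using that
  proof (induction b arbitrary: j rule: less_induct)
    case (less b)
    define V where "V = (\<Sum>b'\<in>{Suc b..<D}. X (b' - Suc b) * F b')"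
    have XX: "X (m + n) = X m * X n" for m n
      by (simp add: X_def mult_monom algebra_simps)
    have "(\<Sum>b'<D. X b' * F b') = (\<Sum>b'<b. X b' * F b') + X b * F b + (\<Sum>b'\<in>{Suc b..<D}. X b' * F b')"
    proof -
      have "{..<D} = {..<b} \<union> {b} \<union> {Suc b..<D}" using less.prems(1) by auto
      moreover have "{..<b} \<inter> {Suc b..<D} = {}" by auto
      ultimately show ?thesis by (simp add: sum.union_disjoint)
    qed
    also have "(\<Sum>b'\<in>{Suc b..<D}. X b' * F b') = X b * (X 1 * V)"
      unfolding V_def sum_distrib_left
    proof (intro sum.cong refl)
      fix b' assume "b' \<in> {Suc b..<D}"
      then have "b' = b + (1 + (b' - Suc b))" by simp
      then have "X b' = X b * (X 1 * X (b' - Suc b))" by (metis XX)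
      then show "X b' * F b' = X b * (X 1 * (X (b' - Suc b) * F b'))" by (simp add: mult_ac)
    qed
    finally have total: "(\<Sum>b'<D. X b' * F b') - (\<Sum>b'<b. X b' * F b') = X b * (F b + X 1 * V)"
      by (simp add: algebra_simps)
    have "zero_mod (\<Sum>b'<b. X b' * F b')"
    proof (intro zero_mod_sum zero_mod_multI(2))
      fix b' assume b': "b' \<in> {..<b}"
      show "zero_mod (F b')"
        unfolding F_def
      proof (intro zero_mod_sum zero_mod_multI(2))
        fix j' assume "j' \<in> {..<k} \<times> {..<k}"
        then show "zero_mod (E b' j')" using less b' by simp
      qed
    qed
    then have "zero_mod (X b * (F b + X 1 * V))"
      unfolding total[symmetric] by (rule zero_mod_diff[OF zsum])
    then have "zero_mod (F b - X 1 * (- V))" using nX by (simp add: zero_mod_mult_iff)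
    then have "dvd_mod (X 1) (F b)" unfolding dvd_mod_def by blast
    moreover have "X 1 = [:0, 1:] ^ nat p" by (simp add: X_def monom_altdef)
    ultimately have dvdF: "dvd_mod ([:0, 1:] ^ nat p) (\<Sum>j\<in>{..<k} \<times> {..<k}. f1 ^ (fst j * g) * f2 ^ (snd j * g) * E b j)"
      by (simp add: F_def)
    have cardJ: "card ({..<k} \<times> {..<k}) = k\<^sup>2" by (simp add: power2_eq_square)
    show ?case
    proof (rule independence_mod[OF sep1 sep2 deg f0 kg _ _ _ dvdF, where B = B])
      show "\<forall>j\<in>{..<k} \<times> {..<k}. degree (E b j) \<le> B"
        unfolding E_def
        by (intro ballI degree_sum_le) (auto intro: order.trans[OF degree_monom_le])
      show "2 ^ card ({..<k} \<times> {..<k}) * (B + 2 * d) + card ({..<k} \<times> {..<k}) < nat p"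
        using large1 cardJ by simp
      have "int (k * (2 ^ k\<^sup>2 * (B + 2 * d) + 1)) < int (nat p)" using large2 by (simp only: of_nat_less_iff)
      then show "int k * (2 ^ card ({..<k} \<times> {..<k}) * (int B + 2 * int d) + 1) < p"
        unfolding cardJ using p_pos by (simp add: algebra_simps)
    qed (use less.prems in auto)
  qed
  from c obtain j a b where "\<not> p dvd c (j, (a, b))" "j \<in> {..<k} \<times> {..<k}" "a < B" "b < D"
    by (auto simp: I_def)
  moreover have "coeff (E b j) a = c (j, (a, b))" if "a < B" for j a b
    using that by (simp add: E_def coeff_sum coeff_monom)
  ultimately show False using E0[of b j] unfolding zero_mod_iff_coeff by metis
qed

section \<open>Counting pairs of power residues\<close>

lemma poly_cong_mod:
  fixes f :: "int poly"
  assumes "[a = b] (mod p)" shows "[poly f a = poly f b] (mod p)"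
proof (induction f)
  case (pCons c f)
  then show ?case using assms by (auto intro!: cong_add cong_mult)
qed simp

lemma separating_translates:
  assumes lc: "\<not> p dvd lead_coeff f" and d: "\<not> p dvd int (degree f)"
    and bez: "u * f + v * pderiv f = [:R:]" "\<not> p dvd R" and t: "\<not> p dvd t"
  shows "\<exists>q. separating q (f \<circ>\<^sub>p [:c, 1:]) (f \<circ>\<^sub>p [:c + t, 1:])"
proof -
  define f1 where "f1 = f \<circ>\<^sub>p [:c, 1:]"
  have lc1: "lead_coeff f1 = lead_coeff f" "degree f1 = degree f"
    using lead_coeff_translate[of f "degree f" c] by (simp_all add: f1_def degree_pcompose)
  have "(u \<circ>\<^sub>p [:c, 1:]) * f1 + (v \<circ>\<^sub>p [:c, 1:]) * pderiv f1 = (u * f + v * pderiv f) \<circ>\<^sub>p [:c, 1:]"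
    by (simp add: f1_def pcompose_add pcompose_mult pderiv_pcompose pderiv_pCons)
  also have "\<dots> = [:R:]" using bez by simp
  finally have bez1: "(u \<circ>\<^sub>p [:c, 1:]) * f1 + (v \<circ>\<^sub>p [:c, 1:]) * pderiv f1 = [:R:]" .
  have "\<not> dvd_mod f1 (f1 \<circ>\<^sub>p [:t, 1:])"
    using not_dvd_translate[of f1 t] lc d t lc1 by simp
  then have "\<not> dvd_mod f1 (f \<circ>\<^sub>p [:c + t, 1:])" by (simp add: f1_def translate_add)
  moreover have "\<not> zero_mod f1" using zero_mod_lead_coeff[of f1] lc lc1 by simp
  ultimately show ?thesis
    using exists_prime_factor_not_dividing[OF _ bez1 bez(2)] unfolding separating_def f1_def by blast
qed

lemma exists_common_nonroot:
  assumes lc: "\<not> p dvd lead_coeff f" and large: "2 * degree f < nat p"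
  shows "\<exists>c. \<not> p dvd poly f c \<and> \<not> p dvd poly f (c + t)"
proof (rule ccontr)
  assume contra: "\<not> ?thesis"
  define h where "h = f * (f \<circ>\<^sub>p [:t, 1:])"
  have "zero_mod h"
  proof (rule zero_mod_if_many_roots[of "{0..<p}" 1])
    show "p dvd poly ((pderiv ^^ i) h) u" if "i < 1" "u \<in> {0..<p}" for i u
    proof -
      have "p dvd poly f u * poly f (u + t)" using contra dvd_mult dvd_mult2 by blast
      then show ?thesis using that by (simp add: h_def poly_pcompose add.commute)
    qed
    have "degree h \<le> degree f + degree f"
      unfolding h_def by (intro degree_mult_bound) (simp_all add: degree_pcompose)
    then show "degree h < 1 * card {0..<p}" using large by simp
  qed (use p_pos in auto)
  moreover have "lead_coeff (f \<circ>\<^sub>p [:t, 1:]) = lead_coeff f"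
    using lead_coeff_translate[of f "degree f" t] by (simp add: degree_pcompose)
  ultimately show False
    using zero_mod_lead_coeff[of f] zero_mod_lead_coeff[of "f \<circ>\<^sub>p [:t, 1:]"] lc
    by (simp add: h_def zero_mod_mult_iff)
qed

text \<open>
  The method of Stepanov needs polynomials that do not vanish at \<open>0\<close>. So the count is translated by a \<open>c\<close> at which neither
  \<open>f(x)\<close> nor \<open>f(x + t)\<close> vanishes.
\<close>

lemma pair_count:
  fixes k g D L B :: nat
  assumes lc: "\<not> p dvd lead_coeff f" and d1: "1 \<le> degree f"
    and bez: "u * f + v * pderiv f = [:R:]" "\<not> p dvd R" and t: "\<not> p dvd t"
    and kg: "int k * int g = p - 1" and k: "1 \<le> k" and D: "1 \<le> D"
    and L: "L = k\<^sup>2 * D - 1" and B: "B = k\<^sup>2 * D * (D + 2 * degree f * L) + 1"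
    and large1: "2 ^ k\<^sup>2 * (B + 2 * degree f) + k\<^sup>2 < nat p"
    and large2: "k * (2 ^ k\<^sup>2 * (B + 2 * degree f) + 1) < nat p"
  shows "L * card {x \<in> {0..<p}. [poly f x ^ g = z1] (mod p) \<and> [poly f (x + t) ^ g = z2] (mod p)}
      \<le> 2 * degree f * L + 2 * degree f * ((k - 1) * g) + B + nat p * D"
    (is "L * card ?Z \<le> _")
proof -
  have "1 * (2 * degree f) \<le> 2 ^ k\<^sup>2 * (B + 2 * degree f)" by (intro mult_le_mono) auto
  then have dp: "2 * degree f < nat p" using large1 by linarith
  then have "int (degree f) < p" "0 < int (degree f)" using d1 by linarith+
  then have d: "\<not> p dvd int (degree f)" using zdvd_not_zless by blast
  obtain c where c: "\<not> p dvd poly f c" "\<not> p dvd poly f (c + t)"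
    using exists_common_nonroot[OF lc dp] by blast
  define f1 where "f1 = f \<circ>\<^sub>p [:c, 1:]"
  define f2 where "f2 = f \<circ>\<^sub>p [:c + t, 1:]"
  obtain q1 where q1: "separating q1 f1 f2"
    using separating_translates[OF lc d bez t, of c] by (auto simp: f1_def f2_def)
  have "\<not> p dvd - t" using t by simp
  then obtain q2 where q2: "separating q2 f2 f1"
    using separating_translates[OF lc d bez, of "- t" "c + t"] by (auto simp: f1_def f2_def)
  define Y where "Y = (\<lambda>x. (x - c) mod p) ` ?Z"
  have cardY: "card Y = card ?Z"
    unfolding Y_def
  proof (rule card_image, rule inj_onI)
    fix x y assume xy: "x \<in> ?Z" "y \<in> ?Z" "(x - c) mod p = (y - c) mod p"
    then have "p dvd x - y" by (simp add: mod_eq_dvd_iff)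
    then have "x mod p = y mod p" by (simp add: mod_eq_dvd_iff)
    then show "x = y" using xy by simp
  qed
  have shift: "[poly (f \<circ>\<^sub>p [:c + s, 1:]) ((x - c) mod p) = poly f (x + s)] (mod p)" for s x
  proof -
    have "[c + s + (x - c) mod p = c + s + (x - c)] (mod p)" by (intro cong_add cong_refl) simp
    then have "[(x - c) mod p + (c + s) = x + s] (mod p)" by (simp add: algebra_simps)
    then show ?thesis using poly_cong_mod by (simp add: poly_pcompose algebra_simps)
  qed
  have "L * card Y \<le> 2 * degree f * L + 2 * degree f * ((k - 1) * g) + B + nat p * D"
  proof (rule stepanov_bound[OF q1 q2 _ _ _ _ kg k D L B large1 large2])
    show "degree f1 \<le> degree f" "degree f2 \<le> degree f" by (simp_all add: f1_def f2_def degree_pcompose)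
    show "\<not> p dvd poly f1 0" "\<not> p dvd poly f2 0" using c by (simp_all add: f1_def f2_def poly_pcompose)
    show "Y \<subseteq> {0..<p}" using p_pos by (auto simp: Y_def)
    show "[poly f1 y ^ g = z1] (mod p)" if y: "y \<in> Y" for y
    proof -
      obtain x where x: "x \<in> ?Z" "y = (x - c) mod p" using y by (auto simp: Y_def)
      then have "[poly f1 y = poly f x] (mod p)" using shift[of 0 x] by (simp add: f1_def)
      then show ?thesis using x by (metis (no_types, lifting) cong_pow cong_trans mem_Collect_eq)
    qed
    show "[poly f2 y ^ g = z2] (mod p)" if y: "y \<in> Y" for y
    proof -
      obtain x where x: "x \<in> ?Z" "y = (x - c) mod p" using y by (auto simp: Y_def)
      then have "[poly f2 y = poly f (x + t)] (mod p)" using shift[of t x] by (simp add: f2_def)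
      then show ?thesis using x by (metis (no_types, lifting) cong_pow cong_trans mem_Collect_eq)
    qed
  qed
  then show ?thesis by (simp add: cardY)
qed

lemma card_roots_mod_le:
  assumes "\<not> zero_mod f" shows "card {x \<in> {0..<p}. p dvd poly f x} \<le> degree f"
proof (rule ccontr)
  assume "\<not> ?thesis"
  then have "zero_mod f"
    using p_pos by (intro zero_mod_if_many_roots[of "{x \<in> {0..<p}. p dvd poly f x}" 1]) auto
  then show False using assms by simp
qed

text \<open>
  Outside the zeros of \<open>f(x)\<close> and \<open>f(x + 1)\<close>, the pair \<open>(f(x)^g, f(x + 1)^g)\<close> is one of at most \<open>k\<^sup>2\<close> pairs of
  \<open>k\<close>-th roots of unity. Those with first entry different from \<open>1\<close> account for at most \<open>(k - 1) * k * K\<close> of the \<open>x\<close>.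
\<close>

lemma count_lower_bound:
  fixes k g :: nat and K :: real
  assumes lc: "\<not> p dvd lead_coeff f" and kg: "int k * int g = p - 1" and k: "1 \<le> k"
    and K: "\<And>z1 z2. real (card {x \<in> {0..<p}. [poly f x ^ g = z1] (mod p) \<and> [poly f (x + 1) ^ g = z2] (mod p)}) \<le> K"
  shows "real_of_int p - 2 * real (degree f) - real ((k - 1) * k) * K
    \<le> real (card {x \<in> {0..<p}. [poly f x ^ g = 1] (mod p)})"
proof -
  define mu where "mu = {z \<in> {0..<p}. p dvd poly (monom 1 k - 1) z}"
  have mu_iff: "z \<in> mu \<longleftrightarrow> z \<in> {0..<p} \<and> [z ^ k = 1] (mod p)" for z
    by (simp add: mu_def poly_monom cong_iff_dvd_diff)
  have cf: "coeff (monom 1 k - 1 :: int poly) k = 1" using k by (simp add: coeff_monom)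
  have "\<not> zero_mod (monom 1 k - 1)"
    unfolding zero_mod_iff_coeff using cf not_p_dvd_one by metis
  then have "card mu \<le> degree (monom 1 k - 1 :: int poly)"
    unfolding mu_def by (rule card_roots_mod_le)
  also have "\<dots> \<le> k" by (intro degree_diff_le) (auto simp: degree_monom_eq)
  finally have card_mu: "card mu \<le> k" .
  have fin: "finite mu" unfolding mu_def by (rule finite_subset[of _ "{0..<p}"]) auto
  have p1: "1 < p" using prime_p by (rule prime_gt_1_int)
  have one: "1 \<in> mu" using p1 by (simp add: mu_iff)
  define C where "C z1 z2 = {x \<in> {0..<p}. [poly f x ^ g = z1] (mod p) \<and> [poly f (x + 1) ^ g = z2] (mod p)}" for z1 z2
  define h where "h = f \<circ>\<^sub>p [:1, 1:]"
  have lch: "\<not> p dvd lead_coeff h" using lc lead_coeff_translate[of f "degree f" 1]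
    by (simp add: h_def degree_pcompose)
  define Rf where "Rf = {x \<in> {0..<p}. p dvd poly f x}"
  define Rh where "Rh = {x \<in> {0..<p}. p dvd poly h x}"
  define S where "S = {x \<in> {0..<p}. [poly f x ^ g = 1] (mod p)}"
  have power_in: "(y ^ g) mod p \<in> mu" if "\<not> p dvd y" for y
  proof -
    have "[y ^ nat p = y] (mod p)"
    proof -
      have "[(y mod p) ^ nat p = y mod p] (mod p)" using p_pos by (intro fermat_mod) simp
      then show ?thesis by (simp add: cong_def power_mod)
    qed
    moreover have "y ^ nat p = y ^ (g * k) * y"
    proof -
      have "nat p = Suc (g * k)"
      proof -
        have "int (Suc (g * k)) = p" using kg by (simp add: mult.commute)
        then show ?thesis by (metis nat_int)
      qed
      then show ?thesis by (simp add: mult.commute)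
    qed
    ultimately have "p dvd y * (y ^ (g * k) - 1)" by (simp add: cong_iff_dvd_diff algebra_simps)
    then have "p dvd y ^ (g * k) - 1" using that prime_p by (simp add: prime_dvd_mult_iff)
    then have "[((y ^ g) mod p) ^ k = 1] (mod p)"
      by (simp add: cong_iff_dvd_diff[symmetric] power_mult cong_def power_mod)
    then show ?thesis using p_pos by (simp add: mu_iff)
  qed
  have "{0..<p} \<subseteq> Rf \<union> Rh \<union> S \<union> (\<Union>z1\<in>mu - {1}. \<Union>z2\<in>mu. C z1 z2)"
  proof
    fix x assume x: "x \<in> {0..<p}"
    show "x \<in> Rf \<union> Rh \<union> S \<union> (\<Union>z1\<in>mu - {1}. \<Union>z2\<in>mu. C z1 z2)"
    proof (cases "p dvd poly f x \<or> p dvd poly f (x + 1)")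
      case True
      then show ?thesis using x by (auto simp: Rf_def Rh_def h_def poly_pcompose add.commute)
    next
      case False
      then have z: "poly f x ^ g mod p \<in> mu" "poly f (x + 1) ^ g mod p \<in> mu"
        using power_in by auto
      have "x \<in> C (poly f x ^ g mod p) (poly f (x + 1) ^ g mod p)"
        using x by (simp add: C_def)
      moreover have "x \<in> S" if "poly f x ^ g mod p = 1"
        using that x p1 by (simp add: S_def cong_def)
      ultimately show ?thesis using z by blast
    qed
  qed
  moreover have "finite (Rf \<union> Rh \<union> S \<union> (\<Union>z1\<in>mu - {1}. \<Union>z2\<in>mu. C z1 z2))"
    by (rule finite_subset[of _ "{0..<p}"]) (auto simp: Rf_def Rh_def S_def C_def)
  ultimately have "card {0..<p} \<le> card (Rf \<union> Rh \<union> S \<union> (\<Union>z1\<in>mu - {1}. \<Union>z2\<in>mu. C z1 z2))"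
    by (intro card_mono)
  also have "\<dots> \<le> card Rf + card Rh + card S + card (\<Union>z1\<in>mu - {1}. \<Union>z2\<in>mu. C z1 z2)"
    by (meson add_le_mono card_Un_le le_trans order_refl)
  finally have main: "nat p \<le> card Rf + card Rh + card S + card (\<Union>z1\<in>mu - {1}. \<Union>z2\<in>mu. C z1 z2)"
    by simp
  have "card Rf \<le> degree f" "card Rh \<le> degree f"
    unfolding Rf_def Rh_def using card_roots_mod_le[of f] card_roots_mod_le[of h]
      zero_mod_lead_coeff[OF lc] zero_mod_lead_coeff[OF lch] by (simp_all add: h_def degree_pcompose)
  moreover have "real (card (\<Union>z1\<in>mu - {1}. \<Union>z2\<in>mu. C z1 z2)) \<le> real ((k - 1) * k) * K"
  proof -
    have K0: "0 \<le> K" using K[of 0 0] by linarith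
    have "card (\<Union>z1\<in>mu - {1}. \<Union>z2\<in>mu. C z1 z2) \<le> (\<Sum>z1\<in>mu - {1}. card (\<Union>z2\<in>mu. C z1 z2))"
      using fin by (intro card_UN_le) simp
    also have "\<dots> \<le> (\<Sum>z1\<in>mu - {1}. \<Sum>z2\<in>mu. card (C z1 z2))"
      using fin by (intro sum_mono card_UN_le)
    finally have "real (card (\<Union>z1\<in>mu - {1}. \<Union>z2\<in>mu. C z1 z2)) \<le> (\<Sum>z1\<in>mu - {1}. \<Sum>z2\<in>mu. real (card (C z1 z2)))"
      by (simp flip: of_nat_sum)
    also have "\<dots> \<le> (\<Sum>z1\<in>mu - {1}. \<Sum>z2\<in>mu. K)"
      using K by (intro sum_mono) (simp add: C_def)
    also have "\<dots> = real ((card mu - 1) * card mu) * K"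
      using fin one by (simp add: card_Diff_singleton)
    also have "\<dots> \<le> real ((k - 1) * k) * K"
      using card_mu K0 by (intro mult_right_mono of_nat_mono mult_le_mono) auto
    finally show ?thesis .
  qed
  ultimately show ?thesis using main p_pos unfolding S_def[symmetric] by linarith
qed

end

section \<open>Equidistribution of power residues\<close>

text \<open>
  The bound of \<open>pair_count\<close> is \<open>(D + 2 d) / (k\<^sup>2 D - 1)\<close> times \<open>p\<close>, up to a constant. The factor tends to \<open>1 / k\<^sup>2\<close> as \<open>D\<close>
  grows, so \<open>D\<close> is fixed to come within \<open>\<epsilon> / 2\<close>, and \<open>p0\<close> to absorb the constant into the other half.
\<close>

lemma equidistribution:
  fixes f :: "int poly" and k :: nat and \<epsilon> :: real
  assumes d1: "1 \<le> degree f" and bez: "u * f + v * pderiv f = [:R:]" "R \<noteq> 0" and k: "2 \<le> k" and e: "0 < \<epsilon>"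
  shows "\<exists>p0. \<forall>p g. prime p \<and> int k * int g = p - 1 \<and> p0 \<le> p \<longrightarrow>
    \<not> p dvd lead_coeff f \<and>
    (\<forall>t z1 z2. \<not> p dvd t \<longrightarrow>
      real (card {x \<in> {0..<p}. [poly f x ^ g = z1] (mod p) \<and> [poly f (x + t) ^ g = z2] (mod p)})
        \<le> (1 / real k ^ 2 + \<epsilon>) * real_of_int p)"
proof -
  define d where "d = degree f"
  define \<eta> where "\<eta> = real k ^ 2 * \<epsilon> / 2"
  have eta: "0 < \<eta>" using e k by (simp add: \<eta>_def)
  \<comment> \<open>The inequality \<open>ratio\<close> below needs \<open>\<eta> * L \<ge> 2 * d * k\<^sup>2 + 1\<close>, and \<open>L \<ge> D > D0\<close>.\<close>
  obtain D0 :: nat where D0: "(2 * real d * real k ^ 2 + 1) / \<eta> < real D0"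
    using reals_Archimedean2 by blast
  define D where "D = D0 + 1"
  have D: "1 \<le> D" by (simp add: D_def)
  define L where "L = k\<^sup>2 * D - 1"
  define B where "B = k\<^sup>2 * D * (D + 2 * d * L) + 1"
  have k4: "4 \<le> k\<^sup>2" using power_mono[of 2 k 2] k by simp
  then have kD: "4 * D \<le> k\<^sup>2 * D" by simp
  then have L1: "D \<le> L" unfolding L_def using D by linarith
  then have L0: "0 < real L" using D by simp
  have Lr: "real L = real k ^ 2 * real D - 1"
    using kD D by (simp add: L_def of_nat_diff)
  have "2 * real d * real k ^ 2 + 1 \<le> \<eta> * real L"
  proof -
    have "2 * real d * real k ^ 2 + 1 < real D0 * \<eta>" using D0 eta by (simp add: pos_divide_less_eq)
    also have "\<dots> \<le> real L * \<eta>" using L1 eta by (intro mult_right_mono) (auto simp: D_def)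
    finally show ?thesis by (simp add: mult.commute)
  qed
  moreover have "real k ^ 2 * (real D + 2 * real d) = real L + (2 * real d * real k ^ 2 + 1)"
    using Lr by (simp add: algebra_simps)
  ultimately have "real k ^ 2 * (real D + 2 * real d) \<le> (1 + \<eta>) * real L"
    unfolding distrib_right by linarith
  also have "\<dots> = real k ^ 2 * ((1 / real k ^ 2 + \<epsilon> / 2) * real L)"
    using k by (simp add: \<eta>_def field_simps)
  finally have ratio: "real D + 2 * real d \<le> (1 / real k ^ 2 + \<epsilon> / 2) * real L"
    using k by simp
  define c where "c = 2 * d * L + B"
  obtain P0 :: nat where P0: "2 * real c / \<epsilon> < real P0" using reals_Archimedean2 by blast
  define m where "m = 2 ^ k\<^sup>2 * (B + 2 * d) + k\<^sup>2"
  define m' where "m' = k * (2 ^ k\<^sup>2 * (B + 2 * d) + 1)"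
  define p0 where "p0 = 1 + \<bar>R\<bar> + \<bar>lead_coeff f\<bar> + int m + int m' + int P0"
  show ?thesis
  proof (intro exI[of _ p0] allI impI conjI; elim conjE)
    fix p g assume p: "prime p" "int k * int g = p - 1" "p0 \<le> p"
    interpret prime_modulus p by standard (rule p(1))
    have small: "\<not> p dvd a" if "a \<noteq> 0" "\<bar>a\<bar> < p0" for a
      using that p(3) zdvd_imp_le[of p "\<bar>a\<bar>"] by auto
    have "lead_coeff f \<noteq> 0" using d1 by auto
    then show lc: "\<not> p dvd lead_coeff f" by (rule small) (simp add: p0_def)
    have R: "\<not> p dvd R" by (rule small[OF bez(2)]) (simp add: p0_def)
    fix t z1 z2 assume t: "\<not> p dvd t"
    let ?Z = "{x \<in> {0..<p}. [poly f x ^ g = z1] (mod p) \<and> [poly f (x + t) ^ g = z2] (mod p)}"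
    have "L * card ?Z \<le> 2 * degree f * L + 2 * degree f * ((k - 1) * g) + B + nat p * D"
    proof (rule pair_count[OF lc d1 bez(1) R t p(2) _ D])
      show "L = k\<^sup>2 * D - 1" "B = k\<^sup>2 * D * (D + 2 * degree f * L) + 1"
        by (simp_all add: L_def B_def d_def)
      have "int m < p" "int m' < p" using p(3) by (simp_all add: p0_def)
      then show "2 ^ k\<^sup>2 * (B + 2 * degree f) + k\<^sup>2 < nat p"
        "k * (2 ^ k\<^sup>2 * (B + 2 * degree f) + 1) < nat p"
        unfolding m_def m'_def d_def by linarith+
    qed (use k in auto)
    also have "\<dots> \<le> c + nat p * (D + 2 * d)"
    proof -
      have "(k - 1) * g \<le> k * g" by (intro mult_le_mono1) simp
      moreover have "int (k * g) = p - 1" using p(2) by simp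
      ultimately have "(k - 1) * g \<le> nat p" by linarith
      then have "2 * d * ((k - 1) * g) \<le> 2 * d * nat p" by (rule mult_le_mono2)
      then show ?thesis by (simp add: c_def d_def algebra_simps)
    qed
    finally have "real (L * card ?Z) \<le> real (c + nat p * (D + 2 * d))" by (simp only: of_nat_le_iff)
    then have "real L * real (card ?Z) \<le> real c + real_of_int p * (real D + 2 * real d)"
      using p_pos by simp
    also have "\<dots> \<le> real_of_int p * (\<epsilon> / 2) * real L + real_of_int p * ((1 / real k ^ 2 + \<epsilon> / 2) * real L)"
    proof (intro add_mono mult_left_mono ratio)
      have "real P0 \<le> real_of_int p" using p(3) by (simp add: p0_def)
      then have "real P0 * \<epsilon> \<le> real_of_int p * \<epsilon>" using e by (intro mult_right_mono) auto
      moreover have "2 * real c < real P0 * \<epsilon>" using P0 e by (simp add: pos_divide_less_eq)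
      ultimately have "real c \<le> real_of_int p * (\<epsilon> / 2) * 1" by simp
      also have "\<dots> \<le> real_of_int p * (\<epsilon> / 2) * real L"
        using L1 D e p_pos by (intro mult_left_mono) auto
      finally show "real c \<le> real_of_int p * (\<epsilon> / 2) * real L" .
    qed (use p_pos in auto)
    also have "\<dots> = real L * ((1 / real k ^ 2 + \<epsilon>) * real_of_int p)" by (simp add: algebra_simps)
    finally show "real (card ?Z) \<le> (1 / real k ^ 2 + \<epsilon>) * real_of_int p"
      using L0 by simp
  qed
qed

section \<open>The discriminant and the set of k-th powers\<close>

lemma of_int_poly_mult: "complex_of_int_poly (a * b) = complex_of_int_poly a * complex_of_int_poly b"
  by (intro poly_eqI) (simp add: coeff_map_poly coeff_mult)

lemma of_int_poly_pderiv: "complex_of_int_poly (pderiv a) = pderiv (complex_of_int_poly a)"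
  by (intro poly_eqI) (simp add: coeff_map_poly coeff_pderiv)

lemma of_int_poly_smult: "complex_of_int_poly (smult c a) = smult (of_int c) (complex_of_int_poly a)"
  by (intro poly_eqI) (simp add: coeff_map_poly)

lemma no_multiple_root:
  assumes d: "1 \<le> degree f" and disc: "discrim f \<noteq> 0"
  shows "\<not> (poly (complex_of_int_poly f) \<beta> = 0 \<and> poly (pderiv (complex_of_int_poly f)) \<beta> = 0)"
proof
  let ?F = "complex_of_int_poly f"
  assume root: "poly ?F \<beta> = 0 \<and> poly (pderiv ?F) \<beta> = 0"
  have dF: "degree ?F = degree f" by (simp add: degree_map_poly)
  then have F0: "?F \<noteq> 0" "pderiv ?F \<noteq> 0" using d by (auto simp: pderiv_eq_0_iff)
  have "Polynomial.order \<beta> ?F = Suc (Polynomial.order \<beta> (pderiv ?F))" using order_pderiv F0 root by blast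
  moreover have "Polynomial.order \<beta> (pderiv ?F) \<noteq> 0" using root F0 by (simp add: order_root)
  ultimately have "2 \<le> count (mset (root_list f)) \<beta>" using F0 by (simp add: mset_root_list)
  moreover have "count (mset (root_list f)) \<beta> \<le> 1" if "distinct (root_list f)"
    using that distinct_count_atmost_1[of "root_list f"] by simp
  ultimately have "\<not> distinct (root_list f)" by linarith
  then obtain i j where ij: "i < j" "j < degree f" "root_list f ! i = root_list f ! j"
    unfolding distinct_conv_nth length_root_list by (metis nat_neq_iff)
  have "finite {(i, j). i < j \<and> j < degree f}"
    by (rule finite_subset[of _ "{..<degree f} \<times> {..<degree f}"]) auto
  then have "(\<Prod>(i, j) \<in> {(i, j). i < j \<and> j < degree f}. (root_list f ! j - root_list f ! i)\<^sup>2) = 0"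
    using ij by (intro prod_zero bexI[of _ "(i, j)"]) auto
  then show False using disc by (simp add: discrim_def)
qed

text \<open>
  A nonzero element of least degree in the ideal generated by \<open>f\<close> and its derivative divides integer multiples of both, by
  pseudo-division. A complex root of it would be a multiple root of \<open>f\<close>.
\<close>

lemma bezout_of_discrim:
  assumes d: "1 \<le> degree f" and disc: "discrim f \<noteq> 0"
  shows "\<exists>u v R. u * f + v * pderiv f = [:R:] \<and> R \<noteq> 0"
proof -
  define I where "I z \<longleftrightarrow> z \<noteq> 0 \<and> (\<exists>u v. z = u * f + v * pderiv f)" for z
  have "f \<noteq> 0" using d by auto
  then have "I f" unfolding I_def by (metis add.right_neutral mult_1 mult_zero_left)
  then have "\<exists>z. I z \<and> (\<forall>w. I w \<longrightarrow> degree z \<le> degree w)" by (rule ex_has_least_nat)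
  then obtain z where z: "I z" and least: "\<And>w. I w \<Longrightarrow> degree z \<le> degree w" by blast
  obtain u v where uv: "z = u * f + v * pderiv f" and z0: "z \<noteq> 0" using z by (auto simp: I_def)
  have divides: "\<exists>c q. c \<noteq> 0 \<and> smult c w = z * q" if w: "w = u' * f + v' * pderiv f" for w u' v'
  proof -
    obtain c q where cq: "c \<noteq> 0" "smult c w = z * q + pseudo_mod w z"
      using pseudo_mod(1)[OF z0, of w] by blast
    have "pseudo_mod w z = smult c w - z * q" using cq by simp
    also have "\<dots> = (smult c u' - q * u) * f + (smult c v' - q * v) * pderiv f"
      unfolding w uv by (simp add: algebra_simps smult_add_right)
    finally have "pseudo_mod w z = 0 \<or> I (pseudo_mod w z)" unfolding I_def by blast
    then have "pseudo_mod w z = 0" using least pseudo_mod(2)[OF z0, of w] by fastforce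
    then show ?thesis using cq by auto
  qed
  have "degree z = 0"
  proof (rule ccontr)
    assume "degree z \<noteq> 0"
    let ?Z = "complex_of_int_poly z"
    have "degree ?Z \<noteq> 0" using \<open>degree z \<noteq> 0\<close> by (simp add: degree_map_poly)
    then have "\<not> constant (poly ?Z)" by (simp add: constant_degree)
    then obtain \<beta> where \<beta>: "poly ?Z \<beta> = 0" using fundamental_theorem_of_algebra by blast
    have root: "poly (complex_of_int_poly w) \<beta> = 0" if w: "w = u' * f + v' * pderiv f" for w u' v'
    proof -
      obtain c q where cq: "c \<noteq> 0" "smult c w = z * q" using divides[OF w] by blast
      have "smult (of_int c) (complex_of_int_poly w) = ?Z * complex_of_int_poly q"
        using cq(2) by (metis of_int_poly_mult of_int_poly_smult)
      then have "of_int c * poly (complex_of_int_poly w) \<beta> = poly ?Z \<beta> * poly (complex_of_int_poly q) \<beta>"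
        by (metis poly_mult poly_smult)
      then show ?thesis using \<beta> cq(1) by simp
    qed
    show False
      using no_multiple_root[OF d disc, of \<beta>] root[of f 1 0] root[of "pderiv f" 0 1]
      by (simp add: of_int_poly_pderiv)
  qed
  then obtain R where R: "z = [:R:]" by (blast elim: degree_eq_zeroE)
  then have "R \<noteq> 0" using z0 by auto
  then show ?thesis using uv R by metis
qed

lemma D_powers_eq:
  assumes "prime p"
  shows "D_powers k p = {x ^ k mod int p | x. x \<in> {1..int p - 1}}"
proof -
  interpret residues_prime p "Fp p"
    using assms by unfold_locales auto
  have pow: "x [^]\<^bsub>Fp p\<^esub> k = x ^ k mod int p" if "x \<in> {1..int p - 1}" for x
    using pow_cong[of x k] that by simp
  have units: "carrier (Fp p) - {\<zero>\<^bsub>Fp p\<^esub>} = {1..int p - 1}"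
    by (auto simp: res_carrier_eq res_zero_eq)
  have "D_powers k p = (\<lambda>x. x [^]\<^bsub>Fp p\<^esub> k) ` {1..int p - 1}"
    unfolding D_powers_def units by blast
  also have "\<dots> = (\<lambda>x. x ^ k mod int p) ` {1..int p - 1}" by (rule image_cong[OF refl pow])
  finally show ?thesis by blast
qed

text \<open>
  Fermat's theorem for one direction, a primitive root for the other.
\<close>

lemma D_powers_iff:
  assumes p: "prime p" and kg: "k * g = p - 1"
  shows "a mod int p \<in> D_powers k p \<longleftrightarrow> [a ^ g = 1] (mod int p)"
proof
  assume "a mod int p \<in> D_powers k p"
  then obtain x where x: "x \<in> {1..int p - 1}" "a mod int p = x ^ k mod int p"
    unfolding D_powers_eq[OF p] by auto
  have "[a ^ g = (x ^ k) ^ g] (mod int p)" using x(2) by (intro cong_pow) (simp add: cong_def)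
  also have "(x ^ k) ^ g = int (nat x ^ (p - 1))" using x by (simp add: kg flip: power_mult)
  also have "[\<dots> = int 1] (mod int p)"
  proof -
    have "\<not> p dvd nat x" using x by (intro nat_dvd_not_less) auto
    then have "[nat x ^ (p - 1) = 1] (mod p)" using p by (intro fermat_theorem)
    then show ?thesis by (simp only: cong_int_iff)
  qed
  finally show "[a ^ g = 1] (mod int p)" by simp
next
  assume a: "[a ^ g = 1] (mod int p)"
  have p1: "1 < p" using p prime_gt_1_nat by blast
  have kg0: "0 < g" "0 < k" using kg p1 by (auto intro!: Nat.gr0I)
  define b where "b = nat (a mod int p)"
  have b: "int b = a mod int p" using p1 by (simp add: b_def)
  have "[int b ^ g = a ^ g] (mod int p)" unfolding b by (intro cong_pow) simp
  then have "[int (b ^ g) = int 1] (mod int p)" using a cong_trans by simp blast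
  then have bg: "[b ^ g = 1] (mod p)" by (simp only: cong_int_iff)
  have "\<not> p dvd b"
  proof
    assume "p dvd b"
    then have "p dvd b ^ g" using kg0 by (simp add: dvd_power_le dvd_trans)
    then have "p dvd 1" using bg cong_dvd_iff by blast
    then show False using p1 by simp
  qed
  have "int b < int p" using p1 unfolding b by simp
  then have "b < p" by simp
  then have "b \<in> totatives p" using p \<open>\<not> p dvd b\<close>
    by (auto simp: totatives_prime intro!: Nat.gr0I)
  obtain r where r: "residue_primroot p r" using prime_primitive_root_exists[of p] p p1 by auto
  then obtain i where i: "b = r ^ i mod p"
    using residue_primroot_is_generator[OF p1 r] \<open>b \<in> totatives p\<close> unfolding bij_betw_def by auto
  have "[r ^ (i * g) = 1] (mod p)"
    using bg i by (simp add: power_mult cong_def power_mod)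
  then have "k * g dvd i * g"
  proof -
    have "ord p r dvd i * g" using \<open>[r ^ (i * g) = 1] (mod p)\<close> ord_divides by blast
    moreover have "ord p r = k * g" using r p by (simp add: residue_primroot_def totient_prime kg)
    ultimately show ?thesis by simp
  qed
  then have "k dvd i" using kg0 by simp
  then obtain j where j: "i = j * k" by (metis dvd_def mult.commute)
  define x where "x = r ^ j mod p"
  have "\<not> p dvd r"
  proof
    assume "p dvd r"
    moreover have "coprime p r" using r by (simp add: residue_primroot_def)
    ultimately have "is_unit p" by (simp add: coprime_absorb_left)
    then show False using p1 by simp
  qed
  then have "\<not> p dvd r ^ j" using p prime_dvd_power by blast
  then have "x \<noteq> 0" by (simp add: x_def dvd_eq_mod_eq_0)
  moreover have "x < p" using p1 by (simp add: x_def)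
  ultimately have "int x \<in> {1..int p - 1}" by auto
  moreover have "a mod int p = int x ^ k mod int p"
  proof -
    have "x ^ k mod p = b" unfolding x_def i j by (simp add: power_mod power_mult)
    then show ?thesis using b by (metis of_nat_mod of_nat_power)
  qed
  ultimately show "a mod int p \<in> D_powers k p" unfolding D_powers_eq[OF p] by blast
qed

section \<open>Hamilton cycles in the power residue sum graph\<close>

theorem theorem1p1:
  fixes f :: "int poly" and k :: nat
  assumes "degree f \<ge> 1" and "discrim f \<noteq> 0" and "k \<ge> 2"
  shows "\<exists>p\<^sub>0 :: nat. \<forall>p :: nat. prime p \<and> [p = 1] (mod k) \<and> p \<ge> p\<^sub>0 \<longrightarrow>
    (\<forall>A. A \<subseteq> carrier (Fp p) \<and> int (card A) \<ge> c_bound p k f \<longrightarrow>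
      (\<exists>a :: nat \<Rightarrow> int. bij_betw a {1..card A} A \<and>
        (\<forall>i \<in> {1..<card A}. eval_Fp p f (a i \<oplus>\<^bsub>Fp p\<^esub> a (i + 1)) \<in> D_powers k p) \<and>
        eval_Fp p f (a (card A) \<oplus>\<^bsub>Fp p\<^esub> a 1) \<in> D_powers k p))"
proof -
  define x where "x = 1 / real k"
  have x: "0 < x" "x \<le> 1 / 2" using assms(3) by (auto simp: x_def field_simps)
  obtain u v R where bez: "u * f + v * pderiv f = [:R:]" "R \<noteq> 0"
    using bezout_of_discrim[OF assms(1,2)] by blast
  have "0 < x ^ 5 / 1000" using x by simp
  from equidistribution[OF assms(1) bez assms(3) this] obtain P1 where
    P1: "\<And>p g. prime p \<Longrightarrow> int k * int g = p - 1 \<Longrightarrow> P1 \<le> p \<Longrightarrow> \<not> p dvd lead_coeff f \<and>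
    (\<forall>t z1 z2. \<not> p dvd t \<longrightarrow>
      real (card {x \<in> {0..<p}. [poly f x ^ g = z1] (mod p) \<and> [poly f (x + t) ^ g = z2] (mod p)})
        \<le> (1 / real k ^ 2 + x ^ 5 / 1000) * real_of_int p)"
    by blast
  have k2: "1 / real k ^ 2 = x\<^sup>2" by (simp add: x_def power_divide)
  \<comment> \<open>The thresholds \<open>P2\<close> and \<open>P3\<close> serve the size condition of the sum graph lemma and the \<open>2 * degree f\<close> zeros in the lower bound for \<open>N\<close>.\<close>
  obtain P2 :: nat where P2: "32000 / x ^ 7 < real P2" using reals_Archimedean2 by blast
  obtain P3 :: nat where P3: "2 * real (degree f) / (x ^ 4 / 1000) < real P3" using reals_Archimedean2 by blast
  show ?thesis
  proof (intro exI[of _ "nat \<bar>P1\<bar> + P2 + P3"] allI impI; elim conjE)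
    fix p :: nat and A :: "int set"
    assume p: "prime p" and pk: "[p = 1] (mod k)" and large: "nat \<bar>P1\<bar> + P2 + P3 \<le> p"
      and A: "A \<subseteq> carrier (Fp p)" and cA: "c_bound p k f \<le> int (card A)"
    have p1: "1 < p" using p prime_gt_1_nat by blast
    have pi: "prime (int p)" using p by simp
    interpret prime_modulus "int p" by standard (rule pi)
    interpret rp: residues_prime p "Fp p" using p by unfold_locales auto
    have carrier: "carrier (Fp p) = {0..<int p}" by (auto simp: rp.res_carrier_eq)
    have "k dvd p - 1" using pk p1 by (metis cong_to_1_nat)
    then obtain g where g: "p - 1 = k * g" by (elim dvdE)
    then have kg: "int k * int g = int p - 1" using p1 by (simp flip: of_nat_mult)
    have lc: "\<not> int p dvd lead_coeff f" and
      K: "\<And>t z1 z2. \<not> int p dvd t \<Longrightarrow>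
      real (card {x \<in> {0..<int p}. [poly f x ^ g = z1] (mod int p) \<and> [poly f (x + t) ^ g = z2] (mod int p)})
        \<le> (x\<^sup>2 + x ^ 5 / 1000) * real p"
      using P1[OF pi kg] large k2 by auto
    define P where "P y \<longleftrightarrow> [poly f y ^ g = 1] (mod int p)" for y
    have per: "periodic (int p) P"
      unfolding periodic_def
    proof
      fix y
      have "[poly f (y mod int p) ^ g = poly f y ^ g] (mod int p)"
        by (intro cong_pow poly_cong_mod) simp
      then show "P (y mod int p) = P y" unfolding P_def by (meson cong_sym cong_trans)
    qed
    have D_iff: "eval_Fp p f (y mod int p) \<in> D_powers k p \<longleftrightarrow> P y" for y
    proof -
      have "y mod int p \<in> carrier (Fp p)" using p1 by (simp add: carrier)
      then have "eval_Fp p f (y mod int p) = poly f (y mod int p) mod int p" by (rule eval_Fp_eq[OF p])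
      then have "eval_Fp p f (y mod int p) \<in> D_powers k p \<longleftrightarrow> P (y mod int p)"
        using D_powers_iff[OF p g[symmetric]] by (simp add: P_def)
      then show ?thesis using per by (simp add: periodic_def)
    qed
    define N where "N = card {y \<in> {0..<int p}. P y}"
    have N_count: "N_count p k f = N"
    proof -
      have "eval_Fp p f y \<in> D_powers k p \<longleftrightarrow> P y" if "y \<in> {0..<int p}" for y
        using D_iff[of y] that by simp
      then have "{x \<in> carrier (Fp p). eval_Fp p f x \<in> D_powers k p} = {y \<in> {0..<int p}. P y}"
        unfolding carrier by blast
      then show ?thesis by (simp add: N_count_def N_def)
    qed
    have cardA: "card A \<le> p" using card_mono[of "{0..<int p}" A] A carrier by simp
    have "N \<le> card {0..<int p}" unfolding N_def by (intro card_mono) auto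
    then have "N \<le> p" by simp
    \<comment> \<open>As \<open>N \<le> p\<close>, the floor in \<open>c_bound\<close> is at least \<open>1\<close>. If \<open>N = 0\<close>, no set is large enough.\<close>
    have "int p + 3 \<le> int (card A) + int N"
    proof -
      have "N \<noteq> 0"
      proof
        assume "N = 0"
        then have "c_bound p k f = int p + 2" by (simp add: c_bound_def N_count)
        then show False using cA cardA by simp
      qed
      have "1 \<le> Lambda_bound p k f" using assms(3) by (simp add: Lambda_bound_def)
      then have "2 * real p * 1 \<le> 2 * real p * Lambda_bound p k f" by (intro mult_left_mono) auto
      moreover have "1 * real N \<le> 2 * real p" using \<open>N \<le> p\<close> by simp
      ultimately have "1 * real N \<le> 2 * real p * Lambda_bound p k f" by linarith
      then have "1 \<le> 2 * real p * Lambda_bound p k f / real N"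
        using \<open>N \<noteq> 0\<close> by (subst pos_le_divide_eq) auto
      then have "1 \<le> \<lfloor>2 * real p * Lambda_bound p k f / real N\<rfloor>" by simp
      then show ?thesis using cA unfolding c_bound_def N_count by linarith
    qed
    moreover have "(x - x ^ 3 / 1000) * real_of_int (int p) \<le> real N"
    proof -
      have "real_of_int (int p) - 2 * real (degree f) - real ((k - 1) * k) * ((x\<^sup>2 + x ^ 5 / 1000) * real p)
          \<le> real (card {x \<in> {0..<int p}. [poly f x ^ g = 1] (mod int p)})"
        using assms(3) p1 by (intro count_lower_bound[OF lc kg] K) (auto simp: prime_p not_p_dvd_one)
      moreover have "real ((k - 1) * k) * ((x\<^sup>2 + x ^ 5 / 1000) * real p) =
          (1 - x + x ^ 3 / 1000 - x ^ 4 / 1000) * real p"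
      proof -
        have kx: "real k * x = 1" using assms(3) by (simp add: x_def)
        have "real ((k - 1) * k) = real k * real k - real k" using assms(3) by (simp add: of_nat_diff algebra_simps)
        moreover have "(real k * real k - real k) * (x\<^sup>2 + x ^ 5 / 1000) = 1 - x + x ^ 3 / 1000 - x ^ 4 / 1000"
          using assms(3) by (simp add: x_def field_simps eval_nat_numeral)
        ultimately show ?thesis by (simp add: mult.assoc[symmetric])
      qed
      moreover have "2 * real (degree f) \<le> x ^ 4 / 1000 * real p"
      proof -
        have "2 * real (degree f) < real P3 * (x ^ 4 / 1000)"
          using P3 x by (subst (asm) pos_divide_less_eq) auto
        also have "\<dots> \<le> real p * (x ^ 4 / 1000)" using large x by (intro mult_right_mono) auto
        finally show ?thesis by (simp add: mult.commute)
      qed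
      ultimately show ?thesis by (simp add: N_def P_def algebra_simps)
    qed
    moreover have "32000 \<le> real_of_int (int p) * x ^ 7"
    proof -
      have "32000 < real P2 * x ^ 7" using P2 x by (subst (asm) pos_divide_less_eq) auto
      also have "\<dots> \<le> real p * x ^ 7" using large x by (intro mult_right_mono) auto
      finally show ?thesis by simp
    qed
    ultimately obtain xs where cyc: "is_cycle (\<lambda>u v. u \<noteq> v \<and> P (u + v)) xs" and xs: "set xs = A"
      using hamiltonian_sum_graph[OF per x, of A] K A carrier by (auto simp: N_def P_def)
    have dist: "distinct xs" and len: "3 \<le> length xs" using cyc by (auto simp: is_cycle_def)
    have lenA: "length xs = card A" using distinct_card[OF dist] xs by simp
    define a where "a i = xs ! (i - 1)" for i
    have edge: "P (xs ! i + xs ! Suc i)" if "Suc i < length xs" for i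
      using cyc that by (auto simp: is_cycle_def successively_conv_nth)
    have closing: "P (xs ! (length xs - 1) + xs ! 0)"
    proof -
      have "xs \<noteq> []" using len by auto
      then have "last xs = xs ! (length xs - 1)" "hd xs = xs ! 0"
        by (simp_all add: last_conv_nth hd_conv_nth)
      moreover have "P (last xs + hd xs)" using cyc by (simp add: is_cycle_def)
      ultimately show ?thesis by simp
    qed
    show "\<exists>a :: nat \<Rightarrow> int. bij_betw a {1..card A} A \<and>
        (\<forall>i \<in> {1..<card A}. eval_Fp p f (a i \<oplus>\<^bsub>Fp p\<^esub> a (i + 1)) \<in> D_powers k p) \<and>
        eval_Fp p f (a (card A) \<oplus>\<^bsub>Fp p\<^esub> a 1) \<in> D_powers k p"
    proof (intro exI[of _ a] conjI ballI)
      have "bij_betw ((!) xs) {..<length xs} (set xs)" using dist by (rule bij_betw_nth) auto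
      moreover have "bij_betw (\<lambda>i. i - 1) {1..card A} {..<length xs}"
        by (rule bij_betw_byWitness[where f' = Suc]) (auto simp: lenA)
      ultimately have "bij_betw ((!) xs \<circ> (\<lambda>i. i - 1)) {1..card A} (set xs)" by (rule bij_betw_trans[rotated])
      then show "bij_betw a {1..card A} A" by (simp add: a_def[abs_def] comp_def xs)
      show "eval_Fp p f (a i \<oplus>\<^bsub>Fp p\<^esub> a (i + 1)) \<in> D_powers k p" if "i \<in> {1..<card A}" for i
        using edge[of "i - 1"] that lenA by (simp add: rp.res_add_eq D_iff a_def)
      show "eval_Fp p f (a (card A) \<oplus>\<^bsub>Fp p\<^esub> a 1) \<in> D_powers k p"
        using closing lenA by (simp add: rp.res_add_eq D_iff a_def)
    qed
  qed
qed

end
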